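(* Let $K$ be an algebraically closed field, let $n\geq 4$, let $X$ be an $n\times n$ matrix of indeterminates, and let $\mathfrak P_{n-1}\subseteq K[X]$ be the ideal generated by the $(n-1)\times(n-1)$ principal minors of $X$. Then the minimal primes of $\mathfrak P_{n-1}$ are exactly $\mathrm I_{n-1}$ and $\mathfrak Q_{n-1}$. In other words, $\mathscr V(\mathfrak P_{n-1})$ has two irreducible components: one is defined by the determinantal ideal $\mathrm I_{n-1}$, and the other is the Zariski closure of the locally closed set $\mathscr Y_{n,n,n-1}$, which has codimension $n$.
   Context: $K[X]$ is the polynomial ring over $K$ in the $n^2$ entries of $X$. A minor is principal if it is defined by the same row and column indices. $\mathscr V(\cdot)$ denotes the vanishing locus in $\operatorname{Spec}K[X]$ (affine space of $n\times n$ matrices). $\mathrm I_{n-1}\subseteq K[X]$ is the determinantal ideal generated by all $(n-1)\times(n-1)$ minors of $X$. Put $\Delta=\det X$ and $S_\Delta=K[X][\frac1\Delta]$; $\mathfrak Q_{n-1}$ is the contraction to $K[X]$ of the ideal $\mathfrak P_{n-1}S_\Delta$, i.e. $\mathfrak Q_{n-1}=\mathfrak P_{n-1}:_{K[X]}\Delta^\infty$. $\mathscr Y_{n,n,n-1}$ is the locally closed set of matrices of rank exactly $n$ in $\mathscr V(\mathfrak P_{n-1})$; $\mathfrak Q_{n-1}$ is the defining ideal of its Zariski closure. *)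

theory Defs
  imports
    "HOL-Analysis.Abstract_Topology"
    "HOL-Algebra.Ideal"
    "HOL-Computational_Algebra.Polynomial"
    "HOL-Library.Poly_Mapping"
    "HOL-Library.Extended_Nat"
    "Jordan_Normal_Form.Determinant"
    "Jordan_Normal_Form.DL_Submatrix"
begin

section \<open>Polynomial rings\<close>

text \<open>
  Polynomials over \<open>'k\<close> in indeterminates from \<open>'x\<close> form the monoid algebra of the finitely
  supported exponent vectors. The polynomial ring in a set \<open>V\<close> of indeterminates is the subring
  of those polynomials all of whose monomials are supported in \<open>V\<close>.
\<close>

type_synonym ('x, 'k) mpoly = "('x \<Rightarrow>\<^sub>0 nat) \<Rightarrow>\<^sub>0 'k"

definition indets :: "('x, 'k::zero) mpoly \<Rightarrow> 'x set" where
  "indets f = (\<Union>m \<in> Poly_Mapping.keys f. Poly_Mapping.keys m)"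

definition Var :: "'x \<Rightarrow> ('x, 'k::zero_neq_one) mpoly" where
  "Var x = Poly_Mapping.single (Poly_Mapping.single x 1) 1"

definition poly_ring :: "'x set \<Rightarrow> ('x, 'k::comm_ring_1) mpoly ring" where
  "poly_ring V =
     \<lparr>carrier = {f. indets f \<subseteq> V}, monoid.mult = (*), one = 1, zero = 0, add = (+)\<rparr>"

lemma indets_add: "indets (f + g) \<subseteq> indets f \<union> indets (g :: ('x, 'k::comm_ring_1) mpoly)"
  using Poly_Mapping.keys_add[of f g] unfolding indets_def by blast

lemma indets_mult: "indets (f * g) \<subseteq> indets f \<union> indets (g :: ('x, 'k::comm_ring_1) mpoly)"
proof
  fix x assume "x \<in> indets (f * g)"
  then obtain m where m: "m \<in> Poly_Mapping.keys (f * g)" "x \<in> Poly_Mapping.keys m"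
    unfolding indets_def by blast
  from m(1) obtain a b where ab: "m = a + b" "a \<in> Poly_Mapping.keys f" "b \<in> Poly_Mapping.keys g"
    using Poly_Mapping.keys_mult[of f g] by blast
  with m(2) have "x \<in> Poly_Mapping.keys a \<union> Poly_Mapping.keys b"
    using Poly_Mapping.keys_add[of a b] by blast
  with ab show "x \<in> indets f \<union> indets g"
    unfolding indets_def by blast
qed

lemma indets_uminus: "indets (- f) = indets (f :: ('x, 'k::comm_ring_1) mpoly)"
  by (simp add: indets_def)

lemma indets_0 [simp]: "indets 0 = {}" and indets_1 [simp]: "indets 1 = {}"
  by (simp_all add: indets_def flip: single_one)

lemma poly_ring_simps:
  "f \<in> carrier (poly_ring V) \<longleftrightarrow> indets f \<subseteq> V" "x \<otimes>\<^bsub>poly_ring V\<^esub> y = x * y"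
  "x \<oplus>\<^bsub>poly_ring V\<^esub> y = x + y" "\<one>\<^bsub>poly_ring V\<^esub> = 1" "\<zero>\<^bsub>poly_ring V\<^esub> = 0"
  by (simp_all add: poly_ring_def)

lemma cring_poly_ring: "cring (poly_ring V :: ('x, 'k::comm_ring_1) mpoly ring)"
proof (rule cringI)
  show "abelian_group (poly_ring V :: ('x, 'k) mpoly ring)"
  proof (rule abelian_groupI)
    fix f :: "('x, 'k) mpoly" assume "f \<in> carrier (poly_ring V)"
    then show "\<exists>g\<in>carrier (poly_ring V). g \<oplus>\<^bsub>poly_ring V\<^esub> f = \<zero>\<^bsub>poly_ring V\<^esub>"
      by (intro bexI[of _ "- f"]) (simp_all add: poly_ring_simps indets_uminus)
  next
    fix f g :: "('x, 'k) mpoly"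
    assume "f \<in> carrier (poly_ring V)" "g \<in> carrier (poly_ring V)"
    then show "f \<oplus>\<^bsub>poly_ring V\<^esub> g \<in> carrier (poly_ring V)"
      unfolding poly_ring_simps using indets_add[of f g] by blast
  qed (simp_all add: poly_ring_simps ac_simps)
  show "comm_monoid (poly_ring V :: ('x, 'k) mpoly ring)"
  proof (rule comm_monoidI)
    fix f g :: "('x, 'k) mpoly"
    assume "f \<in> carrier (poly_ring V)" "g \<in> carrier (poly_ring V)"
    then show "f \<otimes>\<^bsub>poly_ring V\<^esub> g \<in> carrier (poly_ring V)"
      unfolding poly_ring_simps using indets_mult[of f g] by blast
  qed (simp_all add: poly_ring_simps ac_simps)
qed (simp add: poly_ring_simps algebra_simps)

section \<open>Minimal primes and saturations\<close>

definition minimal_primes :: "('a, 'm) ring_scheme \<Rightarrow> 'a set \<Rightarrow> 'a set set" where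
  "minimal_primes R J =
     {p. primeideal p R \<and> J \<subseteq> p \<and> (\<forall>q. primeideal q R \<longrightarrow> J \<subseteq> q \<longrightarrow> q \<subseteq> p \<longrightarrow> q = p)}"

definition saturation :: "('a, 'm) ring_scheme \<Rightarrow> 'a set \<Rightarrow> 'a \<Rightarrow> 'a set" where
  "saturation R J d = {f \<in> carrier R. \<exists>k::nat. (d [^]\<^bsub>R\<^esub> k) \<otimes>\<^bsub>R\<^esub> f \<in> J}"

section \<open>The prime spectrum with its Zariski topology\<close>

definition Spec :: "('a, 'm) ring_scheme \<Rightarrow> 'a set set" where
  "Spec R = {p. primeideal p R}"

definition vanishing_locus :: "('a, 'm) ring_scheme \<Rightarrow> 'a set \<Rightarrow> 'a set set" where
  "vanishing_locus R J = {p \<in> Spec R. J \<subseteq> p}"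

definition zariski :: "('a, 'm) ring_scheme \<Rightarrow> 'a set topology" where
  "zariski R = topology (\<lambda>U. \<exists>J \<subseteq> carrier R. U = Spec R - vanishing_locus R J)"

lemma istopology_zariski:
  "istopology (\<lambda>U. \<exists>J \<subseteq> carrier R. U = Spec R - vanishing_locus R J)"
  unfolding istopology_def
proof (intro conjI allI impI)
  fix U W
  assume "\<exists>J \<subseteq> carrier R. U = Spec R - vanishing_locus R J"
    and "\<exists>J \<subseteq> carrier R. W = Spec R - vanishing_locus R J"
  then obtain J L where J: "J \<subseteq> carrier R" "U = Spec R - vanishing_locus R J"
    and L: "L \<subseteq> carrier R" "W = Spec R - vanishing_locus R L" by blast
  show "\<exists>M \<subseteq> carrier R. U \<inter> W = Spec R - vanishing_locus R M"
  proof (cases "Spec R = {}")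
    case True
    then show ?thesis using J by auto
  next
    case False
    then obtain p where "primeideal p R" by (auto simp: Spec_def)
    then interpret cring R by (rule primeideal.axioms(2))
    define M where "M = {a \<otimes>\<^bsub>R\<^esub> b | a b. a \<in> J \<and> b \<in> L}"
    have M_iff: "M \<subseteq> q \<longleftrightarrow> J \<subseteq> q \<or> L \<subseteq> q" if q: "primeideal q R" for q
    proof -
      interpret q: primeideal q R by (rule q)
      show ?thesis
      proof
        assume M: "M \<subseteq> q"
        show "J \<subseteq> q \<or> L \<subseteq> q"
        proof (rule ccontr)
          assume "\<not> (J \<subseteq> q \<or> L \<subseteq> q)"
          then obtain a b where "a \<in> J" "a \<notin> q" "b \<in> L" "b \<notin> q" by blast
          moreover from this have "a \<otimes>\<^bsub>R\<^esub> b \<in> q" using M unfolding M_def by blast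
          ultimately show False using q.I_prime[of a b] J(1) L(1) by blast
        qed
      next
        assume "J \<subseteq> q \<or> L \<subseteq> q"
        show "M \<subseteq> q"
        proof
          fix x assume "x \<in> M"
          then obtain a b where x: "x = a \<otimes>\<^bsub>R\<^esub> b" "a \<in> J" "b \<in> L"
            unfolding M_def by blast
          then have "a \<in> carrier R" "b \<in> carrier R" using J(1) L(1) by (simp_all add: subsetD)
          then show "x \<in> q"
            using x \<open>J \<subseteq> q \<or> L \<subseteq> q\<close> q.I_r_closed[of a b] q.I_l_closed[of b a]
            by (metis subsetD)
        qed
      qed
    qed
    have "vanishing_locus R M = vanishing_locus R J \<union> vanishing_locus R L"
      unfolding vanishing_locus_def Spec_def by (simp add: Un_def M_iff conj_disj_distribL cong: conj_cong)
    then have "U \<inter> W = Spec R - vanishing_locus R M"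
      unfolding J(2) L(2) by blast
    moreover have "M \<subseteq> carrier R"
      using J(1) L(1) m_closed unfolding M_def by (auto simp: subset_iff)
    ultimately show ?thesis by blast
  qed
next
  fix \<K>
  assume "\<forall>K\<in>\<K>. \<exists>J \<subseteq> carrier R. K = Spec R - vanishing_locus R J"
  then have "\<forall>K\<in>\<K>. \<exists>J. J \<subseteq> carrier R \<and> K = Spec R - vanishing_locus R J" by blast
  from bchoice[OF this] obtain J where
    J: "\<And>K. K \<in> \<K> \<Longrightarrow> J K \<subseteq> carrier R" "\<And>K. K \<in> \<K> \<Longrightarrow> K = Spec R - vanishing_locus R (J K)"
    by blast
  have "\<Union>\<K> = (\<Union>K\<in>\<K>. Spec R - vanishing_locus R (J K))"
  proof -
    have "(\<lambda>K. K) ` \<K> = (\<lambda>K. Spec R - vanishing_locus R (J K)) ` \<K>"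
      by (rule image_cong[OF refl J(2)])
    then show ?thesis by (simp only: image_ident)
  qed
  also have "\<dots> = Spec R - vanishing_locus R (\<Union>(J ` \<K>))"
    unfolding vanishing_locus_def by blast
  finally show "\<exists>M \<subseteq> carrier R. \<Union>\<K> = Spec R - vanishing_locus R M"
    using J(1) by (intro exI[of _ "\<Union>(J ` \<K>)"]) (simp add: UN_least)
qed

lemma openin_zariski:
  "openin (zariski R) U \<longleftrightarrow> (\<exists>J \<subseteq> carrier R. U = Spec R - vanishing_locus R J)"
  unfolding zariski_def topology_inverse'[OF istopology_zariski] by (rule refl)

lemma topspace_zariski: "topspace (zariski R) = Spec R"
proof
  show "topspace (zariski R) \<subseteq> Spec R"
    unfolding topspace_def openin_zariski by blast
  have "Spec R = Spec R - vanishing_locus R (carrier R)"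
  proof -
    have "\<not> carrier R \<subseteq> p" if "primeideal p R" for p
      using primeideal.I_notcarr[OF that] additive_subgroup.a_subset
        ideal.axioms(1) primeideal.axioms(1)[OF that] by blast
    then show ?thesis unfolding vanishing_locus_def Spec_def by blast
  qed
  then have "openin (zariski R) (Spec R)"
    unfolding openin_zariski by (intro exI[of _ "carrier R"]) simp
  then show "Spec R \<subseteq> topspace (zariski R)" by (rule openin_subset)
qed

lemma closedin_zariski:
  "closedin (zariski R) C \<longleftrightarrow> (\<exists>J \<subseteq> carrier R. C = vanishing_locus R J)"
proof
  assume "closedin (zariski R) C"
  then obtain J where J: "C \<subseteq> Spec R" "J \<subseteq> carrier R" "Spec R - C = Spec R - vanishing_locus R J"
    unfolding closedin_def topspace_zariski openin_zariski by (elim conjE exE)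
  moreover have "vanishing_locus R J \<subseteq> Spec R" unfolding vanishing_locus_def by blast
  ultimately have "C = vanishing_locus R J" by blast
  with J(2) show "\<exists>J \<subseteq> carrier R. C = vanishing_locus R J" by (intro exI conjI)
next
  assume "\<exists>J \<subseteq> carrier R. C = vanishing_locus R J"
  then obtain J where J: "J \<subseteq> carrier R" "C = vanishing_locus R J" by (elim conjE exE)
  then have "openin (zariski R) (Spec R - C)"
    unfolding openin_zariski by (intro exI[of _ J]) simp
  moreover have "C \<subseteq> Spec R" unfolding J(2) vanishing_locus_def by blast
  ultimately show "closedin (zariski R) C"
    unfolding closedin_def topspace_zariski by (intro conjI)
qed

section \<open>Irreducibility and codimension\<close>

definition irreducible_in :: "'a topology \<Rightarrow> 'a set \<Rightarrow> bool" where
  "irreducible_in T Z \<longleftrightarrow>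
     Z \<subseteq> topspace T \<and> Z \<noteq> {} \<and>
     (\<forall>A B. closedin T A \<longrightarrow> closedin T B \<longrightarrow> Z \<subseteq> A \<union> B \<longrightarrow> Z \<subseteq> A \<or> Z \<subseteq> B)"

definition irreducible_components :: "'a topology \<Rightarrow> 'a set \<Rightarrow> 'a set set" where
  "irreducible_components T C =
     {Z. Z \<subseteq> C \<and> irreducible_in T Z \<and>
         (\<forall>Z'. Z' \<subseteq> C \<longrightarrow> irreducible_in T Z' \<longrightarrow> Z \<subseteq> Z' \<longrightarrow> Z' = Z)}"

definition locally_closedin :: "'a topology \<Rightarrow> 'a set \<Rightarrow> bool" where
  "locally_closedin T Y \<longleftrightarrow> (\<exists>U C. openin T U \<and> closedin T C \<and> Y = U \<inter> C)"

definition irreducible_codim :: "'a topology \<Rightarrow> 'a set \<Rightarrow> enat" where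
  "irreducible_codim T Z =
     Sup {enat k | k. \<exists>c :: nat \<Rightarrow> 'a set. c 0 = Z \<and>
            (\<forall>i \<le> k. closedin T (c i) \<and> irreducible_in T (c i)) \<and>
            (\<forall>i < k. c i \<subset> c (Suc i))}"

text \<open>
  The codimension of a locally closed set is that of its closure, and the codimension of a
  closed set is the least codimension of an irreducible closed subset of it.
\<close>

definition codimension :: "'a topology \<Rightarrow> 'a set \<Rightarrow> enat" where
  "codimension T Y =
     Inf {irreducible_codim T Z | Z. closedin T Z \<and> irreducible_in T Z \<and> Z \<subseteq> T closure_of Y}"

section \<open>Rank of a matrix at a point of the spectrum\<close>

text \<open>
  For a prime \<open>p\<close>, this is the rank of the image of \<open>A\<close> over the residue field at \<open>p\<close>, that is,
  the fraction field of the domain \<open>R/p\<close>: the largest number of columns that are linearly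
  independent over that field. Clearing denominators, the columns in \<open>J\<close> are independent over
  the fraction field iff they are independent over \<open>R/p\<close>, and the coefficients of a relation
  over \<open>R/p\<close> lift to \<open>R\<close>.
\<close>

definition cols_indep_at :: "('a, 'm) ring_scheme \<Rightarrow> 'a set \<Rightarrow> 'a mat \<Rightarrow> nat set \<Rightarrow> bool" where
  "cols_indep_at R p A J \<longleftrightarrow>
     (\<forall>c \<in> J \<rightarrow> carrier R.
        (\<forall>i < dim_row A. (\<Oplus>\<^bsub>R\<^esub>j\<in>J. c j \<otimes>\<^bsub>R\<^esub> A $$ (i, j)) \<in> p) \<longrightarrow> (\<forall>j\<in>J. c j \<in> p))"

definition rank_at :: "('a, 'm) ring_scheme \<Rightarrow> 'a set \<Rightarrow> 'a mat \<Rightarrow> nat" where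
  "rank_at R p A = Max {card J | J. J \<subseteq> {..<dim_col A} \<and> cols_indep_at R p A J}"

section \<open>The generic square matrix and its ideals of minors\<close>

text \<open>Rows and columns are numbered from 0, so the indeterminates are \<open>(i, j)\<close> with \<open>i, j < n\<close>.\<close>

type_synonym 'k matrix_poly = "(nat \<times> nat, 'k) mpoly"

definition matrix_poly_ring :: "nat \<Rightarrow> 'k::comm_ring_1 matrix_poly ring" where
  "matrix_poly_ring n = poly_ring ({..<n} \<times> {..<n})"

definition generic_matrix :: "nat \<Rightarrow> 'k::comm_ring_1 matrix_poly mat" where
  "generic_matrix n = mat n n Var"

definition principal_minor_ideal :: "nat \<Rightarrow> nat \<Rightarrow> 'k::comm_ring_1 matrix_poly set" where
  "principal_minor_ideal n t =
     Idl\<^bsub>matrix_poly_ring n\<^esub>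
       {det (submatrix (generic_matrix n) A A) | A. A \<subseteq> {..<n} \<and> card A = t}"

definition determinantal_ideal :: "nat \<Rightarrow> nat \<Rightarrow> 'k::comm_ring_1 matrix_poly set" where
  "determinantal_ideal n t =
     Idl\<^bsub>matrix_poly_ring n\<^esub>
       {det (submatrix (generic_matrix n) A B) | A B.
          A \<subseteq> {..<n} \<and> B \<subseteq> {..<n} \<and> card A = t \<and> card B = t}"

definition saturated_principal_minor_ideal :: "nat \<Rightarrow> nat \<Rightarrow> 'k::comm_ring_1 matrix_poly set" where
  "saturated_principal_minor_ideal n t =
     saturation (matrix_poly_ring n) (principal_minor_ideal n t) (det (generic_matrix n))"

definition principal_rank_locus :: "nat \<Rightarrow> nat \<Rightarrow> nat \<Rightarrow> 'k::comm_ring_1 matrix_poly set set" where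
  "principal_rank_locus n r t =
     {p \<in> vanishing_locus (matrix_poly_ring n) (principal_minor_ideal n t).
        rank_at (matrix_poly_ring n) p (generic_matrix n) = r}"

end

theory Submission
  imports Defs
begin

text \<open>
  Up to the factor \<open>\<Delta>\<close>, the principal \<open>(n - 1)\<close>-minors of \<open>X\<close> are the diagonal entries of its inverse.
  On the open set \<open>\<Delta> \<noteq> 0\<close>, inversion therefore carries the locus \<open>P = 0\<close> to the set of invertible
  matrices with zero diagonal, an open piece of a linear space of codimension \<open>n\<close>. The closure of
  this locus is irreducible, and its ideal is the saturation \<open>Q\<close>
  (\<open>saturated_principal_minor_ideal_eq\<close>, \<open>primeideal_zero_diag_inverse_ideal\<close>). On the closed set
  \<open>\<Delta> = 0\<close>, the matrices of rank at most \<open>n - 2\<close> form the determinantal variety, and a matrix of rank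
  \<open>n - 1\<close> with vanishing principal minors is a limit of invertible ones, because its adjugate
  \<open>u * v\<^sup>T\<close> is a limit of invertible matrices with zero diagonal (\<open>singular_specialization\<close>). The limit
  argument is carried out modulo an arbitrary prime over \<open>P\<close>, so that it shows at once that such a
  prime contains \<open>I\<close> or \<open>Q\<close> (\<open>prime_over_principal_minors\<close>).

  That \<open>I\<close> itself is prime, not only its radical, requires that the minors generate all polynomials
  that vanish on the matrices of bounded rank (\<open>mem_determinantal_ideal_iff\<close>). This is proved with the
  weight \<open>i * j\<close> of the indeterminate in position \<open>(i, j)\<close>, for which the diagonal term of every minor
  leads. A set of positions that contains no diagonal of an \<open>(r + 1)\<close>-minor splits into \<open>r\<close>
  antichains, each of which supports a degeneration of matrices of rank one, and the sum of these
  degenerations is a matrix of rank at most \<open>r\<close> with arbitrary entries on the given positions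
  (\<open>leading_monomial_has_chain\<close>). Hence every leading term is divisible by a diagonal, and division by
  minors terminates with remainder zero.

  For \<open>n \<ge> 4\<close> the two primes are incomparable: a binomial in the \<open>(n - 2)\<close>-minors, which corresponds to
  two ways of writing the monomial of a four-cycle in the entries of the inverse as a product of two
  of its two-rowed minors, lies in \<open>Q\<close> but does not vanish on all matrices of rank \<open>n - 2\<close>
  (\<open>incomparable\<close>). The height of \<open>Q\<close> is at least \<open>n\<close> by the chain of primes that arises from
  imposing the zeros of the diagonal one after the other, and at most \<open>n\<close> since the \<open>n\<^sup>2 - n\<close>
  off-diagonal entries of the adjugate are independent modulo \<open>Q\<close>, each step of a chain of primes
  adds an independent element, and there are at most \<open>n\<^sup>2\<close> independent polynomials
  (\<open>prime_chain_length\<close>).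
\<close>

section \<open>Evaluating polynomials\<close>

abbreviation "keys \<equiv> Poly_Mapping.keys"
abbreviation "lookup \<equiv> Poly_Mapping.lookup"
abbreviation "single \<equiv> Poly_Mapping.single"

definition monom_eval :: "('x \<Rightarrow> 'a::comm_ring_1) \<Rightarrow> ('x \<Rightarrow>\<^sub>0 nat) \<Rightarrow> 'a" where
  "monom_eval v m = (\<Prod>x\<in>keys m. v x ^ lookup m x)"

text \<open>
  The coefficients are carried to the target ring by \<open>h\<close>, so that the same operator evaluates at
  points over the ground field, where \<open>h\<close> is the identity, and substitutes polynomials, where it is
  \<open>Const\<close>.
\<close>

definition mpoly_eval ::
    "('k::comm_ring_1 \<Rightarrow> 'a::comm_ring_1) \<Rightarrow> ('x \<Rightarrow> 'a) \<Rightarrow> ('x, 'k) mpoly \<Rightarrow> 'a" where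
  "mpoly_eval h v f = (\<Sum>m\<in>keys f. h (lookup f m) * monom_eval v m)"

abbreviation eval_at :: "('x \<Rightarrow> 'k) \<Rightarrow> ('x, 'k::comm_ring_1) mpoly \<Rightarrow> 'k" where
  "eval_at \<equiv> mpoly_eval (\<lambda>c. c)"

definition Const :: "'k \<Rightarrow> ('x, 'k::comm_ring_1) mpoly" where
  "Const c = single 0 c"

lemma comm_ring_hom_Const: "comm_ring_hom (Const :: 'k::comm_ring_1 \<Rightarrow> ('x, 'k) mpoly)"
  by unfold_locales (simp_all add: Const_def single_add mult_single)

lemma comm_ring_hom_id: "comm_ring_hom (\<lambda>x::'a::comm_ring_1. x)"
  by unfold_locales simp_all

lemma monom_eval_superset:
  assumes "finite A" "keys m \<subseteq> A"
  shows "monom_eval v m = (\<Prod>x\<in>A. v x ^ lookup m x)"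
  unfolding monom_eval_def using assms
  by (intro prod.mono_neutral_left) (auto simp: in_keys_iff)

lemma monom_eval_0 [simp]: "monom_eval v 0 = 1"
  by (simp add: monom_eval_def)

lemma monom_eval_single [simp]: "monom_eval v (single x k) = v x ^ k"
  by (simp add: monom_eval_def)

lemma monom_eval_add: "monom_eval v (m + m') = monom_eval v m * monom_eval v m'"
proof -
  let ?A = "keys m \<union> keys m'"
  have "keys (m + m') \<subseteq> ?A" by (rule Poly_Mapping.keys_add)
  then show ?thesis
    by (simp add: monom_eval_superset[of ?A] lookup_add power_add prod.distrib)
qed

lemma monom_eval_mult: "monom_eval (\<lambda>x. v x * w x) m = monom_eval v m * monom_eval w m"
  by (simp add: monom_eval_def power_mult_distrib prod.distrib)

lemma monom_eval_1 [simp]: "monom_eval (\<lambda>x. 1) m = 1"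
  by (simp add: monom_eval_def)

lemma monom_eval_cong: "(\<And>x. x \<in> keys m \<Longrightarrow> v x = w x) \<Longrightarrow> monom_eval v m = monom_eval w m"
  by (simp add: monom_eval_def)

lemma (in comm_ring_hom) hom_monom_eval: "hom (monom_eval v m) = monom_eval (\<lambda>x. hom (v x)) m"
  by (simp add: monom_eval_def hom_distribs)

lemma poly_mapping_sum_monomials:
  "f = (\<Sum>m\<in>keys f. single m (lookup f m))"
proof (rule poly_mapping_eqI)
  fix k
  have "(\<Sum>m\<in>keys f. lookup (single m (lookup f m)) k)
      = (\<Sum>m\<in>keys f. if m = k then lookup f k else 0)"
    by (intro sum.cong) (auto simp: lookup_single when_def)
  then show "lookup f k =
      lookup (\<Sum>m\<in>keys f. single m (lookup f m)) k"
    by (simp add: lookup_sum in_keys_iff)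
qed

context comm_ring_hom
begin

lemma mpoly_eval_superset:
  assumes "finite A" "keys f \<subseteq> A"
  shows "mpoly_eval hom v f = (\<Sum>m\<in>A. hom (lookup f m) * monom_eval v m)"
  unfolding mpoly_eval_def using assms
  by (intro sum.mono_neutral_left) (auto simp: in_keys_iff)

lemma mpoly_eval_single: "mpoly_eval hom v (single m c) = hom c * monom_eval v m"
  by (simp add: mpoly_eval_superset[of "{m}"] lookup_single)

lemma mpoly_eval_add: "mpoly_eval hom v (f + g) = mpoly_eval hom v f + mpoly_eval hom v g"
proof -
  let ?A = "keys f \<union> keys g"
  have "keys (f + g) \<subseteq> ?A" by (rule Poly_Mapping.keys_add)
  then show ?thesis
    by (simp add: mpoly_eval_superset[of ?A] lookup_add hom_add distrib_right sum.distrib)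
qed

lemma mpoly_eval_0 [simp]: "mpoly_eval hom v 0 = 0"
  by (simp add: mpoly_eval_def)

lemma mpoly_eval_sum: "mpoly_eval hom v (\<Sum>i\<in>I. f i) = (\<Sum>i\<in>I. mpoly_eval hom v (f i))"
  by (induction I rule: infinite_finite_induct) (simp_all add: mpoly_eval_add)

lemma mpoly_eval_mult: "mpoly_eval hom v (f * g) = mpoly_eval hom v f * mpoly_eval hom v g"
proof -
  let ?s = "\<lambda>f m. single m (lookup f m)"
  have "f * g = (\<Sum>m\<in>keys f. ?s f m) * (\<Sum>m\<in>keys g. ?s g m)"
    using poly_mapping_sum_monomials[of f] poly_mapping_sum_monomials[of g] by simp
  also have "mpoly_eval hom v \<dots> =
      (\<Sum>m\<in>keys f. \<Sum>m'\<in>keys g. mpoly_eval hom v (?s f m * ?s g m'))"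
    by (simp add: sum_product mpoly_eval_sum)
  also have "\<dots> = mpoly_eval hom v f * mpoly_eval hom v g"
    by (simp add: mult_single mpoly_eval_single mpoly_eval_def[of _ _ f] mpoly_eval_def[of _ _ g]
        sum_product monom_eval_add hom_mult ac_simps)
  finally show ?thesis .
qed

lemma comm_ring_hom_mpoly_eval: "comm_ring_hom (mpoly_eval hom v)"
proof
  show "mpoly_eval hom v 1 = 1"
    using mpoly_eval_single[of v 0 1] by simp
qed (simp_all add: mpoly_eval_add mpoly_eval_mult)

lemma mpoly_eval_Var [simp]: "mpoly_eval hom v (Var x) = v x"
  by (simp add: Var_def mpoly_eval_single)

lemma mpoly_eval_Const [simp]: "mpoly_eval hom v (Const c) = hom c"
  by (simp add: Const_def mpoly_eval_single)

end

lemma mpoly_eval_cong: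
  "(\<And>x. x \<in> indets f \<Longrightarrow> v x = w x) \<Longrightarrow> mpoly_eval h v f = mpoly_eval h w f"
  unfolding mpoly_eval_def
  by (intro sum.cong refl arg_cong2[of _ _ _ _ "(*)"] monom_eval_cong) (auto simp: indets_def)

lemma (in comm_ring_hom) hom_mpoly_eval:
  "hom (mpoly_eval h v f) = mpoly_eval (\<lambda>c. hom (h c)) (\<lambda>x. hom (v x)) f"
  by (simp add: mpoly_eval_def hom_distribs hom_monom_eval)

lemma Const_mult_monom_eval_Var:
  "Const c * monom_eval Var m = (single m c :: ('x, 'k::comm_ring_1) mpoly)"
proof -
  have p: "Var x ^ k = (single (single x k) 1 :: ('x, 'k) mpoly)" for x k
    by (induction k) (simp_all add: Var_def mult_single single_add[symmetric])
  have "(\<Prod>x\<in>A. single (e x) 1) = (single (\<Sum>x\<in>A. e x) 1 :: ('x, 'k) mpoly)"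
    if "finite A" for A and e :: "'x \<Rightarrow> 'x \<Rightarrow>\<^sub>0 nat"
    using that by (induction A rule: finite_induct) (simp_all add: mult_single)
  then show ?thesis
    unfolding monom_eval_def p using poly_mapping_sum_monomials[of m]
    by (simp add: Const_def mult_single)
qed

lemma mpoly_eval_Const_Var [simp]: "mpoly_eval Const Var f = f"
  unfolding mpoly_eval_def Const_mult_monom_eval_Var by (rule poly_mapping_sum_monomials[symmetric])

lemma mpoly_eval_mpoly_eval:
  fixes f :: "('x, 'k::comm_ring_1) mpoly"
  assumes "comm_ring_hom h"
  shows "mpoly_eval h w (mpoly_eval Const v f) = mpoly_eval h (\<lambda>x. mpoly_eval h w (v x)) f"
proof -
  interpret comm_ring_hom h by fact
  interpret e: comm_ring_hom "mpoly_eval h w" by (rule comm_ring_hom_mpoly_eval)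
  show ?thesis by (simp add: e.hom_mpoly_eval)
qed

lemma indets_sum: "indets (\<Sum>i\<in>I. f i) \<subseteq> (\<Union>i\<in>I. indets (f i :: ('x, 'k::comm_ring_1) mpoly))"
proof (induction I rule: infinite_finite_induct)
  case (insert i I)
  then show ?case using indets_add[of "f i" "\<Sum>i\<in>I. f i"] by auto
qed simp_all

lemma indets_prod: "indets (\<Prod>i\<in>I. f i) \<subseteq> (\<Union>i\<in>I. indets (f i :: ('x, 'k::comm_ring_1) mpoly))"
proof (induction I rule: infinite_finite_induct)
  case (insert i I)
  then show ?case using indets_mult[of "f i" "\<Prod>i\<in>I. f i"] by auto
qed simp_all

lemma indets_power: "indets (f ^ k) \<subseteq> indets (f :: ('x, 'k::comm_ring_1) mpoly)"
  using indets_prod[of "\<lambda>_. f" "{..<k}"] by (auto split: if_splits)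

lemma indets_diff: "indets (f - g) \<subseteq> indets f \<union> indets (g :: ('x, 'k::comm_ring_1) mpoly)"
  using indets_add[of f "- g"] by (simp add: indets_uminus)

lemma indets_Const [simp]: "indets (Const c) = {}"
  by (simp add: indets_def Const_def)

lemma indets_Var [simp]: "indets (Var x :: ('x, 'k::comm_ring_1) mpoly) = {x}"
  by (simp add: indets_def Var_def)

lemma indets_single: "indets (single m c) \<subseteq> keys m"
  by (auto simp: indets_def)

lemma indets_det:
  fixes A :: "('x, 'k::comm_ring_1) mpoly mat"
  assumes "A \<in> carrier_mat n n" and "\<And>i j. i < n \<Longrightarrow> j < n \<Longrightarrow> indets (A $$ (i, j)) \<subseteq> V"
  shows "indets (det A) \<subseteq> V"
  unfolding det_def'[OF assms(1)]
proof (rule order.trans[OF indets_sum], rule UN_least)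
  fix p assume p: "p \<in> {p. p permutes {0..<n}}"
  have "indets (signof p * (\<Prod>i = 0..<n. A $$ (i, p i))) \<subseteq> indets (\<Prod>i = 0..<n. A $$ (i, p i))"
    by (cases "sign p = 1") (simp_all add: sign_def indets_uminus split: if_splits)
  also have "\<dots> \<subseteq> V"
    using p assms(2) permutes_in_image[of p "{0..<n}"]
    by (intro order.trans[OF indets_prod] UN_least) auto
  finally show "indets (signof p * (\<Prod>i = 0..<n. A $$ (i, p i))) \<subseteq> V" .
qed

lemma indets_mpoly_eval_Const:
  fixes f :: "('x, 'k::comm_ring_1) mpoly" and v :: "'x \<Rightarrow> ('y, 'k) mpoly"
  assumes "\<And>x. x \<in> indets f \<Longrightarrow> indets (v x) \<subseteq> V"
  shows "indets (mpoly_eval Const v f) \<subseteq> V"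
  unfolding mpoly_eval_def
proof (rule order.trans[OF indets_sum], rule UN_least)
  fix m assume m: "m \<in> keys f"
  have "indets (monom_eval v m) \<subseteq> V"
    unfolding monom_eval_def using m assms
    by (intro order.trans[OF indets_prod] UN_least order.trans[OF indets_power]) (auto simp: indets_def)
  then show "indets (Const (lookup f m) * monom_eval v m) \<subseteq> V"
    using indets_mult[of "Const (lookup f m)" "monom_eval v m"] by auto
qed

section \<open>Ideals and congruences\<close>

text \<open>
  Most computations below take place in the whole ring of polynomials, modulo an ideal. These
  locales describe ideals of a ring given by a type; a prime of \<open>poly_ring V\<close> yields one as its
  preimage under the retraction that kills the other indeterminates.
\<close>

locale type_ideal =
  fixes p :: "'a::comm_ring_1 set"
  assumes zero_mem: "0 \<in> p"
    and add_mem: "a \<in> p \<Longrightarrow> b \<in> p \<Longrightarrow> a + b \<in> p"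
    and mult_mem: "a \<in> p \<Longrightarrow> r * a \<in> p"
begin

lemma mult_mem': "a \<in> p \<Longrightarrow> a * r \<in> p"
  using mult_mem[of a r] by (simp add: mult.commute)

lemma uminus_mem: "a \<in> p \<Longrightarrow> - a \<in> p"
  using mult_mem[of a "-1"] by simp

lemma diff_mem: "a \<in> p \<Longrightarrow> b \<in> p \<Longrightarrow> a - b \<in> p"
  using add_mem[of a "- b"] uminus_mem[of b] by simp

lemma sum_mem: "(\<And>i. i \<in> I \<Longrightarrow> f i \<in> p) \<Longrightarrow> sum f I \<in> p"
  by (induction I rule: infinite_finite_induct) (auto simp: zero_mem add_mem)

lemma mem_cong: "a - b \<in> p \<Longrightarrow> a \<in> p \<longleftrightarrow> b \<in> p"
  using add_mem[of "a - b" b] diff_mem[of a "a - b"] by auto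

lemma cong_mult: assumes "a - b \<in> p" "c - d \<in> p" shows "a * c - b * d \<in> p"
proof -
  have "a * c - b * d = c * (a - b) + b * (c - d)" by (simp add: algebra_simps)
  then show ?thesis using assms by (simp add: add_mem mult_mem)
qed

lemma cong_sum: "(\<And>i. i \<in> I \<Longrightarrow> f i - g i \<in> p) \<Longrightarrow> sum f I - sum g I \<in> p"
  by (simp add: sum_mem flip: sum_subtractf)

lemma cong_prod: "(\<And>i. i \<in> I \<Longrightarrow> f i - g i \<in> p) \<Longrightarrow> prod f I - prod g I \<in> p"
  by (induction I rule: infinite_finite_induct) (auto simp: zero_mem cong_mult)

lemma cong_power: "a - b \<in> p \<Longrightarrow> a ^ k - b ^ k \<in> p"
  using cong_prod[of "{..<k}" "\<lambda>_. a" "\<lambda>_. b"] by simp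

lemma cong_det:
  assumes "A \<in> carrier_mat n n" "B \<in> carrier_mat n n"
    and "\<And>i j. i < n \<Longrightarrow> j < n \<Longrightarrow> A $$ (i, j) - B $$ (i, j) \<in> p"
  shows "det A - det B \<in> p"
  unfolding det_def'[OF assms(1)] det_def'[OF assms(2)]
proof (rule cong_sum, rule cong_mult)
  fix \<pi> :: "nat \<Rightarrow> nat" assume "\<pi> \<in> {\<pi>. \<pi> permutes {0..<n}}"
  then have "\<pi> i < n" if "i < n" for i using permutes_in_image[of \<pi> "{0..<n}" i] that by simp
  then show "(\<Prod>i = 0..<n. A $$ (i, \<pi> i)) - (\<Prod>i = 0..<n. B $$ (i, \<pi> i)) \<in> p"
    using assms(3) by (intro cong_prod) simp
qed (simp add: zero_mem)

lemma cong_monom_eval: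
  "(\<And>x. x \<in> keys m \<Longrightarrow> v x - w x \<in> p) \<Longrightarrow> monom_eval v m - monom_eval w m \<in> p"
  unfolding monom_eval_def by (intro cong_prod cong_power)

end

locale type_prime = type_ideal +
  assumes one_notin: "1 \<notin> p"
    and prime: "a * b \<in> p \<Longrightarrow> a \<in> p \<or> b \<in> p"
begin

lemma mult_mem_iff: "a * b \<in> p \<longleftrightarrow> a \<in> p \<or> b \<in> p"
  using prime mult_mem mult_mem' by blast

lemma power_mem: "a ^ k \<in> p \<Longrightarrow> a \<in> p"
  using one_notin prime by (induction k) auto

lemma prod_notin: "(\<And>i. i \<in> I \<Longrightarrow> f i \<notin> p) \<Longrightarrow> prod f I \<notin> p"
  using one_notin prime by (induction I rule: infinite_finite_induct) auto

end

lemma type_prime_zero: "type_prime {0 :: 'a::idom}"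
  by unfold_locales auto

section \<open>Polynomial curves\<close>

text \<open>
  All irreducibility and closure arguments move along curves. Their parameter runs through the ground
  field, and \<open>h\<close> embeds it in the ring of the coordinates, which is the field itself or a ring of
  polynomials.
\<close>

definition poly_fun :: "('k \<Rightarrow> 'a::comm_ring_1) \<Rightarrow> ('k \<Rightarrow> 'a) \<Rightarrow> bool" where
  "poly_fun h g \<longleftrightarrow> (\<exists>q. \<forall>s. g s = poly q (h s))"

lemma poly_fun_const [simp]: "poly_fun h (\<lambda>s. c)"
  unfolding poly_fun_def by (rule exI[of _ "[:c:]"]) simp

lemma poly_fun_param [simp]: "poly_fun h (\<lambda>s. h s)"
  unfolding poly_fun_def by (rule exI[of _ "[:0, 1:]"]) simp

lemma poly_fun_add:
  assumes "poly_fun h f" "poly_fun h g" shows "poly_fun h (\<lambda>s. f s + g s)"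
proof -
  obtain a b where "\<forall>s. f s = poly a (h s)" "\<forall>s. g s = poly b (h s)"
    using assms unfolding poly_fun_def by blast
  then show ?thesis unfolding poly_fun_def by (intro exI[of _ "a + b"]) simp
qed

lemma poly_fun_mult:
  assumes "poly_fun h f" "poly_fun h g" shows "poly_fun h (\<lambda>s. f s * g s)"
proof -
  obtain a b where "\<forall>s. f s = poly a (h s)" "\<forall>s. g s = poly b (h s)"
    using assms unfolding poly_fun_def by blast
  then show ?thesis unfolding poly_fun_def by (intro exI[of _ "a * b"]) simp
qed

lemma poly_fun_diff:
  assumes "poly_fun h f" "poly_fun h g" shows "poly_fun h (\<lambda>s. f s - g s)"
  using poly_fun_add[OF assms(1) poly_fun_mult[OF poly_fun_const[of _ "-1"] assms(2)]] by simp

lemma poly_fun_sum: "(\<And>i. i \<in> I \<Longrightarrow> poly_fun h (f i)) \<Longrightarrow> poly_fun h (\<lambda>s. \<Sum>i\<in>I. f i s)"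
  by (induction I rule: infinite_finite_induct) (auto intro: poly_fun_add)

lemma poly_fun_prod: "(\<And>i. i \<in> I \<Longrightarrow> poly_fun h (f i)) \<Longrightarrow> poly_fun h (\<lambda>s. \<Prod>i\<in>I. f i s)"
  by (induction I rule: infinite_finite_induct) (auto intro: poly_fun_mult)

lemma poly_fun_power: "poly_fun h f \<Longrightarrow> poly_fun h (\<lambda>s. f s ^ k)"
  using poly_fun_prod[of "{..<k}" h "\<lambda>_. f"] by simp

lemma poly_fun_det:
  assumes A: "\<And>s. A s \<in> carrier_mat n n"
    and e: "\<And>i j. i < n \<Longrightarrow> j < n \<Longrightarrow> poly_fun h (\<lambda>s. A s $$ (i, j))"
  shows "poly_fun h (\<lambda>s. det (A s))"
  unfolding det_def'[OF A]
proof (intro poly_fun_sum poly_fun_mult poly_fun_prod poly_fun_const)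
  fix \<pi> :: "nat \<Rightarrow> nat" and i assume "\<pi> \<in> {\<pi>. \<pi> permutes {0..<n}}" "i \<in> {0..<n}"
  then show "poly_fun h (\<lambda>s. A s $$ (i, \<pi> i))"
    using permutes_in_image[of \<pi> "{0..<n}" i] by (intro e) auto
qed

lemma poly_fun_adj_mat:
  assumes A: "\<And>s. A s \<in> carrier_mat n n"
    and e: "\<And>i j. i < n \<Longrightarrow> j < n \<Longrightarrow> poly_fun h (\<lambda>s. A s $$ (i, j))"
    and ij: "i < n" "j < n"
  shows "poly_fun h (\<lambda>s. adj_mat (A s) $$ (i, j))"
proof -
  have d: "dim_row (A s) = n" "dim_col (A s) = n" for s using A[of s] by auto
  have "adj_mat (A s) $$ (i, j) = (-1) ^ (j + i) * det (mat_delete (A s) j i)" for s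
    using ij by (simp add: adj_mat_def d cofactor_def)
  moreover have "poly_fun h (\<lambda>s. det (mat_delete (A s) j i))"
    by (rule poly_fun_det[of _ "n - 1"])
      (use ij in \<open>auto simp: mat_delete_def d intro!: e mat_delete_carrier[OF A]\<close>)
  ultimately show ?thesis by (simp add: poly_fun_mult)
qed

lemma poly_fun_mpoly_eval:
  assumes "\<And>x. x \<in> indets f \<Longrightarrow> poly_fun h (\<lambda>s. v s x)"
  shows "poly_fun h (\<lambda>s. mpoly_eval h' (v s) f)"
  unfolding mpoly_eval_def monom_eval_def
  using assms by (intro poly_fun_sum poly_fun_mult poly_fun_prod poly_fun_power) (auto simp: indets_def)

text \<open>
  One parameter \<open>s0\<close> with value in the ideal splits off a linear factor modulo the ideal. At every
  other parameter this factor is a unit, being the image of a nonzero element of the field, so the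
  quotient has the same property and smaller degree.
\<close>

lemma (in type_ideal) poly_mem_of_infinite:
  fixes h :: "'k::field \<Rightarrow> 'a"
  assumes h: "comm_ring_hom h"
  shows "infinite {s. poly q (h s) \<in> p} \<Longrightarrow> poly q (h s) \<in> p"
proof (induction "degree q" arbitrary: q s rule: less_induct)
  case less
  interpret h: comm_ring_hom h by fact
  obtain s0 where s0: "poly q (h s0) \<in> p"
    using less.prems by (metis (mono_tags, lifting) finite.emptyI empty_Collect_eq)
  show ?case
  proof (cases "degree q = 0")
    case True
    then obtain c where "q = [:c:]" by (metis degree_eq_zeroE)
    then show ?thesis using s0 by simp
  next
    case False
    define r where "r = synthetic_div q (h s0)"
    have q: "poly q x = (x - h s0) * poly r x + poly q (h s0)" for x
      using arg_cong[OF synthetic_div_correct'[of "h s0" q], of "\<lambda>q. poly q x"]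
      by (simp add: r_def algebra_simps)
    have "{s. poly q (h s) \<in> p} - {s0} \<subseteq> {s. poly r (h s) \<in> p}"
    proof
      fix s assume s: "s \<in> {s. poly q (h s) \<in> p} - {s0}"
      then have "h (s - s0) * poly r (h s) \<in> p"
        using s0 diff_mem[of "poly q (h s)" "poly q (h s0)"] q[of "h s"] by (simp add: h.hom_minus)
      then have "h (inverse (s - s0)) * (h (s - s0) * poly r (h s)) \<in> p" by (rule mult_mem)
      moreover have "h (inverse (s - s0)) * h (s - s0) = 1"
        using s by (simp flip: h.hom_mult)
      ultimately show "s \<in> {s. poly r (h s) \<in> p}"
        by (simp add: mult.assoc[symmetric])
    qed
    then have "infinite {s. poly r (h s) \<in> p}"
      using less.prems infinite_super by (meson finite.emptyI finite_insert infinite_remove)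
    then have "poly r (h s) \<in> p"
      using less.hyps[of r] False by (simp add: r_def degree_synthetic_div)
    then show ?thesis using s0 q[of "h s"] by (simp add: add_mem mult_mem)
  qed
qed

lemma (in type_ideal) finite_parameters:
  fixes h :: "'k::field \<Rightarrow> 'a"
  assumes "comm_ring_hom h" "poly_fun h g" "g s0 \<notin> p"
  shows "finite {s. g s \<in> p}"
proof (rule ccontr)
  assume inf: "infinite {s. g s \<in> p}"
  obtain q where "\<And>s. g s = poly q (h s)" using assms(2) unfolding poly_fun_def by blast
  then show False using poly_mem_of_infinite[OF assms(1), of q s0] inf assms(3) by simp
qed

lemma infinite_alg_closed_field: "infinite (UNIV :: 'k::alg_closed_field set)"
proof
  assume fin: "finite (UNIV :: 'k set)"
  define q :: "'k poly" where "q = (\<Prod>a\<in>UNIV. [:-a, 1:])"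
  have "degree q = card (UNIV :: 'k set)"
    unfolding q_def by (subst degree_prod_eq_sum_degree) auto
  then have "degree (q + 1) > 0"
    using fin by (simp add: degree_add_eq_left finite_UNIV_card_ge_0)
  then obtain x where x: "poly (q + 1) x = 0"
    using alg_closed_imp_poly_has_root by blast
  have "poly q x = 0"
    unfolding q_def poly_prod using fin by (intro prod_zero) auto
  then show False using x by simp
qed

lemma generic_parameter:
  fixes g :: "'i \<Rightarrow> 'k::alg_closed_field \<Rightarrow> 'k"
  assumes "finite I" "\<And>i. i \<in> I \<Longrightarrow> poly_fun (\<lambda>s. s) (g i)" "\<And>i. i \<in> I \<Longrightarrow> g i (s0 i) \<noteq> 0"
  shows "\<exists>s. \<forall>i\<in>I. g i s \<noteq> 0"
proof -
  interpret type_prime "{0 :: 'k}" by (rule type_prime_zero)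
  have "finite (\<Union>i\<in>I. {s. g i s \<in> {0}})"
    using assms finite_parameters[OF comm_ring_hom_id] by blast
  then have "(\<Union>i\<in>I. {s. g i s \<in> {0}}) \<noteq> UNIV"
    using infinite_alg_closed_field by metis
  then show ?thesis by auto
qed

text \<open>
  Monomials are multiplicative characters of the set of points, so Artin's argument for the
  independence of characters shows that a polynomial vanishing at all points is zero.
\<close>

lemma monomials_independent:
  fixes c :: "('x \<Rightarrow>\<^sub>0 nat) \<Rightarrow> 'k::alg_closed_field"
  assumes "finite M"
  shows "(\<And>v. (\<Sum>m\<in>M. c m * monom_eval v m) = 0) \<Longrightarrow> m \<in> M \<Longrightarrow> c m = 0"
  using assms
proof (induction M arbitrary: c m rule: finite_induct)
  case (insert m0 M)
  have sum0: "c m0 * monom_eval v m0 + (\<Sum>m\<in>M. c m * monom_eval v m) = 0" for v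
    using insert.prems(1)[of v] insert.hyps by simp
  have rest: "c m1 = 0" if m1: "m1 \<in> M" for m1
  proof -
    obtain x where x: "lookup m1 x \<noteq> lookup m0 x"
      using m1 insert.hyps(2) by (metis poly_mapping_eqI)
    define w :: "'k \<Rightarrow> 'x \<Rightarrow> 'k" where "w s y = (if y = x then s else 1)" for s y
    have ev: "monom_eval (w s) m = s ^ lookup m x" for s m
    proof -
      have "monom_eval (w s) m = (\<Prod>y\<in>insert x (keys m). w s y ^ lookup m y)"
        by (rule monom_eval_superset) auto
      also have "\<dots> = (\<Prod>y\<in>{x}. w s y ^ lookup m y)"
        by (rule prod.mono_neutral_right) (auto simp: w_def)
      finally show ?thesis by (simp add: w_def)
    qed
    define q :: "'k poly" where
      "q = Polynomial.monom 1 (lookup m1 x) - Polynomial.monom 1 (lookup m0 x)"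
    have "coeff q (lookup m1 x) = 1" using x by (simp add: q_def)
    then have "q \<noteq> 0" by auto
    then have "finite {s. poly q s = 0}" by (rule poly_roots_finite)
    then obtain s where "poly q s \<noteq> 0"
      using infinite_alg_closed_field by (metis (mono_tags, lifting) UNIV_eq_I mem_Collect_eq)
    then have s: "monom_eval (w s) m1 \<noteq> monom_eval (w s) m0"
      by (simp add: ev q_def poly_monom)
    define c' where "c' m = c m * (monom_eval (w s) m - monom_eval (w s) m0)" for m
    have "(\<Sum>m\<in>M. c' m * monom_eval v m) = 0" for v
    proof -
      have "(\<Sum>m\<in>M. c' m * monom_eval v m) =
          (c m0 * monom_eval (\<lambda>x. w s x * v x) m0 + (\<Sum>m\<in>M. c m * monom_eval (\<lambda>x. w s x * v x) m))
          - monom_eval (w s) m0 * (c m0 * monom_eval v m0 + (\<Sum>m\<in>M. c m * monom_eval v m))"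
        by (simp add: c'_def monom_eval_mult algebra_simps sum_subtractf sum_distrib_left)
      then show ?thesis using sum0[of v] sum0[of "\<lambda>x. w s x * v x"] by simp
    qed
    from insert.IH[OF this m1] show ?thesis using s by (simp add: c'_def)
  qed
  have "c m0 = 0" using sum0[of "\<lambda>_. 1"] rest by simp
  then show ?case using rest insert.prems(2) by auto
qed simp

lemma mpoly_eq_0_iff:
  "f = 0 \<longleftrightarrow> (\<forall>v. eval_at v f = (0 :: 'k::alg_closed_field))"
proof
  assume *: "\<forall>v. eval_at v f = 0"
  have "lookup f m = 0" if "m \<in> keys f" for m
    by (rule monomials_independent[OF finite_keys _ that]) (use * in \<open>simp add: mpoly_eval_def\<close>)
  then show "f = 0" by (metis in_keys_iff keys_eq_empty all_not_in_conv)
qed (simp add: mpoly_eval_def)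

section \<open>Minors and matrices of bounded rank\<close>

definition low_rank_point :: "nat \<Rightarrow> (nat \<Rightarrow> nat \<Rightarrow> 'a::comm_ring_1) \<Rightarrow> (nat \<Rightarrow> nat \<Rightarrow> 'a) \<Rightarrow> nat \<times> nat \<Rightarrow> 'a" where
  "low_rank_point r y z = (\<lambda>(i, j). \<Sum>k<r. y k i * z k j)"

lemma det_low_rank_eq_0:
  assumes "r < t"
  shows "det (mat t t (\<lambda>(a, b). low_rank_point r y z (\<rho> a, \<gamma> b))) = 0"
proof -
  define A where "A = mat t t (\<lambda>(a, k). if k < r then y k (\<rho> a) else 0)"
  define B where "B = mat t t (\<lambda>(k, b). if k < r then z k (\<gamma> b) else 0)"
  have "(\<Sum>k<r. f k) = (\<Sum>k = 0..<t. if k < r then f k else 0)" for f :: "nat \<Rightarrow> 'a"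
    using assms by (intro sum.mono_neutral_cong_left) auto
  then have "mat t t (\<lambda>(a, b). low_rank_point r y z (\<rho> a, \<gamma> b)) = A * B"
    by (intro eq_matI) (auto simp: A_def B_def low_rank_point_def scalar_prod_def intro!: sum.cong)
  moreover have "det A = 0"
    using laplace_expansion_column[of A t "t - 1"] assms by (auto simp: A_def intro!: sum.neutral)
  ultimately show ?thesis
    using det_mult[of A t B] by (simp add: A_def B_def)
qed

definition below :: "nat \<times> nat \<Rightarrow> nat \<times> nat \<Rightarrow> bool" where
  "below x y \<longleftrightarrow> fst x < fst y \<and> snd x < snd y"

text \<open>
  \<open>chain_end F l x\<close>: some sequence of \<open>l + 1\<close> positions in \<open>F\<close>, increasing in both coordinates,
  ends in \<open>x\<close>; that is, \<open>F\<close> contains the main diagonal of an \<open>(l + 1)\<close>-minor.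
\<close>

fun chain_end :: "(nat \<times> nat) set \<Rightarrow> nat \<Rightarrow> nat \<times> nat \<Rightarrow> bool" where
  "chain_end F 0 x \<longleftrightarrow> x \<in> F"
| "chain_end F (Suc l) x \<longleftrightarrow> x \<in> F \<and> (\<exists>y. chain_end F l y \<and> below y x)"

lemma chain_end_sequence:
  "chain_end F l x \<Longrightarrow> \<exists>\<rho> \<gamma>. strict_mono_on {..<Suc l} \<rho> \<and> strict_mono_on {..<Suc l} \<gamma> \<and>
     (\<forall>a<Suc l. (\<rho> a, \<gamma> a) \<in> F) \<and> (\<rho> l, \<gamma> l) = x"
proof (induction l arbitrary: x)
  case 0
  then show ?case
    by (intro exI[of _ "\<lambda>_. fst x"] exI[of _ "\<lambda>_. snd x"]) (auto simp: strict_mono_on_def)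
next
  case (Suc l)
  then obtain y where y: "chain_end F l y" "below y x" and x: "x \<in> F" by auto
  from Suc.IH[OF y(1)] obtain \<rho> \<gamma> where *: "strict_mono_on {..<Suc l} \<rho>" "strict_mono_on {..<Suc l} \<gamma>"
    "\<forall>a<Suc l. (\<rho> a, \<gamma> a) \<in> F" "(\<rho> l, \<gamma> l) = y" by blast
  have ext: "strict_mono_on {..<Suc (Suc l)} (f(Suc l := c))"
    if "strict_mono_on {..<Suc l} f" "f l < c" for f :: "nat \<Rightarrow> nat" and c
  proof (rule strict_mono_onI)
    fix a b assume ab: "a \<in> {..<Suc (Suc l)}" "b \<in> {..<Suc (Suc l)}" "a < b"
    have "f a \<le> f l" if "a < Suc l"
      using \<open>strict_mono_on {..<Suc l} f\<close> that
      by (metis le_less less_Suc_eq lessI lessThan_iff strict_mono_onD)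
    then show "(f(Suc l := c)) a < (f(Suc l := c)) b"
      using ab that by (auto simp: strict_mono_on_def less_Suc_eq)
  qed
  have "strict_mono_on {..<Suc (Suc l)} (\<rho>(Suc l := fst x))"
    "strict_mono_on {..<Suc (Suc l)} (\<gamma>(Suc l := snd x))"
    using * y(2) by (auto simp: below_def intro!: ext simp del: fun_upd_apply)
  moreover have "\<forall>a<Suc (Suc l). ((\<rho>(Suc l := fst x)) a, (\<gamma>(Suc l := snd x)) a) \<in> F"
    using *(3) x by (auto simp: less_Suc_eq)
  moreover have "((\<rho>(Suc l := fst x)) (Suc l), (\<gamma>(Suc l := snd x)) (Suc l)) = x" by simp
  ultimately show ?case by blast
qed

text \<open>
  Mirsky's theorem, the easy dual of Dilworth's: the greatest length of a chain that ends in a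
  position takes different values at comparable positions.
\<close>

lemma height_function:
  assumes "\<And>x. \<not> chain_end F r x"
  shows "\<exists>ht. (\<forall>x\<in>F. ht x < r) \<and> (\<forall>x\<in>F. \<forall>y\<in>F. below x y \<longrightarrow> ht x < ht y)"
proof -
  have dec: "chain_end F l x" if "chain_end F (Suc l) x" for l x
    using that
  proof (induction l arbitrary: x)
    case (Suc l)
    from Suc.prems obtain y where "x \<in> F" "chain_end F (Suc l) y" "below y x"
      unfolding chain_end.simps(2)[of F "Suc l"] by blast
    then show ?case using Suc.IH[of y] by (simp only: chain_end.simps) blast
  qed simp
  have bound: "l < r" if "chain_end F l x" for l x
  proof (rule ccontr)
    assume "\<not> l < r"
    then have "r \<le> l" by simp
    from this that have "chain_end F r x"
      by (induction rule: inc_induct) (blast intro: dec)+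
    with assms show False by blast
  qed
  define ht where "ht x = (GREATEST l. chain_end F l x)" for x
  have le: "\<forall>l. chain_end F l x \<longrightarrow> l \<le> r" for x using bound less_imp_le by blast
  have ht: "chain_end F (ht x) x" if "x \<in> F" for x
    unfolding ht_def by (rule GreatestI_nat[of _ 0 r]) (use that le[of x] in simp_all)
  have "ht x < ht y" if "x \<in> F" "y \<in> F" "below x y" for x y
  proof -
    have "chain_end F (Suc (ht x)) y"
      unfolding chain_end.simps using ht[OF that(1)] that(2,3) by blast
    then have "Suc (ht x) \<le> ht y"
      unfolding ht_def[of y] using le[of y] by (intro Greatest_le_nat[of _ _ r]) blast+
    then show ?thesis by simp
  qed
  then show ?thesis using ht bound by blast
qed

definition antichain :: "(nat \<times> nat) set \<Rightarrow> bool" where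
  "antichain F \<longleftrightarrow> (\<forall>x\<in>F. \<forall>y\<in>F. \<not> below x y)"

lemma antichainD: "antichain F \<Longrightarrow> (i, j) \<in> F \<Longrightarrow> (i', j') \<in> F \<Longrightarrow> i < i' \<Longrightarrow> j' \<le> j"
  unfolding antichain_def below_def by force

text \<open>
  Seen as edges of a bipartite graph on rows and columns, an antichain is a forest: in the first row
  that it meets, the last position is alone in its row or alone in its column. So arbitrary nonzero
  entries on an antichain occur in a matrix of rank one.
\<close>

lemma antichain_rank_one:
  fixes c :: "nat \<times> nat \<Rightarrow> 'k::field"
  assumes "finite F" "antichain F" "\<And>x. x \<in> F \<Longrightarrow> c x \<noteq> 0"
  shows "\<exists>\<alpha> \<beta>. (\<forall>i. \<alpha> i \<noteq> 0) \<and> (\<forall>j. \<beta> j \<noteq> 0) \<and> (\<forall>(i, j)\<in>F. \<alpha> i * \<beta> j = c (i, j))"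
  using assms
proof (induction "card F" arbitrary: F)
  case 0
  then show ?case by (intro exI[of _ "\<lambda>_. 1"]) auto
next
  case (Suc N)
  have ne: "F \<noteq> {}" using Suc.hyps(2) by auto
  (* the last position (i, j) of the first row *)
  define i where "i = Min (fst ` F)"
  have "i \<in> fst ` F" unfolding i_def using Suc.prems(1) ne by (intro Min_in) simp_all
  have i_min: "i \<le> i'" if "(i', j') \<in> F" for i' j'
  proof -
    have "i' \<in> fst ` F" using imageI[OF that, of fst] by simp
    then show ?thesis unfolding i_def using Suc.prems(1) by (intro Min_le) simp_all
  qed
  define R where "R = {j. (i, j) \<in> F}"
  have "R \<subseteq> snd ` F" by (force simp: R_def)
  then have R: "finite R" "R \<noteq> {}"
    using finite_subset[OF _ finite_imageI[OF Suc.prems(1)]] \<open>i \<in> fst ` F\<close> by (force simp: R_def)+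
  define j where "j = Max R"
  have ij: "(i, j) \<in> F" using Max_in[OF R] by (simp add: j_def R_def)
  define G where "G = F - {(i, j)}"
  have "N = card G" using Suc.hyps(2) ij Suc.prems(1) by (simp add: G_def)
  moreover have "antichain G" using Suc.prems(2) by (auto simp: antichain_def G_def)
  moreover have "finite G" using Suc.prems(1) by (simp add: G_def)
  moreover have "c x \<noteq> 0" if "x \<in> G" for x using Suc.prems(3) that by (simp add: G_def)
  ultimately have "\<exists>\<alpha> \<beta>. (\<forall>i. \<alpha> i \<noteq> 0) \<and> (\<forall>j. \<beta> j \<noteq> 0) \<and> (\<forall>(i, j)\<in>G. \<alpha> i * \<beta> j = c (i, j))"
    by (intro Suc.hyps(1))
  then obtain \<alpha> \<beta> where *: "\<forall>i. \<alpha> i \<noteq> 0" "\<forall>j. \<beta> j \<noteq> 0" "\<forall>(i, j)\<in>G. \<alpha> i * \<beta> j = c (i, j)"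
    by blast
  have G: "\<alpha> a * \<beta> b = c (a, b)" if "(a, b) \<in> G" for a b using bspec[OF *(3) that] by simp
  have FG: "(a, b) = (i, j) \<or> (a, b) \<in> G" if "(a, b) \<in> F" for a b using that by (auto simp: G_def)
  have cij: "c (i, j) \<noteq> 0" using Suc.prems(3) ij by blast
  show ?case
  proof (cases "\<exists>j'. (i, j') \<in> G")
    case True
    then obtain j' where j': "(i, j') \<in> G" by blast
    then have "j' \<in> R" "j' \<noteq> j" by (auto simp: G_def R_def)
    then have "j' < j" unfolding j_def using R by (metis Max_ge le_neq_implies_less)
    have col: "i' = i" if "(i', j) \<in> F" for i'
      using antichainD[OF Suc.prems(2), of i j' i' j] i_min[OF that] that j' \<open>j' < j\<close>
      by (cases "i < i'") (auto simp: G_def)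
    then have "b \<noteq> j" if "(a, b) \<in> G" for a b using that by (auto simp: G_def)
    then have "\<alpha> a * (\<beta>(j := c (i, j) / \<alpha> i)) b = c (a, b)" if "(a, b) \<in> F" for a b
      using FG[OF that] G[of a b] *(1) by auto
    moreover have "\<forall>b. (\<beta>(j := c (i, j) / \<alpha> i)) b \<noteq> 0" using * cij by simp
    ultimately show ?thesis using *(1) by blast
  next
    case False
    then have "a \<noteq> i" if "(a, b) \<in> G" for a b using that by auto
    then have "(\<alpha>(i := c (i, j) / \<beta> j)) a * \<beta> b = c (a, b)" if "(a, b) \<in> F" for a b
      using FG[OF that] G[of a b] *(2) by auto
    moreover have "\<forall>a. (\<alpha>(i := c (i, j) / \<beta> j)) a \<noteq> 0" using * cij by simp
    ultimately show ?thesis using *(2) by blast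
  qed
qed

text \<open>
  An antichain is a decreasing staircase, and \<open>a\<close> is a discrete concave function whose slope between
  rows \<open>l\<close> and \<open>l + 1\<close> is the sum of the last column that \<open>F\<close> meets after row \<open>l\<close> and the first one
  that it meets up to row \<open>l\<close>. Up to sign, \<open>b\<close> is its Legendre transform for the pairing \<open>2 * i * j\<close>; equality in Young's inequality
  picks out the staircase.
\<close>

lemma antichain_potentials:
  assumes F: "F \<subseteq> {..<n} \<times> {..<n}" "antichain F"
  shows "\<exists>a b :: nat \<Rightarrow> nat. (\<forall>(i, j)\<in>F. a i = 2 * i * j + b j) \<and>
    (\<forall>i\<in>fst ` F. \<forall>j\<in>snd ` F. (i, j) \<notin> F \<longrightarrow> a i < 2 * i * j + b j)"
proof -
  (* the values 0 and n keep the slopes decreasing after the last and before the first row of F *)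
  define L where "L l = Max (insert 0 {j. \<exists>i>l. (i, j) \<in> F})" for l
  define U where "U l = Min (insert n {j. \<exists>i\<le>l. (i, j) \<in> F})" for l
  have fin: "finite {j. \<exists>i>l. (i, j) \<in> F}" "finite {j. \<exists>i\<le>l. (i, j) \<in> F}" for l
    using F(1) by (auto intro!: finite_subset[of _ "{..<n}"])
  have L_in: "L l \<in> insert 0 {j. \<exists>i>l. (i, j) \<in> F}" and U_in: "U l \<in> insert n {j. \<exists>i\<le>l. (i, j) \<in> F}" for l
    unfolding L_def U_def using fin[of l] by (intro Max_in Min_in; simp)+
  have L_ge: "j \<le> L l" if "(i, j) \<in> F" "l < i" for i j l
    unfolding L_def using that fin by (intro Max_ge) auto
  have U_le: "U l \<le> j" if "(i, j) \<in> F" "i \<le> l" for i j l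
    unfolding U_def using that fin by (intro Min_le) auto
  have L_le: "L l \<le> j" if "(i, j) \<in> F" "i \<le> l" for i j l
  proof -
    have "j' \<le> j" if "(i', j') \<in> F" "l < i'" for i' j'
      using antichainD[OF F(2) \<open>(i, j) \<in> F\<close> that(1)] \<open>l < i'\<close> \<open>i \<le> l\<close> by simp
    then show ?thesis unfolding L_def using fin by (subst Max_le_iff) auto
  qed
  have U_ge: "j \<le> U l" if "(i, j) \<in> F" "l < i" for i j l
  proof -
    have "j \<le> j'" if "(i', j') \<in> F" "i' \<le> l" for i' j'
      using antichainD[OF F(2) that(1) \<open>(i, j) \<in> F\<close>] \<open>i' \<le> l\<close> \<open>l < i\<close> by simp
    then show ?thesis
      unfolding U_def using fin \<open>(i, j) \<in> F\<close> F(1) by (subst Min_ge_iff) auto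
  qed
  define a where "a i = (\<Sum>l<i. L l + U l)" for i
  have split: "a i' = a i + (\<Sum>l\<in>{i..<i'}. L l + U l)" if "i \<le> i'" for i i'
  proof -
    have "{..<i'} = {..<i} \<union> {i..<i'}" using that by auto
    then show ?thesis unfolding a_def by (simp add: sum.union_disjoint ivl_disj_int)
  qed
  have telescope: "(\<Sum>l\<in>{i..<i'}. 2 * j) + 2 * i * j = 2 * i' * j" if "i \<le> i'" for i i' j :: nat
  proof -
    define d where "d = i' - i"
    have d: "i' = i + d" using that by (simp add: d_def)
    have "2 * j * d + 2 * i * j = 2 * (i + d) * j" by (simp add: algebra_simps)
    then show ?thesis by (simp add: d mult.commute)
  qed
  have slope_le: "L l + U l \<le> 2 * j" if "(i, j) \<in> F" "i \<le> l" for i j l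
    using L_le[OF that] U_le[OF that] by simp
  have slope_ge: "2 * j \<le> L l + U l" if "(i, j) \<in> F" "l < i" for i j l
    using L_ge[OF that] U_ge[OF that] by simp
  have young: "a i' + 2 * i * j \<le> a i + 2 * i' * j" if ij: "(i, j) \<in> F" for i j i'
  proof (cases "i \<le> i'")
    case True
    have "(\<Sum>l\<in>{i..<i'}. L l + U l) \<le> (\<Sum>l\<in>{i..<i'}. 2 * j)"
      using slope_le[OF ij] by (intro sum_mono) simp
    then show ?thesis using split[OF True] telescope[OF True, of j] by simp
  next
    case False
    then have le: "i' \<le> i" by simp
    have "(\<Sum>l\<in>{i'..<i}. 2 * j) \<le> (\<Sum>l\<in>{i'..<i}. L l + U l)"
      using slope_ge[OF ij] by (intro sum_mono) simp
    then show ?thesis using split[OF le] telescope[OF le, of j] by simp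
  qed
  have strict: "a i' + 2 * i * j \<noteq> a i + 2 * i' * j"
    if ij: "(i, j) \<in> F" and i': "i' \<in> fst ` F" and nF: "(i', j) \<notin> F" for i j i'
  proof -
    obtain j' where ij': "(i', j') \<in> F" using i' by auto
    have ne: "i' \<noteq> i" "j' \<noteq> j" using ij nF ij' by auto
    then consider "i < i'" | "i' < i" by linarith
    then show ?thesis
    proof cases
      case 1
      have jj: "j' < j" using antichainD[OF F(2) ij ij' 1] ne by simp
      have "L (i' - 1) \<noteq> j"
      proof
        assume "L (i' - 1) = j"
        then have "j \<in> insert 0 {j. \<exists>i>i' - 1. (i, j) \<in> F}" using L_in[of "i' - 1"] by (simp only:)
        then obtain k where k: "(k, j) \<in> F" "k > i' - 1" using jj by auto
        then have "k > i'" using nF 1 by (cases "k = i'") auto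
        then show False using antichainD[OF F(2) ij' k(1)] jj by simp
      qed
      moreover have i'_le: "i \<le> i' - 1" using 1 by arith
      ultimately have "L (i' - 1) < j" using L_le[OF ij, of "i' - 1"] by simp
      then have "(\<Sum>l\<in>{i..<i'}. L l + U l) < (\<Sum>l\<in>{i..<i'}. 2 * j)"
        using slope_le[OF ij] U_le[OF ij i'_le] 1
        by (intro sum_strict_mono_ex1 bexI[of _ "i' - 1"] ballI) simp_all
      then show ?thesis using split[of i i'] telescope[of i i' j] 1 by simp
    next
      case 2
      have jj: "j < j'" using antichainD[OF F(2) ij' ij 2] ne by simp
      have "U i' \<noteq> j"
      proof
        assume "U i' = j"
        then have "j \<in> insert n {j. \<exists>i\<le>i'. (i, j) \<in> F}" using U_in[of i'] by (simp only:)
        then obtain k where k: "(k, j) \<in> F" "k \<le> i'" using F(1) ij by auto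
        then have "k < i'" using nF by (metis le_neq_implies_less)
        then show False using antichainD[OF F(2) k(1) ij'] jj by simp
      qed
      then have "U i' > j" using U_ge[OF ij, of i'] 2 by simp
      then have "(\<Sum>l\<in>{i'..<i}. 2 * j) < (\<Sum>l\<in>{i'..<i}. L l + U l)"
        using slope_ge[OF ij] L_ge[OF ij, of i'] 2
        by (intro sum_strict_mono_ex1 bexI[of _ i'] ballI) simp_all
      then show ?thesis using split[of i' i] telescope[of i' i j] 2 by simp
    qed
  qed
  have b_ex: "2 * i * j \<le> a i" if ij: "(i, j) \<in> F" for i j
    using young[OF ij, of 0] by (simp add: a_def)
  define b where "b j = (let i = (SOME i. (i, j) \<in> F) in a i - 2 * i * j)" for j
  have b: "a i = 2 * i * j + b j" if ij: "(i, j) \<in> F" for i j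
  proof -
    define i0 where "i0 = (SOME i. (i, j) \<in> F)"
    have i0: "(i0, j) \<in> F" unfolding i0_def using ij by (rule someI)
    show ?thesis
      using young[OF ij, of i0] young[OF i0, of i] b_ex[OF i0] by (simp add: b_def Let_def i0_def[symmetric])
  qed
  have "a i < 2 * i * j + b j" if i: "i \<in> fst ` F" and j: "j \<in> snd ` F" and ij: "(i, j) \<notin> F" for i j
  proof -
    obtain i0 where i0: "(i0, j) \<in> F" using j by auto
    show ?thesis using young[OF i0, of i] strict[OF i0 i ij] b[OF i0] by simp
  qed
  moreover have "\<forall>(i, j)\<in>F. a i = 2 * i * j + b j"
  proof
    fix x assume "x \<in> F"
    then show "case x of (i, j) \<Rightarrow> a i = 2 * i * j + b j" using b by (cases x) simp
  qed
  ultimately have "(\<forall>(i, j)\<in>F. a i = 2 * i * j + b j) \<and>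
    (\<forall>i\<in>fst ` F. \<forall>j\<in>snd ` F. (i, j) \<notin> F \<longrightarrow> a i < 2 * i * j + b j)" by simp
  then show ?thesis by (intro exI)
qed

text \<open>
  With the potentials as exponents of \<open>s\<close>, the antichain becomes the part of lowest order of a matrix
  of rank one. Hence it alone survives in the limit \<open>s \<rightarrow> 0\<close>, once the entries are rescaled by the
  powers \<open>s ^ (2 * i * j)\<close>.
\<close>

lemma rank_one_degeneration:
  fixes c :: "nat \<times> nat \<Rightarrow> 'k::field"
  assumes F: "F \<subseteq> {..<n} \<times> {..<n}" "antichain F" and c: "\<And>x. x \<in> F \<Longrightarrow> c x \<noteq> 0"
  shows "\<exists>X :: 'k \<Rightarrow> nat \<Rightarrow> nat \<Rightarrow> 'k.
    (\<forall>i j. poly_fun (\<lambda>s. s) (\<lambda>s. X s i j)) \<and>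
    (\<forall>i j. X 0 i j = (if (i, j) \<in> F then c (i, j) else 0)) \<and>
    (\<forall>s. s \<noteq> 0 \<longrightarrow> (\<exists>y z. \<forall>i j. X s i j = s ^ (2 * i * j) * (y i * z j)))"
proof -
  obtain a b :: "nat \<Rightarrow> nat" where "(\<forall>(i, j)\<in>F. a i = 2 * i * j + b j) \<and>
    (\<forall>i\<in>fst ` F. \<forall>j\<in>snd ` F. (i, j) \<notin> F \<longrightarrow> a i < 2 * i * j + b j)"
    using antichain_potentials[OF F] by (elim exE)
  then have ab: "(i, j) \<in> F \<Longrightarrow> a i = 2 * i * j + b j"
    "i \<in> fst ` F \<Longrightarrow> j \<in> snd ` F \<Longrightarrow> (i, j) \<notin> F \<Longrightarrow> a i < 2 * i * j + b j" for i j
    by (blast, blast)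
  have "finite F" using F(1) finite_subset by blast
  have "\<exists>\<alpha> \<beta>. (\<forall>i. \<alpha> i \<noteq> 0) \<and> (\<forall>j. \<beta> j \<noteq> 0) \<and> (\<forall>(i, j)\<in>F. \<alpha> i * \<beta> j = c (i, j))"
    by (rule antichain_rank_one[OF \<open>finite F\<close> F(2)]) (rule c)
  then obtain \<alpha> \<beta> where "(\<forall>i. \<alpha> i \<noteq> 0) \<and> (\<forall>j. \<beta> j \<noteq> 0) \<and> (\<forall>(i, j)\<in>F. \<alpha> i * \<beta> j = c (i, j))"
    by (elim exE)
  then have \<alpha>\<beta>: "(i, j) \<in> F \<Longrightarrow> \<alpha> i * \<beta> j = c (i, j)" for i j by blast
  define used where "used i j \<longleftrightarrow> i \<in> fst ` F \<and> j \<in> snd ` F" for i j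
  have used: "used i j" if "(i, j) \<in> F" for i j
    using imageI[OF that, of fst] imageI[OF that, of snd] by (simp add: used_def)
  have le: "a i \<le> 2 * i * j + b j" if "used i j" for i j
    using that ab(1)[of i j] ab(2)[of i j] by (cases "(i, j) \<in> F") (auto simp: used_def)
  define X where "X s i j = (if used i j then \<alpha> i * \<beta> j * s ^ (2 * i * j + b j - a i) else 0)"
    for s :: 'k and i j
  have "X 0 i j = (if (i, j) \<in> F then c (i, j) else 0)" for i j
    using used[of i j] ab(1)[of i j] ab(2)[of i j] \<alpha>\<beta>[of i j] by (auto simp: X_def used_def zero_power)
  moreover have "\<exists>y z. \<forall>i j. X s i j = s ^ (2 * i * j) * (y i * z j)" if "s \<noteq> 0" for s
  proof (intro exI allI)
    fix i j
    show "X s i j = s ^ (2 * i * j) *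
        ((if i \<in> fst ` F then \<alpha> i / s ^ a i else 0) * (if j \<in> snd ` F then \<beta> j * s ^ b j else 0))"
      using le[of i j] that by (auto simp: X_def used_def power_diff power_add)
  qed
  moreover have "poly_fun (\<lambda>s. s) (\<lambda>s. X s i j)" for i j
    unfolding X_def by (cases "used i j") (auto intro!: poly_fun_mult poly_fun_power)
  ultimately show ?thesis by blast
qed

definition weight :: "(nat \<times> nat \<Rightarrow>\<^sub>0 nat) \<Rightarrow> nat" where
  "weight m = (\<Sum>x\<in>keys m. lookup m x * (fst x * snd x))"

lemma weight_superset:
  assumes "finite A" "keys m \<subseteq> A"
  shows "weight m = (\<Sum>x\<in>A. lookup m x * (fst x * snd x))"
  unfolding weight_def using assms
  by (intro sum.mono_neutral_left) (auto simp: in_keys_iff)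

lemma weight_add: "weight (m + m') = weight m + weight m'"
proof -
  let ?A = "keys m \<union> keys m'"
  have "keys (m + m') \<subseteq> ?A" by (rule Poly_Mapping.keys_add)
  then show ?thesis
    by (simp add: weight_superset[of ?A] lookup_add distrib_right sum.distrib)
qed

lemma weight_0 [simp]: "weight 0 = 0"
  by (simp add: weight_def)

lemma weight_single [simp]: "weight (single x k) = k * (fst x * snd x)"
  by (simp add: weight_def)

lemma weight_sum: "weight (\<Sum>i\<in>I. m i) = (\<Sum>i\<in>I. weight (m i))"
  by (induction I rule: infinite_finite_induct) (simp_all add: weight_add)

text \<open>
  Suppose that the support of a term of highest weight contains no diagonal of an \<open>(r + 1)\<close>-minor.
  Then it splits into \<open>r\<close> antichains, and their rank-one degenerations add up to a family of matrices
  of rank at most \<open>r\<close>. In the limit, the part of highest weight vanishes at every point with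
  coordinates in the support, although its restriction to these coordinates is a nonzero polynomial.
\<close>

lemma leading_monomial_has_chain:
  fixes f :: "'k::alg_closed_field matrix_poly"
  assumes V: "indets f \<subseteq> {..<n} \<times> {..<n}"
    and van: "\<And>y z. eval_at (low_rank_point r y z) f = 0"
    and W: "\<And>m. m \<in> keys f \<Longrightarrow> weight m \<le> W"
    and m0: "m0 \<in> keys f" "weight m0 = W"
  shows "\<exists>x. chain_end (keys m0) r x"
proof (rule ccontr)
  define F where "F = keys m0"
  assume "\<nexists>x. chain_end (keys m0) r x"
  then have "\<And>x. \<not> chain_end F r x" unfolding F_def by blast
  from height_function[of F r, OF this] obtain ht :: "nat \<times> nat \<Rightarrow> nat"
    where "(\<forall>x\<in>F. ht x < r) \<and> (\<forall>x\<in>F. \<forall>y\<in>F. below x y \<longrightarrow> ht x < ht y)" ..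
  then have ht: "x \<in> F \<Longrightarrow> ht x < r" "x \<in> F \<Longrightarrow> y \<in> F \<Longrightarrow> below x y \<Longrightarrow> ht x < ht y" for x y
    by simp_all
  have FV: "F \<subseteq> {..<n} \<times> {..<n}" using V m0(1) by (auto simp: F_def indets_def)
  define M where "M = {m \<in> keys f. weight m = W \<and> keys m \<subseteq> F}"
  have "finite M" by (simp add: M_def)
  have "m0 \<in> M" using m0 by (simp add: M_def F_def)
  have "\<exists>v. (\<Sum>m\<in>M. lookup f m * monom_eval v m) \<noteq> 0"
  proof (rule ccontr)
    assume "\<not> ?thesis"
    then have "(\<Sum>m\<in>M. lookup f m * monom_eval v m) = 0" for v by simp
    then have "lookup f m0 = 0"
      by (rule monomials_independent[OF \<open>finite M\<close> _ \<open>m0 \<in> M\<close>])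
    then show False using m0(1) by (simp add: in_keys_iff)
  qed
  then obtain v where v: "(\<Sum>m\<in>M. lookup f m * monom_eval v m) \<noteq> 0" ..
  (* the entries of the limit matrix; zeros among them only make the antichains smaller *)
  define c where "c x = (if x \<in> F then v x else 0)" for x
  define F' where "F' k = {x \<in> F. v x \<noteq> 0 \<and> ht x = k}" for k
  have "antichain (F' k)" for k
    unfolding antichain_def
  proof (intro ballI notI)
    fix x y assume "x \<in> F' k" "y \<in> F' k" "below x y"
    then show False using ht(2)[of x y] by (simp add: F'_def)
  qed
  moreover have "F' k \<subseteq> {..<n} \<times> {..<n}" for k using FV by (auto simp: F'_def)
  ultimately have "\<exists>X :: 'k \<Rightarrow> nat \<Rightarrow> nat \<Rightarrow> 'k.
    (\<forall>i j. poly_fun (\<lambda>s. s) (\<lambda>s. X s i j)) \<and>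
    (\<forall>i j. X 0 i j = (if (i, j) \<in> F' k then v (i, j) else 0)) \<and>
    (\<forall>s. s \<noteq> 0 \<longrightarrow> (\<exists>y z. \<forall>i j. X s i j = s ^ (2 * i * j) * (y i * z j)))" (is "\<exists>X. ?P k X") for k
    by (intro rank_one_degeneration) (auto simp: F'_def)
  then have "\<exists>X. \<forall>k. ?P k (X k)" by (intro choice allI)
  then obtain X where X: "\<And>k. ?P k (X k)" by blast
  have X_poly: "poly_fun (\<lambda>s. s) (\<lambda>s. X k s i j)"
    and X_0: "X k 0 i j = (if (i, j) \<in> F' k then v (i, j) else 0)"
    and X_s: "s \<noteq> 0 \<Longrightarrow> \<exists>y z. \<forall>i j. X k s i j = s ^ (2 * i * j) * (y i * z j)" for k i j s
    using X by blast+
  define Z where "Z s = (\<lambda>(i, j). \<Sum>k<r. X k s i j)" for s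
  have Z_0: "Z 0 = c"
  proof
    fix x :: "nat \<times> nat" obtain i j where x: "x = (i, j)" by (cases x)
    have "Z 0 x = (\<Sum>k<r. if k = ht x then c x else 0)"
      unfolding Z_def x prod.case X_0 by (intro sum.cong) (auto simp: F'_def c_def x)
    then show "Z 0 x = c x" using ht(1)[of x] by (auto simp: c_def)
  qed
  define G where "G s = (\<Sum>m\<in>keys f.
      lookup f m * s ^ (2 * (W - weight m)) * monom_eval (Z s) m)" for s
  have "poly_fun (\<lambda>s. s) (\<lambda>s. Z s x)" for x
    unfolding Z_def by (cases x) (auto intro!: poly_fun_sum X_poly)
  then have "poly_fun (\<lambda>s. s) G"
    unfolding G_def monom_eval_def
    by (intro poly_fun_sum poly_fun_mult poly_fun_const poly_fun_prod poly_fun_power poly_fun_param)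
  have G_s: "G s = 0" if s: "s \<noteq> 0" for s
  proof -
    have "\<forall>k. \<exists>yz. \<forall>i j. X k s i j = s ^ (2 * i * j) * (fst yz i * snd yz j)"
      using X_s[OF s] by (metis fst_conv snd_conv)
    then obtain yz where yz': "\<forall>k i j. X k s i j = s ^ (2 * i * j) * (fst (yz k) i * snd (yz k) j)"
      using choice[of "\<lambda>k yz. \<forall>i j. X k s i j = s ^ (2 * i * j) * (fst yz i * snd yz j)"] by blast
    define y z where "y k = fst (yz k)" and "z k = snd (yz k)" for k
    have yz: "X k s i j = s ^ (2 * i * j) * (y k i * z k j)" for k i j
      using yz' by (simp add: y_def z_def)
    let ?u = "\<lambda>x. s ^ (2 * (fst x * snd x))"
    have Z: "Z s = (\<lambda>x. ?u x * low_rank_point r y z x)"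
      by (auto simp: Z_def low_rank_point_def yz sum_distrib_left mult.assoc)
    have u: "monom_eval ?u m = s ^ (2 * weight m)" for m
      by (simp add: monom_eval_def weight_def power_sum sum_distrib_left mult.left_commute mult.commute
          flip: power_mult)
    have "G s = (\<Sum>m\<in>keys f.
        s ^ (2 * W) * (lookup f m * monom_eval (low_rank_point r y z) m))"
      unfolding G_def Z monom_eval_mult u
      using W by (intro sum.cong refl) (simp add: algebra_simps flip: power_add)
    also have "\<dots> = s ^ (2 * W) * eval_at (low_rank_point r y z) f"
      by (simp add: mpoly_eval_def sum_distrib_left)
    finally show ?thesis using van by simp
  qed
  have "G 0 = 0"
  proof (rule ccontr)
    assume "G 0 \<noteq> 0"
    interpret type_prime "{0 :: 'k}" by (rule type_prime_zero)
    have "finite {s. G s \<in> {0}}"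
      using finite_parameters[OF comm_ring_hom_id \<open>poly_fun (\<lambda>s. s) G\<close>, of 0] \<open>G 0 \<noteq> 0\<close> by simp
    moreover have "UNIV - {0} \<subseteq> {s. G s \<in> {0}}" using G_s by auto
    ultimately show False
      using infinite_alg_closed_field[where 'k = 'k] by (metis finite_Diff2 finite.emptyI finite.insertI finite_subset)
  qed
  moreover have "G 0 = (\<Sum>m\<in>M. lookup f m * monom_eval v m)"
  proof -
    have "monom_eval c m = 0" if "\<not> keys m \<subseteq> F" for m
      unfolding monom_eval_def using that by (intro prod_zero) (auto simp: c_def in_keys_iff)
    moreover have "monom_eval c m = monom_eval v m" if "keys m \<subseteq> F" for m
      using that by (intro monom_eval_cong) (auto simp: c_def)
    ultimately have "lookup f m * 0 ^ (2 * (W - weight m)) * monom_eval c m =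
        (if m \<in> M then lookup f m * monom_eval v m else 0)"
      if "m \<in> keys f" for m
      using W[OF that] that by (cases "weight m = W") (auto simp: M_def power_0_left)
    then have "G 0 = (\<Sum>m\<in>keys f. if m \<in> M then lookup f m * monom_eval v m else 0)"
      unfolding G_def Z_0 by (rule sum.cong[OF refl])
    also have "\<dots> = (\<Sum>m\<in>keys f \<inter> M. lookup f m * monom_eval v m)"
      by (simp add: sum.inter_restrict)
    also have "keys f \<inter> M = M" by (auto simp: M_def)
    finally show ?thesis .
  qed
  ultimately show False using v by simp
qed

section \<open>The ideal of minors\<close>

lemmas comm_ring_hom_eval_point = comm_ring_hom.comm_ring_hom_mpoly_eval[OF comm_ring_hom_id]

text \<open>
  Every permutation but the identity has an inversion, and undoing it raises the sum; so only the
  identity can attain the maximum.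
\<close>

lemma rearrangement:
  fixes \<rho> \<gamma> :: "nat \<Rightarrow> nat"
  assumes mono: "strict_mono_on {..<t} \<rho>" "strict_mono_on {..<t} \<gamma>"
  shows "p permutes {..<t} \<Longrightarrow> p \<noteq> id \<Longrightarrow> (\<Sum>a<t. \<rho> a * \<gamma> (p a)) < (\<Sum>a<t. \<rho> a * \<gamma> a)"
proof -
  define cost where "cost q = (\<Sum>a<t. \<rho> a * \<gamma> (q a))" for q
  define B where "B = Max (cost ` {q. q permutes {..<t}})"
  have B: "cost q \<le> B" if "q permutes {..<t}" for q
    unfolding B_def using that by (intro Max_ge) (auto simp: finite_permutations)
  have swap: "\<exists>q'. q' permutes {..<t} \<and> cost q < cost q'" if q: "q permutes {..<t}" and "q \<noteq> id" for q
  proof -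
    (* the least moved point a and its preimage b form an inversion *)
    define a where "a = (LEAST a. q a \<noteq> a)"
    have "\<exists>a. q a \<noteq> a" using \<open>q \<noteq> id\<close> by auto
    then have qa: "q a \<noteq> a" unfolding a_def by (rule LeastI_ex)
    have fixed: "q c = c" if "c < a" for c using not_less_Least[of c "\<lambda>a. q a \<noteq> a"] that by (auto simp: a_def)
    have inj: "x = y" if "q x = q y" for x y using permutes_inj[OF q] that by (simp add: inj_eq)
    have "a < t" using qa permutes_not_in[OF q, of a] by (cases "a < t") auto
    have "a < q a" using fixed[of "q a"] inj[of "q a" a] qa by (cases "q a < a") auto
    define b where "b = inv_into UNIV q a"
    have qb: "q b = a" unfolding b_def by (rule permutes_inverses(1)[OF q])
    have "b \<noteq> a" using qa qb by auto
    have "a < b" using fixed[of b] qb \<open>b \<noteq> a\<close> by (cases "b < a") auto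
    have "b < t" using qb permutes_not_in[OF q, of b] \<open>b \<noteq> a\<close> by (cases "b < t") auto
    have "q a < t" using permutes_in_image[OF q, of a] \<open>a < t\<close> by simp
    define q' where "q' = q \<circ> transpose a b"
    have q': "q' permutes {..<t}"
      unfolding q'_def using \<open>a < t\<close> \<open>b < t\<close> by (intro permutes_compose permutes_swap_id q) auto
    have "q' a = a" "q' b = q a" by (simp_all add: q'_def qb)
    have other: "q' c = q c" if "c \<noteq> a" "c \<noteq> b" for c using that by (simp add: q'_def)
    let ?C = "{..<t} - {a, b}"
    have ab: "{a, b} \<subseteq> {..<t}" using \<open>a < t\<close> \<open>b < t\<close> by auto
    have split: "cost q = (\<Sum>c\<in>?C. \<rho> c * \<gamma> (q c)) + (\<rho> a * \<gamma> (q a) + \<rho> b * \<gamma> (q b))" for q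
      unfolding cost_def using sum.subset_diff[OF ab, of "\<lambda>c. \<rho> c * \<gamma> (q c)"] \<open>b \<noteq> a\<close> by simp
    have "(\<Sum>c\<in>?C. \<rho> c * \<gamma> (q' c)) = (\<Sum>c\<in>?C. \<rho> c * \<gamma> (q c))"
      using other by (intro sum.cong) auto
    moreover have "\<rho> a * \<gamma> (q a) + \<rho> b * \<gamma> a < \<rho> a * \<gamma> a + \<rho> b * \<gamma> (q a)"
    proof -
      have "\<rho> a < \<rho> b" using strict_mono_onD[OF mono(1), of a b] \<open>a < t\<close> \<open>b < t\<close> \<open>a < b\<close> by simp
      moreover have "\<gamma> a < \<gamma> (q a)"
        using strict_mono_onD[OF mono(2), of a "q a"] \<open>a < t\<close> \<open>q a < t\<close> \<open>a < q a\<close> by simp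
      ultimately obtain d e where "\<rho> b = \<rho> a + Suc d" "\<gamma> (q a) = \<gamma> a + Suc e"
        using less_imp_Suc_add by (metis add_Suc_right)
      then show ?thesis by (simp add: algebra_simps)
    qed
    ultimately have "cost q < cost q'"
      unfolding split[of q] split[of q'] \<open>q' a = a\<close> \<open>q' b = q a\<close> qb by simp
    then show ?thesis using q' by blast
  qed
  have "cost q < cost id" if "q permutes {..<t}" "q \<noteq> id" for q
    using that
  proof (induction "B - cost q" arbitrary: q rule: less_induct)
    case less
    obtain q' where q': "q' permutes {..<t}" "cost q < cost q'" using swap[OF less.prems] by blast
    show ?case
    proof (cases "q' = id")
      case False
      have "B - cost q' < B - cost q" using q' B[OF q'(1)] by simp
      from less.hyps[OF this q'(1) False] show ?thesis using q'(2) by simp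
    qed (use q' in simp)
  qed
  then show "p permutes {..<t} \<Longrightarrow> p \<noteq> id \<Longrightarrow> (\<Sum>a<t. \<rho> a * \<gamma> (p a)) < (\<Sum>a<t. \<rho> a * \<gamma> a)"
    by (simp add: cost_def)
qed

lemma keys_sum_subset:
  "keys (\<Sum>i\<in>I. f i :: 'a \<Rightarrow>\<^sub>0 'b::comm_monoid_add) \<subseteq> (\<Union>i\<in>I. keys (f i))"
proof (induction I rule: infinite_finite_induct)
  case (insert i I)
  then show ?case using Poly_Mapping.keys_add[of "f i" "\<Sum>i\<in>I. f i"] by auto
qed simp_all

lemma prod_Var:
  "(\<Prod>a\<in>A. Var (x a)) = (single (\<Sum>a\<in>A. single (x a) 1) 1 :: ('x, 'k::comm_ring_1) mpoly)"
proof (induction A rule: infinite_finite_induct)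
  case (insert a A)
  then show ?case by (simp add: Var_def mult_single)
qed simp_all

text \<open>
  By the rearrangement inequality, the diagonal term of a minor of the generic matrix has higher
  weight than its other terms.
\<close>

lemma minor_leading_term:
  fixes \<rho> \<gamma> :: "nat \<Rightarrow> nat"
  assumes "strict_mono_on {..<t} \<rho>" "strict_mono_on {..<t} \<gamma>"
  defines "d \<equiv> \<Sum>a<t. single (\<rho> a, \<gamma> a) 1"
  shows "\<exists>R. det (mat t t (\<lambda>(a, b). Var (\<rho> a, \<gamma> b))) =
      (single d 1 + R :: 'k::comm_ring_1 matrix_poly) \<and>
    (\<forall>m\<in>keys R. weight m < weight d)"
proof -
  let ?S = "{p. p permutes {..<t}}"
  define leib where "leib p = (signof p * (\<Prod>a<t. Var (\<rho> a, \<gamma> (p a))) :: 'k matrix_poly)" for p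
  have "det (mat t t (\<lambda>(a, b). Var (\<rho> a, \<gamma> b))) = (\<Sum>p\<in>?S. leib p)"
    unfolding det_def'[OF mat_carrier] leib_def lessThan_atLeast0
  proof (rule sum.cong[OF refl])
    fix p assume p: "p \<in> {p. p permutes {0..<t}}"
    have "mat t t (\<lambda>(a, b). Var (\<rho> a, \<gamma> b)) $$ (i, p i) = (Var (\<rho> i, \<gamma> (p i)) :: 'k matrix_poly)"
      if "i \<in> {0..<t}" for i using p permutes_in_image[of p "{0..<t}" i] that by simp
    then show "signof p * (\<Prod>i = 0..<t. mat t t (\<lambda>(a, b). Var (\<rho> a, \<gamma> b)) $$ (i, p i)) =
        (signof p * (\<Prod>a\<in>{0..<t}. Var (\<rho> a, \<gamma> (p a))) :: 'k matrix_poly)"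
      by (simp cong: prod.cong_simp)
  qed
  also have "\<dots> = leib id + (\<Sum>p\<in>?S - {id}. leib p)"
    by (rule sum.remove) (simp_all add: finite_permutations permutes_id)
  also have "leib id = single d 1"
    by (simp add: leib_def prod_Var d_def)
  finally have eq: "det (mat t t (\<lambda>(a, b). Var (\<rho> a, \<gamma> b))) = single d 1 + (\<Sum>p\<in>?S - {id}. leib p)" .
  have wt: "weight (\<Sum>a<t. single (\<rho> a, \<gamma> (p a)) 1) = (\<Sum>a<t. \<rho> a * \<gamma> (p a))" for p
    by (simp add: weight_sum)
  have "weight m < weight d" if m: "m \<in> keys (\<Sum>p\<in>?S - {id}. leib p)" for m
  proof -
    have "m \<in> (\<Union>p\<in>?S - {id}. keys (leib p))"
      by (rule subsetD[OF keys_sum_subset m])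
    then obtain p where p: "p permutes {..<t}" "p \<noteq> id" "m \<in> keys (leib p)" by blast
    have "keys (leib p) \<subseteq> {\<Sum>a<t. single (\<rho> a, \<gamma> (p a)) 1}"
      unfolding leib_def prod_Var by (cases "evenperm p") (simp_all add: sign_def)
    then have m_eq: "m = (\<Sum>a<t. single (\<rho> a, \<gamma> (p a)) 1)" using p(3) by blast
    have "weight d = (\<Sum>a<t. \<rho> a * \<gamma> a)" using wt[of id] by (simp only: d_def id_apply)
    then show ?thesis
      unfolding m_eq wt using rearrangement[OF assms(1,2) p(1,2)] by (simp only:)
  qed
  with eq show ?thesis by blast
qed

lemma poly_ideal_closed:
  assumes "ideal J (poly_ring V :: ('x, 'k::comm_ring_1) mpoly ring)"
  shows "0 \<in> J" "a \<in> J \<Longrightarrow> b \<in> J \<Longrightarrow> a + b \<in> J" "a \<in> J \<Longrightarrow> indets r \<subseteq> V \<Longrightarrow> r * a \<in> J"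
    "a \<in> J \<Longrightarrow> indets a \<subseteq> V" "a \<in> J \<Longrightarrow> - a \<in> J" "a \<in> J \<Longrightarrow> b \<in> J \<Longrightarrow> a - b \<in> J"
proof -
  interpret ideal J "poly_ring V :: ('x, 'k) mpoly ring" by fact
  show zero: "0 \<in> J"
    using additive_subgroup.zero_closed[OF ideal.axioms(1)[OF assms]] by (simp add: poly_ring_simps)
  show add: "a + b \<in> J" if "a \<in> J" "b \<in> J" for a b
    using additive_subgroup.a_closed[OF ideal.axioms(1)[OF assms] that] by (simp add: poly_ring_simps)
  show car: "indets a \<subseteq> V" if "a \<in> J" for a
    using additive_subgroup.a_Hcarr[OF ideal.axioms(1)[OF assms] that] by (simp add: poly_ring_simps)
  show mult: "r * a \<in> J" if "a \<in> J" "indets r \<subseteq> V" for a r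
    using I_l_closed[of a r] that by (simp add: poly_ring_simps)
  show minus: "- a \<in> J" if "a \<in> J" for a
    using mult[OF that, of "-1"] by (simp add: indets_uminus)
  show "a - b \<in> J" if "a \<in> J" "b \<in> J" for a b
    using add[OF that(1) minus[OF that(2)]] by simp
qed

lemma poly_ideal_sum:
  assumes "ideal J (poly_ring V :: ('x, 'k::comm_ring_1) mpoly ring)"
  shows "(\<And>i. i \<in> I \<Longrightarrow> f i \<in> J) \<Longrightarrow> sum f I \<in> J"
  by (induction I rule: infinite_finite_induct) (auto intro: poly_ideal_closed[OF assms])

lemma poly_idealI:
  fixes J :: "('x, 'k::comm_ring_1) mpoly set"
  assumes "\<And>a. a \<in> J \<Longrightarrow> indets a \<subseteq> V" "0 \<in> J" "\<And>a b. a \<in> J \<Longrightarrow> b \<in> J \<Longrightarrow> a + b \<in> J"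
    and mult: "\<And>a r. a \<in> J \<Longrightarrow> indets r \<subseteq> V \<Longrightarrow> r * a \<in> J"
  shows "ideal J (poly_ring V)"
proof -
  interpret R: cring "poly_ring V :: ('x, 'k) mpoly ring" by (rule cring_poly_ring)
  have inv: "\<ominus>\<^bsub>poly_ring V\<^esub> a = - a" if "indets a \<subseteq> V" for a :: "('x, 'k) mpoly"
    using that by (intro R.minus_equality) (simp_all add: poly_ring_simps indets_uminus)
  show ?thesis
  proof (rule idealI)
    show "ring (poly_ring V :: ('x, 'k) mpoly ring)" by unfold_locales
    show "subgroup J (add_monoid (poly_ring V))"
    proof (rule R.add.subgroupI)
      show "J \<subseteq> carrier (poly_ring V)" using assms(1) by (auto simp: poly_ring_simps)
      show "J \<noteq> {}" using assms(2) by blast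
      fix a assume a: "a \<in> J"
      have "- a \<in> J" using mult[OF a, of "-1"] by (simp add: indets_uminus)
      then show "\<ominus>\<^bsub>poly_ring V\<^esub> a \<in> J" using inv assms(1)[OF a] by simp
    next
      fix a b assume "a \<in> J" "b \<in> J"
      then show "a \<oplus>\<^bsub>poly_ring V\<^esub> b \<in> J" using assms(3) by (simp add: poly_ring_simps)
    qed
  qed (use mult in \<open>simp_all add: poly_ring_simps mult.commute\<close>)
qed

lemma ideal_preimage:
  fixes e :: "('x, 'k::comm_ring_1) mpoly \<Rightarrow> 'a::comm_ring_1"
  assumes "comm_ring_hom e" "type_ideal p"
  shows "ideal {f. indets f \<subseteq> V \<and> e f \<in> p} (poly_ring V)"
proof -
  interpret comm_ring_hom e by fact
  interpret type_ideal p by fact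
  show ?thesis
  proof (rule poly_idealI)
    fix a r :: "('x, 'k) mpoly"
    assume "a \<in> {f. indets f \<subseteq> V \<and> e f \<in> p}" "indets r \<subseteq> V"
    then show "r * a \<in> {f. indets f \<subseteq> V \<and> e f \<in> p}"
      using indets_mult[of r a] by (auto simp: hom_mult mult_mem)
  next
    fix a b :: "('x, 'k) mpoly"
    assume "a \<in> {f. indets f \<subseteq> V \<and> e f \<in> p}" "b \<in> {f. indets f \<subseteq> V \<and> e f \<in> p}"
    then show "a + b \<in> {f. indets f \<subseteq> V \<and> e f \<in> p}"
      using indets_add[of a b] by (auto simp: hom_add add_mem)
  qed (auto simp: zero_mem)
qed

lemma genideal_poly_ring_ideal:
  "G \<subseteq> {f. indets f \<subseteq> V} \<Longrightarrow> ideal (Idl\<^bsub>poly_ring V\<^esub> G) (poly_ring V :: ('x, 'k::comm_ring_1) mpoly ring)"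
  using ring.genideal_ideal[OF cring.axioms(1)[OF cring_poly_ring[of V]], of G]
  by (simp add: poly_ring_simps subset_iff)

lemma genideal_mem: "f \<in> G \<Longrightarrow> f \<in> Idl\<^bsub>R\<^esub> G"
  unfolding genideal_def by blast

lemma genideal_least: "ideal J R \<Longrightarrow> G \<subseteq> J \<Longrightarrow> Idl\<^bsub>R\<^esub> G \<subseteq> J"
  unfolding genideal_def by blast

lemma submatrix_generic_matrix:
  assumes "A \<subseteq> {..<n}" "B \<subseteq> {..<n}" "card A = t" "card B = t"
  shows "submatrix (generic_matrix n) A B = mat t t (\<lambda>(a, b). Var (pick A a, pick B b))"
proof -
  have "{i. i < n \<and> i \<in> A} = A" "{i. i < n \<and> i \<in> B} = B" using assms by auto
  moreover have "pick A a < n" if "a < t" for a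
    using pick_in_set_le[of a A] that assms by auto
  moreover have "pick B a < n" if "a < t" for a
    using pick_in_set_le[of a B] that assms by auto
  ultimately show ?thesis
    using assms by (intro eq_matI) (auto simp: submatrix_def generic_matrix_def)
qed

lemma pick_image:
  assumes "strict_mono_on {..<t} \<rho>"
  shows "a < t \<Longrightarrow> pick (\<rho> ` {..<t}) a = (\<rho> a :: nat)"
proof (induction a)
  case 0
  have "\<rho> 0 \<le> \<rho> b" if "b < t" for b
    using strict_mono_on_leD[OF assms, of 0 b] that 0 by simp
  then show ?case using 0 by (auto intro!: Least_equality)
next
  case (Suc a)
  then have IH: "pick (\<rho> ` {..<t}) a = \<rho> a" by simp
  have less: "\<rho> a < \<rho> (Suc a)" using strict_mono_onD[OF assms, of a "Suc a"] Suc.prems by simp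
  have "\<rho> (Suc a) \<le> \<rho> b" if "b < t" "\<rho> a < \<rho> b" for b
  proof -
    have "a < b" using strict_mono_on_leD[OF assms, of b a] that Suc.prems by (cases "b \<le> a") auto
    then show ?thesis using strict_mono_on_leD[OF assms, of "Suc a" b] that Suc.prems by simp
  qed
  then show ?case
    using Suc.prems less by (auto simp: IH intro!: Least_equality)
qed

definition minors :: "nat \<Rightarrow> nat \<Rightarrow> 'k::comm_ring_1 matrix_poly set" where
  "minors n t = {det (submatrix (generic_matrix n) A B) | A B.
     A \<subseteq> {..<n} \<and> B \<subseteq> {..<n} \<and> card A = t \<and> card B = t}"

lemma determinantal_ideal_eq: "determinantal_ideal n t = Idl\<^bsub>matrix_poly_ring n\<^esub> (minors n t)"
  by (simp add: determinantal_ideal_def minors_def)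

lemma minorsE:
  assumes "f \<in> minors n t"
  obtains A B where "A \<subseteq> {..<n}" "B \<subseteq> {..<n}" "card A = t" "card B = t"
    "f = det (mat t t (\<lambda>(a, b). Var (pick A a, pick B b)))"
    "\<And>a. a < t \<Longrightarrow> pick A a < n" "\<And>a. a < t \<Longrightarrow> pick B a < n"
proof -
  obtain A B where *: "A \<subseteq> {..<n}" "B \<subseteq> {..<n}" "card A = t" "card B = t"
    "f = det (submatrix (generic_matrix n) A B)"
    using assms unfolding minors_def by blast
  have "pick A a < n" "pick B a < n" if "a < t" for a
    using pick_in_set_le[of a A] pick_in_set_le[of a B] \<open>a < t\<close> * by auto
  then show thesis
    by (intro that[OF *(1-4)]) (simp_all only: *(5) submatrix_generic_matrix[OF *(1-4)])
qed

lemma indets_minors: "(minors n t :: 'k::comm_ring_1 matrix_poly set) \<subseteq> {f. indets f \<subseteq> {..<n} \<times> {..<n}}"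
proof
  fix f :: "'k matrix_poly" assume "f \<in> minors n t"
  then obtain A B where *: "f = det (mat t t (\<lambda>(a, b). Var (pick A a, pick B b)))"
    "\<And>a. a < t \<Longrightarrow> pick A a < n" "\<And>a. a < t \<Longrightarrow> pick B a < n" using minorsE by blast
  show "f \<in> {f. indets f \<subseteq> {..<n} \<times> {..<n}}"
    unfolding *(1) mem_Collect_eq using *(2,3) by (intro indets_det[of _ t]) auto
qed

lemma ideal_determinantal_ideal: "ideal (determinantal_ideal n t) (matrix_poly_ring n)"
  unfolding determinantal_ideal_eq matrix_poly_ring_def
  by (rule genideal_poly_ring_ideal[OF indets_minors])

lemma det_mem_determinantal_ideal:
  assumes "strict_mono_on {..<t} \<rho>" "strict_mono_on {..<t} \<gamma>"
    and "\<And>a. a < t \<Longrightarrow> \<rho> a < n" "\<And>a. a < t \<Longrightarrow> \<gamma> a < n"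
  shows "det (mat t t (\<lambda>(a, b). Var (\<rho> a, \<gamma> b))) \<in> determinantal_ideal n t"
proof -
  have card: "card (\<rho> ` {..<t}) = t" "card (\<gamma> ` {..<t}) = t"
    using card_image[OF strict_mono_on_imp_inj_on[OF assms(1)]]
      card_image[OF strict_mono_on_imp_inj_on[OF assms(2)]] by simp_all
  have sub: "\<rho> ` {..<t} \<subseteq> {..<n}" "\<gamma> ` {..<t} \<subseteq> {..<n}" using assms(3,4) by auto
  have "submatrix (generic_matrix n) (\<rho> ` {..<t}) (\<gamma> ` {..<t}) = mat t t (\<lambda>(a, b). Var (\<rho> a, \<gamma> b))"
    unfolding submatrix_generic_matrix[OF sub card]
    using pick_image[OF assms(1)] pick_image[OF assms(2)] by (intro eq_matI) auto
  then have "det (mat t t (\<lambda>(a, b). Var (\<rho> a, \<gamma> b))) \<in> minors n t"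
    unfolding minors_def using sub card by (metis (mono_tags, lifting) mem_Collect_eq)
  then show ?thesis unfolding determinantal_ideal_eq by (rule genideal_mem)
qed

lemma minor_low_rank_eq_0:
  assumes "r < t"
  shows "eval_at (low_rank_point r y z) (det (mat t t (\<lambda>(a, b). Var (\<rho> a, \<gamma> b)))) =
    (0 :: 'k::comm_ring_1)"
proof -
  interpret e: comm_ring_hom "eval_at (low_rank_point r y z)"
    by (rule comm_ring_hom_eval_point)
  have m: "map_mat (eval_at (low_rank_point r y z)) (mat t t (\<lambda>(a, b). Var (\<rho> a, \<gamma> b))) =
      mat t t (\<lambda>(a, b). low_rank_point r y z (\<rho> a, \<gamma> b))"
    by (intro eq_matI) (auto simp: comm_ring_hom.mpoly_eval_Var[OF comm_ring_hom_id])
  show ?thesis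
    unfolding e.hom_det[symmetric] m by (rule det_low_rank_eq_0[OF assms])
qed

text \<open>
  Division by minors: each term of highest weight is a multiple of the diagonal term of a minor, so
  subtracting multiples of minors lowers the weight.
\<close>

lemma mem_determinantal_ideal_if_vanishing:
  fixes f :: "'k::alg_closed_field matrix_poly"
  assumes "indets f \<subseteq> {..<n} \<times> {..<n}"
    and "\<And>y z. eval_at (low_rank_point r y z) f = 0"
    and "\<And>m. m \<in> keys f \<Longrightarrow> weight m < W"
  shows "f \<in> determinantal_ideal n (Suc r)"
  using assms
proof (induction W arbitrary: f)
  case 0
  have "f = 0"
  proof (rule poly_mapping_eqI)
    fix m show "lookup f m = lookup 0 m"
      using "0.prems"(3)[of m] by (auto simp: in_keys_iff)
  qed
  then show ?case
    using poly_ideal_closed(1)[OF ideal_determinantal_ideal[unfolded matrix_poly_ring_def]] by simp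
next
  case (Suc W f)
  note J = ideal_determinantal_ideal[where 'a = 'k, of n "Suc r", unfolded matrix_poly_ring_def]
  define T where "T = {m \<in> keys f. weight m = W}"
  let ?minor = "\<lambda>\<rho> \<gamma>. det (mat (Suc r) (Suc r) (\<lambda>(a, b). Var (\<rho> a, \<gamma> b))) :: 'k matrix_poly"
  have "\<exists>g. g \<in> determinantal_ideal n (Suc r) \<and>
      (\<forall>y z. eval_at (low_rank_point r y z) g = 0) \<and>
      (\<forall>m'\<in>keys (single m (lookup f m) - g). weight m' < W)"
    if m: "m \<in> T" for m
  proof -
    have "\<exists>x. chain_end (keys m) r x"
      using m Suc.prems by (intro leading_monomial_has_chain[of f n r W]) (auto simp: T_def less_Suc_eq_le)
    then obtain \<rho> \<gamma> where mono: "strict_mono_on {..<Suc r} \<rho>" "strict_mono_on {..<Suc r} \<gamma>"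
      and mem: "\<And>a. a < Suc r \<Longrightarrow> (\<rho> a, \<gamma> a) \<in> keys m"
      using chain_end_sequence by blast
    have mV: "keys m \<subseteq> {..<n} \<times> {..<n}"
      using m Suc.prems(1) by (auto simp: T_def indets_def)
    define d where "d = (\<Sum>a<Suc r. single (\<rho> a, \<gamma> a) (1::nat))"
    obtain R where R: "?minor \<rho> \<gamma> = single d 1 + R"
      "\<forall>m\<in>keys R. weight m < weight d"
      using minor_leading_term[OF mono] unfolding d_def by blast
    have inj: "inj_on (\<lambda>a. (\<rho> a, \<gamma> a)) {..<Suc r}"
      using strict_mono_on_imp_inj_on[OF mono(1)] by (auto simp: inj_on_def)
    have "lookup d x \<le> lookup m x" for x
    proof -
      have "lookup d x = (\<Sum>a<Suc r. if (\<rho> a, \<gamma> a) = x then 1 else 0)"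
        by (simp only: d_def lookup_sum lookup_single when_def)
      also have "\<dots> = card {a \<in> {..<Suc r}. (\<rho> a, \<gamma> a) = x}"
        by (simp add: sum.If_cases Int_def del: sum.lessThan_Suc)
      also have "\<dots> \<le> lookup m x"
      proof (cases "\<exists>a<Suc r. (\<rho> a, \<gamma> a) = x")
        case True
        then obtain a where a: "a < Suc r" "(\<rho> a, \<gamma> a) = x" by blast
        then have "{a \<in> {..<Suc r}. (\<rho> a, \<gamma> a) = x} = {a}" using inj by (auto simp: inj_on_def)
        moreover have "lookup m x \<noteq> 0" using mem[OF a(1)] a(2) by (simp add: in_keys_iff)
        ultimately show ?thesis by simp
      next
        case False
        then have "{a \<in> {..<Suc r}. (\<rho> a, \<gamma> a) = x} = {}" by blast
        then show ?thesis by (simp only: card.empty)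
      qed
      finally show ?thesis .
    qed
    then have "d + (m - d) = m"
      by (intro poly_mapping_eqI) (simp add: lookup_add lookup_minus)
    define g where "g = single (m - d) (lookup f m) * ?minor \<rho> \<gamma>"
    have keys_md: "keys (m - d) \<subseteq> keys m"
      by (auto simp: in_keys_iff lookup_minus)
    have "?minor \<rho> \<gamma> \<in> determinantal_ideal n (Suc r)"
      using mem mV by (intro det_mem_determinantal_ideal mono) auto
    moreover have "indets (single (m - d) (lookup f m)) \<subseteq> {..<n} \<times> {..<n}"
      using indets_single[of "m - d" "lookup f m"] keys_md mV by blast
    ultimately have "g \<in> determinantal_ideal n (Suc r)"
      unfolding g_def by (intro poly_ideal_closed(3)[OF J])
    moreover have "eval_at (low_rank_point r y z) g = 0" for y z
      unfolding g_def comm_ring_hom.mpoly_eval_mult[OF comm_ring_hom_id] by (simp add: minor_low_rank_eq_0)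
    moreover have "weight m' < W"
      if "m' \<in> keys (single m (lookup f m) - g)" for m'
    proof -
      have "single m (lookup f m) - g =
          - (single (m - d) (lookup f m) * R)"
        unfolding g_def R(1) distrib_left mult_single using \<open>d + (m - d) = m\<close> by (simp add: add.commute)
      then have "m' \<in> keys (single (m - d) (lookup f m) * R)"
        using that by simp
      then obtain a b where "m' = a + b" "b \<in> keys R"
        "a \<in> keys (single (m - d) (lookup f m))"
        using subsetD[OF Poly_Mapping.keys_mult] by fastforce
      then have "m' = (m - d) + b" "weight b < weight d" using R(2) by (auto split: if_splits)
      then have "weight m' < weight (d + (m - d))" by (simp add: weight_add)
      then show ?thesis using m \<open>d + (m - d) = m\<close> by (simp add: T_def)
    qed
    ultimately show ?thesis by blast
  qed
  then have "\<forall>m. \<exists>g. m \<in> T \<longrightarrow> g \<in> determinantal_ideal n (Suc r) \<and>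
      (\<forall>y z. eval_at (low_rank_point r y z) g = 0) \<and>
      (\<forall>m'\<in>keys (single m (lookup f m) - g). weight m' < W)"
    by simp
  from choice[OF this] obtain g where "\<forall>m. m \<in> T \<longrightarrow> g m \<in> determinantal_ideal n (Suc r) \<and>
      (\<forall>y z. eval_at (low_rank_point r y z) (g m) = 0) \<and>
      (\<forall>m'\<in>keys (single m (lookup f m) - g m). weight m' < W)" ..
  then have g: "m \<in> T \<Longrightarrow> g m \<in> determinantal_ideal n (Suc r)"
    "m \<in> T \<Longrightarrow> eval_at (low_rank_point r y z) (g m) = 0"
    "m \<in> T \<Longrightarrow> m' \<in> keys (single m (lookup f m) - g m) \<Longrightarrow> weight m' < W"
    for m y z m' by simp_all
  define s where "s = (\<Sum>m\<in>T. g m)"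
  have s: "s \<in> determinantal_ideal n (Suc r)" unfolding s_def by (intro poly_ideal_sum[OF J] g)
  have "f - s \<in> determinantal_ideal n (Suc r)"
  proof (rule Suc.IH)
    show "indets (f - s) \<subseteq> {..<n} \<times> {..<n}"
      using indets_diff[of f s] Suc.prems(1) poly_ideal_closed(4)[OF J s] by blast
    show "eval_at (low_rank_point r y z) (f - s) = 0" for y z
    proof -
      interpret e: comm_ring_hom "eval_at (low_rank_point r y z)"
        by (rule comm_ring_hom_eval_point)
      have "eval_at (low_rank_point r y z) s = 0"
        unfolding s_def comm_ring_hom.mpoly_eval_sum[OF comm_ring_hom_id] by (intro sum.neutral ballI g)
      then show ?thesis using Suc.prems(2) by (simp add: e.hom_minus)
    qed
    fix m' assume m': "m' \<in> keys (f - s)"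
    let ?s = "\<lambda>m. single m (lookup f m)"
    have "T \<subseteq> keys f" by (auto simp: T_def)
    have "f = (\<Sum>m\<in>keys f - T. ?s m) + (\<Sum>m\<in>T. ?s m)"
      using poly_mapping_sum_monomials[of f] sum.subset_diff[OF \<open>T \<subseteq> keys f\<close>, of ?s] by simp
    then have "f - s = (\<Sum>m\<in>keys f - T. ?s m) + (\<Sum>m\<in>T. ?s m - g m)"
      by (simp add: s_def sum_subtractf)
    then have "keys (f - s) \<subseteq>
        keys (\<Sum>m\<in>keys f - T. ?s m) \<union> keys (\<Sum>m\<in>T. ?s m - g m)"
      by (simp only: Poly_Mapping.keys_add)
    also have "\<dots> \<subseteq> (\<Union>m\<in>keys f - T. keys (?s m)) \<union> (\<Union>m\<in>T. keys (?s m - g m))"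
      by (intro Un_mono keys_sum_subset)
    finally have "m' \<in> \<dots>" using m' by (rule subsetD)
    then show "weight m' < W"
    proof
      assume "m' \<in> (\<Union>m\<in>keys f - T. keys (?s m))"
      then have "m' \<in> keys f - T" by (auto split: if_splits)
      then show ?thesis using Suc.prems(3)[of m'] by (auto simp: T_def)
    next
      assume "m' \<in> (\<Union>m\<in>T. keys (?s m - g m))"
      then show ?thesis using g(3) by blast
    qed
  qed
  from poly_ideal_closed(2)[OF J this s] show ?case by simp
qed

text \<open>
  This is the second fundamental theorem of invariant theory for the general linear group: the
  relations between the entries of a product of an \<open>n \<times> r\<close> and an \<open>r \<times> n\<close> matrix are generated by
  the \<open>(r + 1)\<close>-minors.
\<close>

theorem mem_determinantal_ideal_iff:
  fixes f :: "'k::alg_closed_field matrix_poly"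
  shows "f \<in> determinantal_ideal n (Suc r) \<longleftrightarrow> indets f \<subseteq> {..<n} \<times> {..<n} \<and>
    (\<forall>y z. eval_at (low_rank_point r y z) f = 0)"
proof
  assume f: "f \<in> determinantal_ideal n (Suc r)"
  have "eval_at (low_rank_point r y z) f = 0" for y z
  proof -
    let ?J = "{f. indets f \<subseteq> {..<n} \<times> {..<n} \<and> eval_at (low_rank_point r y z) f \<in> {0}}"
    have "minors n (Suc r) \<subseteq> ?J"
    proof
      fix g :: "'k matrix_poly" assume g: "g \<in> minors n (Suc r)"
      obtain A B where g_eq: "g = det (mat (Suc r) (Suc r) (\<lambda>(a, b). Var (pick A a, pick B b)))"
        using minorsE[OF g] by blast
      have "eval_at (low_rank_point r y z) g = 0"
        unfolding g_eq by (rule minor_low_rank_eq_0) simp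
      then show "g \<in> ?J" using g indets_minors by auto
    qed
    then have "determinantal_ideal n (Suc r) \<subseteq> ?J"
      unfolding determinantal_ideal_eq matrix_poly_ring_def
      by (intro genideal_least ideal_preimage comm_ring_hom_eval_point
          type_prime.axioms(1) type_prime_zero)
    then show ?thesis using f by auto
  qed
  then show "indets f \<subseteq> {..<n} \<times> {..<n} \<and> (\<forall>y z. eval_at (low_rank_point r y z) f = 0)"
    using poly_ideal_closed(4)[OF ideal_determinantal_ideal[unfolded matrix_poly_ring_def] f] by blast
next
  assume f: "indets f \<subseteq> {..<n} \<times> {..<n} \<and> (\<forall>y z. eval_at (low_rank_point r y z) f = 0)"
  then have "indets f \<subseteq> {..<n} \<times> {..<n}" and "eval_at (low_rank_point r y z) f = 0" for y z
    by blast+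
  moreover have "weight m < Suc (Max (weight ` keys f))" if "m \<in> keys f" for m
    unfolding less_Suc_eq_le by (rule Max_ge) (use that in simp_all)
  ultimately show "f \<in> determinantal_ideal n (Suc r)"
    by (rule mem_determinantal_ideal_if_vanishing)
qed

section \<open>Prime ideals of points\<close>

definition vanishing_ideal :: "'x set \<Rightarrow> ('x \<Rightarrow> 'k::comm_ring_1) set \<Rightarrow> ('x, 'k) mpoly set" where
  "vanishing_ideal V S = {f. indets f \<subseteq> V \<and> (\<forall>v\<in>S. eval_at v f = 0)}"

lemma ideal_vanishing_ideal: "ideal (vanishing_ideal V S) (poly_ring V :: ('x, 'k::comm_ring_1) mpoly ring)"
proof (rule poly_idealI)
  fix a r :: "('x, 'k) mpoly" assume "a \<in> vanishing_ideal V S" "indets r \<subseteq> V"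
  then show "r * a \<in> vanishing_ideal V S"
    using indets_mult[of r a]
    by (auto simp: vanishing_ideal_def comm_ring_hom.mpoly_eval_mult[OF comm_ring_hom_id])
next
  fix a b :: "('x, 'k) mpoly" assume "a \<in> vanishing_ideal V S" "b \<in> vanishing_ideal V S"
  then show "a + b \<in> vanishing_ideal V S"
    using indets_add[of a b]
    by (auto simp: vanishing_ideal_def comm_ring_hom.mpoly_eval_add[OF comm_ring_hom_id])
qed (auto simp: vanishing_ideal_def comm_ring_hom.mpoly_eval_0[OF comm_ring_hom_id])

lemma poly_primeidealI:
  fixes J :: "('x, 'k::comm_ring_1) mpoly set"
  assumes "ideal J (poly_ring V)" "1 \<notin> J"
    and "\<And>a b. indets a \<subseteq> V \<Longrightarrow> indets b \<subseteq> V \<Longrightarrow> a * b \<in> J \<Longrightarrow> a \<in> J \<or> b \<in> J"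
  shows "primeideal J (poly_ring V)"
proof (rule primeidealI[OF assms(1) cring_poly_ring])
  have "(1 :: ('x, 'k) mpoly) \<in> carrier (poly_ring V)" by (simp add: poly_ring_simps)
  then show "carrier (poly_ring V) \<noteq> J" using assms(2) by blast
next
  fix a b :: "('x, 'k) mpoly"
  assume "a \<in> carrier (poly_ring V)" "b \<in> carrier (poly_ring V)" "a \<otimes>\<^bsub>poly_ring V\<^esub> b \<in> J"
  then show "a \<in> J \<or> b \<in> J" using assms(3) by (simp add: poly_ring_simps)
qed

text \<open>
  If any two points of a set are joined by a polynomial curve that stays in the set for generic
  parameters, then two polynomials that do not vanish on the set are nonzero together at a generic
  point of such a curve.
\<close>

lemma primeideal_vanishing_ideal:
  fixes S :: "('x \<Rightarrow> 'k::alg_closed_field) set"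
  assumes "S \<noteq> {}"
    and curve: "\<And>v w. v \<in> S \<Longrightarrow> w \<in> S \<Longrightarrow> \<exists>\<gamma> g. \<gamma> 0 = v \<and> \<gamma> 1 = w \<and>
      (\<forall>x. poly_fun (\<lambda>s. s) (\<lambda>s. \<gamma> s x)) \<and> poly_fun (\<lambda>s. s) g \<and> g 0 \<noteq> 0 \<and> (\<forall>s. g s \<noteq> 0 \<longrightarrow> \<gamma> s \<in> S)"
  shows "primeideal (vanishing_ideal V S) (poly_ring V)"
proof (rule poly_primeidealI[OF ideal_vanishing_ideal])
  obtain v where v: "v \<in> S" using assms(1) by blast
  interpret e: comm_ring_hom "eval_at v" by (rule comm_ring_hom_eval_point)
  have "eval_at v 1 = 1" by (rule e.hom_one)
  then have "eval_at v 1 \<noteq> (0 :: 'k)" by (simp only: one_neq_zero not_False_eq_True)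
  then show "1 \<notin> vanishing_ideal V S" using v unfolding vanishing_ideal_def by blast
next
  fix f g :: "('x, 'k) mpoly"
  assume ind: "indets f \<subseteq> V" "indets g \<subseteq> V" and fg: "f * g \<in> vanishing_ideal V S"
  show "f \<in> vanishing_ideal V S \<or> g \<in> vanishing_ideal V S"
  proof (rule ccontr)
    assume neg: "\<not> ?thesis"
    obtain v where v: "v \<in> S" "eval_at v f \<noteq> 0" using neg ind unfolding vanishing_ideal_def by blast
    obtain w where w: "w \<in> S" "eval_at w g \<noteq> 0" using neg ind unfolding vanishing_ideal_def by blast
    obtain \<gamma> b where \<gamma>: "\<gamma> 0 = v" "\<gamma> 1 = w" and poly: "\<forall>x. poly_fun (\<lambda>s. s) (\<lambda>s. \<gamma> s x)"
      "poly_fun (\<lambda>s. s) b" and b: "b 0 \<noteq> 0" "\<forall>s. b s \<noteq> 0 \<longrightarrow> \<gamma> s \<in> S"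
      using curve[OF v(1) w(1)] by blast
    define G where "G i = (if i = (0::nat) then b else if i = 1 then (\<lambda>s. eval_at (\<gamma> s) f)
      else (\<lambda>s. eval_at (\<gamma> s) g))" for i
    have "\<exists>s. \<forall>i\<in>{..<3}. G i s \<noteq> 0"
    proof (rule generic_parameter)
      show "poly_fun (\<lambda>s. s) (G i)" for i
        using poly unfolding G_def by (simp add: poly_fun_mpoly_eval)
      show "G i (if i = 2 then 1 else 0) \<noteq> 0" if "i \<in> {..<3}" for i
        using that v(2) w(2) \<gamma> b(1) by (auto simp: G_def)
    qed simp
    then obtain s where s: "\<forall>i\<in>{..<3}. G i s \<noteq> 0" ..
    have "\<gamma> s \<in> S" using s[THEN bspec, of 0] b(2) by (simp add: G_def)
    moreover have "eval_at (\<gamma> s) (f * g) \<noteq> 0"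
      using s[THEN bspec, of 1] s[THEN bspec, of 2]
      by (simp add: G_def comm_ring_hom.mpoly_eval_mult[OF comm_ring_hom_id])
    ultimately show False using fg by (simp add: vanishing_ideal_def)
  qed
qed

text \<open>
  The ideal of minors is prime because the matrices of bounded rank are the image of an affine
  space under \<open>(y, z) \<mapsto> \<Sum>k y k * z k\<close>, so that lines of that space join any two of them.
\<close>

theorem primeideal_determinantal_ideal:
  "primeideal (determinantal_ideal n (Suc r) :: 'k::alg_closed_field matrix_poly set) (matrix_poly_ring n)"
proof -
  let ?S = "{low_rank_point r y z | y z. True} :: (nat \<times> nat \<Rightarrow> 'k) set"
  have "f \<in> determinantal_ideal n (Suc r) \<longleftrightarrow> f \<in> vanishing_ideal ({..<n} \<times> {..<n}) ?S" for f
    using mem_determinantal_ideal_iff[of f n r] unfolding vanishing_ideal_def by blast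
  then have "determinantal_ideal n (Suc r) = vanishing_ideal ({..<n} \<times> {..<n}) ?S" by blast
  moreover have "primeideal (vanishing_ideal ({..<n} \<times> {..<n}) ?S) (poly_ring ({..<n} \<times> {..<n}))"
  proof (rule primeideal_vanishing_ideal)
    fix v w assume "v \<in> ?S" "w \<in> ?S"
    then obtain y z y' z' where vw: "v = low_rank_point r y z" "w = low_rank_point r y' z'" by blast
    define \<gamma> where "\<gamma> s = low_rank_point r (\<lambda>k i. (1 - s) * y k i + s * y' k i) (\<lambda>k i. (1 - s) * z k i + s * z' k i)"
      for s :: 'k
    have "\<gamma> 0 = v" "\<gamma> 1 = w" by (simp_all add: \<gamma>_def vw)
    moreover have "poly_fun (\<lambda>s. s) (\<lambda>s. \<gamma> s x)" for x
      unfolding \<gamma>_def low_rank_point_def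
      by (cases x) (auto intro!: poly_fun_sum poly_fun_mult poly_fun_add poly_fun_diff)
    moreover have "\<gamma> s \<in> ?S" for s unfolding \<gamma>_def by blast
    ultimately show "\<exists>\<gamma> g. \<gamma> 0 = v \<and> \<gamma> 1 = w \<and> (\<forall>x. poly_fun (\<lambda>s. s) (\<lambda>s. \<gamma> s x)) \<and>
        poly_fun (\<lambda>s. s) g \<and> g 0 \<noteq> 0 \<and> (\<forall>s. g s \<noteq> 0 \<longrightarrow> \<gamma> s \<in> ?S)"
      by (intro exI[of _ \<gamma>] exI[of _ "\<lambda>_. 1"]) simp
  qed blast
  ultimately show ?thesis by (simp add: matrix_poly_ring_def)
qed

section \<open>Adjugate matrices\<close>

lemma adj_mat_dims [simp]: "dim_row (adj_mat A) = dim_row A" "dim_col (adj_mat A) = dim_col A"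
  by (simp_all add: adj_mat_def)

lemma adj_mat_index: "A \<in> carrier_mat n n \<Longrightarrow> i < n \<Longrightarrow> j < n \<Longrightarrow> adj_mat A $$ (i, j) = cofactor A j i"
  by (auto simp: adj_mat_def)

lemma mult_adj_mat:
  assumes "A \<in> carrier_mat n n" "i < n" "j < n"
  shows "(\<Sum>k<n. A $$ (i, k) * adj_mat A $$ (k, j)) = (if i = j then det A else 0)"
proof -
  have "(A * adj_mat A) $$ (i, j) = (\<Sum>k<n. A $$ (i, k) * adj_mat A $$ (k, j))"
    using assms adj_mat(1)[OF assms(1)] by (simp add: scalar_prod_def lessThan_atLeast0)
  then show ?thesis using assms(2,3) unfolding adj_mat(2)[OF assms(1)] by (auto split: if_splits)
qed

lemma adj_mat_mult:
  assumes "A \<in> carrier_mat n n" "i < n" "j < n"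
  shows "(\<Sum>k<n. adj_mat A $$ (i, k) * A $$ (k, j)) = (if i = j then det A else 0)"
proof -
  have "(adj_mat A * A) $$ (i, j) = (\<Sum>k<n. adj_mat A $$ (i, k) * A $$ (k, j))"
    using assms adj_mat(1)[OF assms(1)] by (simp add: scalar_prod_def lessThan_atLeast0)
  then show ?thesis using assms(2,3) unfolding adj_mat(3)[OF assms(1)] by (auto split: if_splits)
qed

lemma det_replace_col:
  assumes "A \<in> carrier_mat n n" "i < n"
  shows "det (replace_col A b i) = (\<Sum>k<n. adj_mat A $$ (i, k) * b $ k)"
proof -
  have c: "replace_col A b i \<in> carrier_mat n n" using assms(1) by (auto simp: replace_col_def)
  have "det (replace_col A b i) = (\<Sum>k<n. replace_col A b i $$ (k, i) * cofactor (replace_col A b i) k i)"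
    by (rule laplace_expansion_column[OF c assms(2)])
  also have "\<dots> = (\<Sum>k<n. adj_mat A $$ (i, k) * b $ k)"
  proof (rule sum.cong[OF refl])
    fix k assume "k \<in> {..<n}"
    then have k: "k < n" by simp
    have "mat_delete (replace_col A b i) k i = mat_delete A k i"
      using assms k by (intro eq_matI) (auto simp: mat_delete_def replace_col_def)
    then show "replace_col A b i $$ (k, i) * cofactor (replace_col A b i) k i = adj_mat A $$ (i, k) * b $ k"
      using assms k by (simp add: adj_mat_index cofactor_def) (simp add: replace_col_def)
  qed
  finally show ?thesis .
qed

lemma adj_mat_eq_det: 
  assumes "A \<in> carrier_mat n n" "i < n" "j < n"
  shows "adj_mat A $$ (i, j) = det (replace_col A (unit_vec n j) i)"
proof -
  have "det (replace_col A (unit_vec n j) i) = (\<Sum>k<n. if k = j then adj_mat A $$ (i, j) else 0)"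
    unfolding det_replace_col[OF assms(1,2)] using assms(3) by (intro sum.cong) auto
  then show ?thesis using assms(3) by simp
qed

text \<open>
  The entries of the adjugate are determinants of matrices with a replaced column, and replacing a
  column commutes with multiplication by \<open>E\<close>. This avoids cancelling determinants in rings with
  zero divisors.
\<close>

lemma adj_mat_mult_left:
  assumes E: "E \<in> carrier_mat n n" "F \<in> carrier_mat n n" "E * F = 1\<^sub>m n" and A: "A \<in> carrier_mat n n"
    and ij: "i < n" "j < n"
  shows "adj_mat (E * A) $$ (i, j) = det E * (\<Sum>k<n. adj_mat A $$ (i, k) * F $$ (k, j))"
proof -
  have EA: "E * A \<in> carrier_mat n n" using E A by simp
  let ?R = "replace_col A (col F j) i"
  have R: "?R \<in> carrier_mat n n" using A by (auto simp: replace_col_def)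
  have "E * ?R = replace_col (E * A) (unit_vec n j) i"
  proof (rule eq_matI)
    fix a b assume "a < dim_row (replace_col (E * A) (unit_vec n j) i)"
      "b < dim_col (replace_col (E * A) (unit_vec n j) i)"
    then have ab: "a < n" "b < n" using E A by (auto simp: replace_col_def)
    show "(E * ?R) $$ (a, b) = replace_col (E * A) (unit_vec n j) i $$ (a, b)"
    proof (cases "b = i")
      case True
      have "col ?R i = col F j" using A E ij by (intro eq_vecI) (auto simp: replace_col_def)
      then have "(E * ?R) $$ (a, b) = row E a \<bullet> col F j"
        using E(1,2) R ab True ij by (simp del: col_def)
      also have "\<dots> = (E * F) $$ (a, j)" using E(1,2) ab ij by simp
      also have "\<dots> = unit_vec n j $ a" unfolding E(3) using ab ij by simp
      finally show ?thesis using E A ab True ij by (simp add: replace_col_def)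
    next
      case False
      have "col ?R b = col A b" using A E ab False by (intro eq_vecI) (auto simp: replace_col_def)
      then show ?thesis using E A R ab False by (simp add: replace_col_def)
    qed
  qed (use E A in \<open>auto simp: replace_col_def\<close>)
  then have "adj_mat (E * A) $$ (i, j) = det E * det ?R"
    using det_mult[OF E(1) R] adj_mat_eq_det[OF EA ij] by simp
  also have "det ?R = (\<Sum>k<n. adj_mat A $$ (i, k) * F $$ (k, j))"
    unfolding det_replace_col[OF A ij(1)] using E ij by (intro sum.cong) auto
  finally show ?thesis .
qed

lemma adj_mat_transpose:
  assumes "A \<in> carrier_mat n n" "i < n" "j < n"
  shows "adj_mat (transpose_mat A) $$ (i, j) = adj_mat A $$ (j, i)"
proof -
  have "mat_delete (transpose_mat A) j i = transpose_mat (mat_delete A i j)"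
    using assms by (intro eq_matI) (auto simp: mat_delete_def)
  moreover have "mat_delete A i j \<in> carrier_mat (n - 1) (n - 1)"
    by (rule mat_delete_carrier[OF assms(1)])
  ultimately show ?thesis
    using assms by (simp add: adj_mat_index[of _ n] cofactor_def det_transpose add.commute)
qed

lemma adj_mat_mult_right:
  assumes E: "E \<in> carrier_mat n n" "F \<in> carrier_mat n n" "F * E = 1\<^sub>m n" and A: "A \<in> carrier_mat n n"
    and ij: "i < n" "j < n"
  shows "adj_mat (A * E) $$ (i, j) = det E * (\<Sum>k<n. F $$ (i, k) * adj_mat A $$ (k, j))"
proof -
  have t: "transpose_mat E \<in> carrier_mat n n" "transpose_mat F \<in> carrier_mat n n"
    "transpose_mat A \<in> carrier_mat n n" using E A by auto
  have "transpose_mat E * transpose_mat F = 1\<^sub>m n"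
    using transpose_mult[OF E(2,1)] E(3) by simp
  note * = adj_mat_mult_left[OF t(1,2) this t(3) ij(2,1)]
  have "transpose_mat E * transpose_mat A = transpose_mat (A * E)"
    using transpose_mult[OF A E(1)] by simp
  then have "adj_mat (A * E) $$ (i, j) =
      det (transpose_mat E) * (\<Sum>k<n. adj_mat (transpose_mat A) $$ (j, k) * transpose_mat F $$ (k, i))"
    using * adj_mat_transpose[of "A * E" n j i] E A ij by simp
  also have "det (transpose_mat E) = det E" by (rule det_transpose[OF E(1)])
  also have "(\<Sum>k<n. adj_mat (transpose_mat A) $$ (j, k) * transpose_mat F $$ (k, i)) =
      (\<Sum>k<n. F $$ (i, k) * adj_mat A $$ (k, j))"
    using E A ij by (intro sum.cong) (auto simp: adj_mat_transpose[OF A] mult.commute)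
  finally show ?thesis .
qed

text \<open>
  Jacobi's identity for the two-rowed minors of the adjugate, multiplied by one of its entries. With
  this factor Cramer's rule proves it in every commutative ring, and all uses are modulo a prime
  that does not contain the entry.
\<close>

lemma adj_mat_two_minor:
  assumes A: "A \<in> carrier_mat n n" and idx: "a < n" "b < n" "j < n" "l < n" "j \<noteq> a"
  defines "y \<equiv> \<lambda>i j. adj_mat A $$ (i, j)"
  shows "y a b * (y a b * y j l - y a l * y j b) =
    y a b * (det A * adj_mat (replace_col A (unit_vec n b) a) $$ (j, l))"
proof -
  let ?R = "replace_col A (unit_vec n b) a"
  have R: "?R \<in> carrier_mat n n" using A by (auto simp: replace_col_def)
  have det_R: "det ?R = y a b" unfolding y_def using adj_mat_eq_det[OF A idx(1,2)] by simp
  define v where "v c = y a b * y c l - y a l * y c b + (if c = a then det A * y a l else 0)" for c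
  have sum_R: "(\<Sum>c<n. ?R $$ (i, c) * v c) = (if i = l then y a b * det A else 0)" if i: "i < n" for i
  proof -
    have "?R $$ (i, c) * v c = A $$ (i, c) * v c +
        (if c = a then ((if i = b then 1 else 0) - A $$ (i, a)) * v a else 0)" if "c < n" for c
      using that i A idx by (auto simp: replace_col_def algebra_simps)
    then have "(\<Sum>c<n. ?R $$ (i, c) * v c) = (\<Sum>c<n. A $$ (i, c) * v c +
        (if c = a then ((if i = b then 1 else 0) - A $$ (i, a)) * v a else 0))"
      by (intro sum.cong) auto
    also have "\<dots> = (\<Sum>c<n. A $$ (i, c) * v c) + ((if i = b then 1 else 0) - A $$ (i, a)) * v a"
      using idx(1) by (simp add: sum.distrib)
    also have "(\<Sum>c<n. A $$ (i, c) * v c) = (\<Sum>c<n. y a b * (A $$ (i, c) * y c l)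
        - y a l * (A $$ (i, c) * y c b) + (if c = a then A $$ (i, a) * (det A * y a l) else 0))"
      unfolding v_def by (intro sum.cong) (auto simp: algebra_simps)
    also have "\<dots> = y a b * (if i = l then det A else 0) - y a l * (if i = b then det A else 0)
        + A $$ (i, a) * (det A * y a l)"
      using idx mult_adj_mat[OF A i, of l] mult_adj_mat[OF A i, of b]
      by (simp add: sum.distrib sum_subtractf y_def flip: sum_distrib_left)
    finally have "(\<Sum>c<n. ?R $$ (i, c) * v c) = y a b * (if i = l then det A else 0)
        - y a l * (if i = b then det A else 0) + A $$ (i, a) * (det A * y a l)
        + ((if i = b then 1 else 0) - A $$ (i, a)) * v a" .
    moreover have "v a = det A * y a l" by (simp add: v_def)
    ultimately show ?thesis
      by (cases "i = b"; cases "i = l") (simp_all only:, simp_all add: algebra_simps)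
  qed
  have "det ?R * v j = (\<Sum>c<n. (if j = c then det ?R else 0) * v c)"
    using idx(3) by (simp add: if_distrib[of "\<lambda>x. x * _"] cong: if_cong)
  also have "\<dots> = (\<Sum>c<n. (\<Sum>i<n. adj_mat ?R $$ (j, i) * ?R $$ (i, c)) * v c)"
    using adj_mat_mult[OF R idx(3)] by (intro sum.cong) simp_all
  also have "\<dots> = (\<Sum>i<n. adj_mat ?R $$ (j, i) * (\<Sum>c<n. ?R $$ (i, c) * v c))"
    unfolding sum_distrib_left sum_distrib_right mult.assoc by (rule sum.swap)
  also have "\<dots> = (\<Sum>i<n. if i = l then adj_mat ?R $$ (j, l) * (y a b * det A) else 0)"
    using sum_R by (intro sum.cong) auto
  also have "\<dots> = adj_mat ?R $$ (j, l) * (y a b * det A)"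
    using idx(4) by simp
  finally show ?thesis
    using idx(5) by (simp add: det_R v_def mult.commute mult.left_commute)
qed

lemma (in comm_ring_hom) hom_adj_mat:
  assumes "A \<in> carrier_mat n n" "i < n" "j < n"
  shows "hom (adj_mat A $$ (i, j)) = adj_mat (map_mat hom A) $$ (i, j)"
proof -
  have "map_mat hom (mat_delete A j i) = mat_delete (map_mat hom A) j i"
    using assms by (intro eq_matI) (auto simp: mat_delete_def)
  then show ?thesis
    using assms
    by (simp add: adj_mat_index[OF assms] adj_mat_index[of "map_mat hom A" n] cofactor_def hom_distribs
        flip: hom_det)
qed

section \<open>Principal minors as entries of the adjugate\<close>

lemma pick_remove:
  assumes "i < n" "a < n - 1"
  shows "pick ({..<n} - {i}) a = (if a < i then a else Suc a)"
proof -
  let ?\<rho> = "\<lambda>a. if a < i then a else Suc a"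
  have "?\<rho> ` {..<n - 1} = {..<n} - {i}"
  proof (intro equalityI subsetI)
    fix b assume b: "b \<in> {..<n} - {i}"
    show "b \<in> ?\<rho> ` {..<n - 1}"
    proof (cases "b < i")
      case True
      then show ?thesis using assms by (intro image_eqI[of _ _ b]) auto
    next
      case False
      then show ?thesis using b by (intro image_eqI[of _ _ "b - 1"]) auto
    qed
  qed (use assms in \<open>auto split: if_splits\<close>)
  moreover have "strict_mono_on {..<n - 1} ?\<rho>" by (auto simp: strict_mono_on_def)
  ultimately show ?thesis using pick_image[of "n - 1" ?\<rho> a] assms(2) by simp
qed

lemma submatrix_remove:
  assumes "i < n" "j < n"
  shows "submatrix (generic_matrix n) ({..<n} - {i}) ({..<n} - {j}) = mat_delete (generic_matrix n) i j"
proof -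
  have "card ({..<n} - {i}) = n - 1" "card ({..<n} - {j}) = n - 1" using assms by simp_all
  then have eq: "submatrix (generic_matrix n) ({..<n} - {i}) ({..<n} - {j}) =
      mat (n - 1) (n - 1) (\<lambda>(a, b). Var (pick ({..<n} - {i}) a, pick ({..<n} - {j}) b))"
    by (intro submatrix_generic_matrix) auto
  show ?thesis
    unfolding eq using assms by (intro eq_matI) (auto simp: mat_delete_def generic_matrix_def pick_remove)
qed

lemma subset_card_minus_1:
  assumes "A \<subseteq> {..<n}" "card A = n - 1" "0 < n"
  shows "\<exists>i<n. A = {..<n} - {i}"
proof -
  have "card ({..<n} - A) = 1"
    using assms card_Diff_subset[of A "{..<n}"] finite_subset[OF assms(1)] by simp
  then obtain i where i: "{..<n} - A = {i}" by (rule card_1_singletonE)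
  have "A = {..<n} - ({..<n} - A)" using assms(1) by (simp add: double_diff)
  then have "A = {..<n} - {i}" unfolding i .
  moreover have "i < n" using i by blast
  ultimately show ?thesis by blast
qed

lemma generic_matrix_carrier [simp]: "generic_matrix n \<in> carrier_mat n n"
  by (simp add: generic_matrix_def)

lemma principal_minor_ideal_eq:
  assumes "0 < n"
  shows "(principal_minor_ideal n (n - 1) :: 'k::comm_ring_1 matrix_poly set) =
    Idl\<^bsub>poly_ring ({..<n} \<times> {..<n})\<^esub> {adj_mat (generic_matrix n) $$ (i, i) | i. i < n}"
proof -
  have *: "det (submatrix (generic_matrix n) ({..<n} - {i}) ({..<n} - {i})) =
      (adj_mat (generic_matrix n) $$ (i, i) :: 'k matrix_poly)"
    if "i < n" for i
    using that by (simp add: submatrix_remove adj_mat_index[of _ n] cofactor_def)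
  have "{det (submatrix (generic_matrix n) A A) | A. A \<subseteq> {..<n} \<and> card A = n - 1} =
      {adj_mat (generic_matrix n) $$ (i, i) :: 'k matrix_poly | i. i < n}" (is "?L = ?R")
  proof
    show "?L \<subseteq> ?R"
    proof
      fix x assume "x \<in> ?L"
      then obtain A where A: "A \<subseteq> {..<n}" "card A = n - 1" "x = det (submatrix (generic_matrix n) A A)" by blast
      obtain i where "i < n" "A = {..<n} - {i}" using subset_card_minus_1[OF A(1,2) assms] by blast
      then show "x \<in> ?R" unfolding A(3) using *[of i] by (intro CollectI exI[of _ i]) simp
    qed
    show "?R \<subseteq> ?L"
    proof
      fix x assume "x \<in> ?R"
      then obtain i where i: "i < n" "x = adj_mat (generic_matrix n) $$ (i, i)" by blast
      then have "card ({..<n} - {i}) = n - 1" by simp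
      moreover have "x = det (submatrix (generic_matrix n) ({..<n} - {i}) ({..<n} - {i}))"
        unfolding i(2) by (rule *[OF i(1), symmetric])
      ultimately show "x \<in> ?L" by blast
    qed
  qed
  then show ?thesis unfolding principal_minor_ideal_def matrix_poly_ring_def by simp
qed

lemma adj_mat_mem_determinantal_ideal:
  assumes "i < n" "j < n"
  shows "adj_mat (generic_matrix n) $$ (i, j) \<in> (determinantal_ideal n (n - 1) :: 'k::comm_ring_1 matrix_poly set)"
proof -
  note J = ideal_determinantal_ideal[where 'a = 'k, of n "n - 1", unfolded matrix_poly_ring_def]
  have "card ({..<n} - {i}) = n - 1" "card ({..<n} - {j}) = n - 1" using assms by simp_all
  then have "det (submatrix (generic_matrix n) ({..<n} - {j}) ({..<n} - {i})) \<in> (minors n (n - 1) :: 'k matrix_poly set)"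
    unfolding minors_def by blast
  then have "det (mat_delete (generic_matrix n) j i) \<in> (determinantal_ideal n (n - 1) :: 'k matrix_poly set)"
    unfolding determinantal_ideal_eq submatrix_remove[OF assms(2,1)] by (rule genideal_mem)
  from poly_ideal_closed(3)[OF J this, of "(-1) ^ (j + i)"] show ?thesis
    using indets_power[of "-1 :: 'k matrix_poly" "j + i"] assms
    by (simp add: adj_mat_index[of _ n] cofactor_def indets_uminus)
qed

lemma determinantal_ideal_subset:
  fixes J :: "'k::comm_ring_1 matrix_poly set"
  assumes J: "ideal J (matrix_poly_ring n)" and "0 < n"
    and adj: "\<And>i j. i < n \<Longrightarrow> j < n \<Longrightarrow> adj_mat (generic_matrix n) $$ (i, j) \<in> J"
  shows "determinantal_ideal n (n - 1) \<subseteq> J"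
  unfolding determinantal_ideal_eq
proof (rule genideal_least[OF J], rule subsetI)
  fix f :: "'k matrix_poly" assume "f \<in> minors n (n - 1)"
  then obtain A B where AB: "A \<subseteq> {..<n}" "B \<subseteq> {..<n}" "card A = n - 1" "card B = n - 1"
    "f = det (submatrix (generic_matrix n) A B)" unfolding minors_def by blast
  obtain i j where ij: "i < n" "A = {..<n} - {i}" "j < n" "B = {..<n} - {j}"
    using subset_card_minus_1[OF AB(1,3) assms(2)] subset_card_minus_1[OF AB(2,4) assms(2)] by blast
  have f: "f = det (mat_delete (generic_matrix n) i j)"
    unfolding AB(5) ij(2,4) submatrix_remove[OF ij(1,3)] ..
  have "(-1) ^ (i + j) * adj_mat (generic_matrix n) $$ (j, i) = f"
    using ij f by (simp add: adj_mat_index[of _ n] cofactor_def flip: mult.assoc power_add)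
  moreover have "(-1) ^ (i + j) * adj_mat (generic_matrix n) $$ (j, i) \<in> J"
    by (rule poly_ideal_closed(3)[OF J[unfolded matrix_poly_ring_def] adj[OF ij(3,1)]])
      (rule order.trans[OF indets_power], simp add: indets_uminus)
  ultimately show "f \<in> J" by simp
qed

section \<open>Invertible matrices whose inverse has zero diagonal entries\<close>

text \<open>
  Indexing a matrix outside its dimensions gives unspecified values. Zeros instead of them make the
  coordinates of a polynomial family of matrices polynomial at all positions.
\<close>

definition entries :: "nat \<Rightarrow> 'a::zero mat \<Rightarrow> nat \<times> nat \<Rightarrow> 'a" where
  "entries n x = (\<lambda>(i, j). if i < n \<and> j < n then x $$ (i, j) else 0)"

lemma eval_generic_matrix:
  assumes "comm_ring_hom h" "x \<in> carrier_mat n n"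
  shows "map_mat (mpoly_eval h (entries n x)) (generic_matrix n) = x"
  using assms(2)
  by (intro eq_matI)
    (auto simp: generic_matrix_def entries_def comm_ring_hom.mpoly_eval_Var[OF assms(1)])

lemma eval_det_generic_matrix:
  assumes "comm_ring_hom h" "x \<in> carrier_mat n n"
  shows "mpoly_eval h (entries n x) (det (generic_matrix n)) = det x"
proof -
  interpret e: comm_ring_hom "mpoly_eval h (entries n x)"
    by (rule comm_ring_hom.comm_ring_hom_mpoly_eval[OF assms(1)])
  have "mpoly_eval h (entries n x) (det (generic_matrix n)) =
      det (map_mat (mpoly_eval h (entries n x)) (generic_matrix n))" by (rule e.hom_det[symmetric])
  then show ?thesis unfolding eval_generic_matrix[OF assms] .
qed

lemma eval_adj_generic_matrix:
  assumes "comm_ring_hom h" "x \<in> carrier_mat n n" "i < n" "j < n"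
  shows "mpoly_eval h (entries n x) (adj_mat (generic_matrix n) $$ (i, j)) = adj_mat x $$ (i, j)"
proof -
  interpret e: comm_ring_hom "mpoly_eval h (entries n x)"
    by (rule comm_ring_hom.comm_ring_hom_mpoly_eval[OF assms(1)])
  have "mpoly_eval h (entries n x) (adj_mat (generic_matrix n) $$ (i, j)) =
      adj_mat (map_mat (mpoly_eval h (entries n x)) (generic_matrix n)) $$ (i, j)"
    by (rule e.hom_adj_mat[OF generic_matrix_carrier assms(3,4)])
  then show ?thesis unfolding eval_generic_matrix[OF assms(1,2)] .
qed

lemma indets_det_generic_matrix: "indets (det (generic_matrix n :: 'k::comm_ring_1 matrix_poly mat)) \<subseteq> {..<n} \<times> {..<n}"
  by (rule indets_det[OF generic_matrix_carrier]) (simp add: generic_matrix_def)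

lemma indets_adj_generic_matrix:
  assumes "i < n" "j < n"
  shows "indets (adj_mat (generic_matrix n :: 'k::comm_ring_1 matrix_poly mat) $$ (i, j)) \<subseteq> {..<n} \<times> {..<n}"
  using poly_ideal_closed(4)[OF ideal_determinantal_ideal[unfolded matrix_poly_ring_def]
      adj_mat_mem_determinantal_ideal[OF assms]] .

definition zero_diag_inverse :: "nat \<Rightarrow> nat set \<Rightarrow> 'k::field mat set" where
  "zero_diag_inverse n D =
     {x \<in> carrier_mat n n. det x \<noteq> 0 \<and> (\<forall>i\<in>D. adj_mat x $$ (i, i) = 0)}"

text \<open>The defining ideal of the Zariski closure of \<open>zero_diag_inverse n D\<close>.\<close>

definition zero_diag_inverse_ideal :: "nat \<Rightarrow> nat set \<Rightarrow> 'k::field matrix_poly set" where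
  "zero_diag_inverse_ideal n D =
     vanishing_ideal ({..<n} \<times> {..<n}) (entries n ` zero_diag_inverse n D)"

lemma mem_zero_diag_inverse_ideal:
  "f \<in> zero_diag_inverse_ideal n D \<longleftrightarrow> indets f \<subseteq> {..<n} \<times> {..<n} \<and>
     (\<forall>x\<in>zero_diag_inverse n D. eval_at (entries n x) f = 0)"
  by (simp add: zero_diag_inverse_ideal_def vanishing_ideal_def)

text \<open>
  Up to nonzero factors, \<open>A\<close> and its adjugate are inverse to each other, so the adjugate of the
  adjugate is a multiple of \<open>A\<close> and inherits the zeros of its diagonal.
\<close>

lemma smult_adj_mat_mem:
  fixes A :: "'k::field mat"
  assumes A: "A \<in> carrier_mat n n" "det A \<noteq> 0" "\<And>i. i \<in> D \<Longrightarrow> A $$ (i, i) = 0"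
    and D: "D \<subseteq> {..<n}" and "\<kappa> \<noteq> 0"
  shows "\<kappa> \<cdot>\<^sub>m adj_mat A \<in> zero_diag_inverse n D"
    and "i < n \<Longrightarrow> j < n \<Longrightarrow>
      adj_mat (\<kappa> \<cdot>\<^sub>m adj_mat A) $$ (i, j) * (\<kappa> * det A) = det (\<kappa> \<cdot>\<^sub>m adj_mat A) * A $$ (i, j)"
proof -
  let ?y = "\<kappa> \<cdot>\<^sub>m adj_mat A"
  have y: "?y \<in> carrier_mat n n" using adj_mat(1)[OF A(1)] by simp
  have yA: "?y * A = (\<kappa> * det A) \<cdot>\<^sub>m 1\<^sub>m n"
    using adj_mat(3)[OF A(1)] A(1) adj_mat(1)[OF A(1)]
    by (simp add: mult_smult_assoc_mat[of _ n n]) (intro eq_matI; simp)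
  have "det ?y * det A = (\<kappa> * det A) ^ n"
    using det_mult[OF y A(1)] by (simp add: yA)
  then have det_y: "det ?y \<noteq> 0" using A(2) \<open>\<kappa> \<noteq> 0\<close> by (auto simp: power_eq_0_iff)
  have ent: "adj_mat ?y $$ (i, j) * (\<kappa> * det A) = det ?y * A $$ (i, j)" if ij: "i < n" "j < n" for i j
  proof -
    have "adj_mat ?y * (?y * A) = det ?y \<cdot>\<^sub>m A"
      using adj_mat(1,3)[OF y] y A(1)
      by (simp add: assoc_mult_mat[symmetric, of _ n n _ n _ n] mult_smult_assoc_mat[of _ n n])
    then have "((\<kappa> * det A) \<cdot>\<^sub>m adj_mat ?y) = det ?y \<cdot>\<^sub>m A"
      unfolding yA using adj_mat(1)[OF y] right_mult_one_mat[OF adj_mat(1)[OF y]]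
      by (simp add: mult_smult_distrib[of _ n n _ n])
    then have "((\<kappa> * det A) \<cdot>\<^sub>m adj_mat ?y) $$ (i, j) = (det ?y \<cdot>\<^sub>m A) $$ (i, j)" by simp
    then show ?thesis using ij A(1) adj_mat(1)[OF y] by (simp add: mult.commute)
  qed
  then show "i < n \<Longrightarrow> j < n \<Longrightarrow> adj_mat ?y $$ (i, j) * (\<kappa> * det A) = det ?y * A $$ (i, j)" .
  have "adj_mat ?y $$ (i, i) = 0" if "i \<in> D" for i
    using ent[of i i] that D A(2,3) \<open>\<kappa> \<noteq> 0\<close> by auto
  then show "?y \<in> zero_diag_inverse n D" using y det_y by (simp add: zero_diag_inverse_def)
qed

lemma zero_diag_inverseE:
  fixes x :: "'k::field mat"
  assumes "x \<in> zero_diag_inverse n D"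
  shows "x \<in> carrier_mat n n" "det x \<noteq> 0" "adj_mat x \<in> carrier_mat n n" "det (adj_mat x) \<noteq> 0"
    "i \<in> D \<Longrightarrow> adj_mat x $$ (i, i) = 0" "x = (det x / det (adj_mat x)) \<cdot>\<^sub>m adj_mat (adj_mat x)"
proof -
  let ?A = "adj_mat x"
  show x: "x \<in> carrier_mat n n" and d: "det x \<noteq> 0" and "i \<in> D \<Longrightarrow> ?A $$ (i, i) = 0"
    using assms by (auto simp: zero_diag_inverse_def)
  show A: "?A \<in> carrier_mat n n" by (rule adj_mat(1)[OF x])
  have "det ?A * det x = det x ^ n"
    using det_mult[OF A x] adj_mat(3)[OF x] by simp
  then show dA: "det ?A \<noteq> 0" using d by auto
  have "adj_mat ?A * (?A * x) = det ?A \<cdot>\<^sub>m x"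
    using adj_mat(1,3)[OF A] A x
    by (simp add: assoc_mult_mat[symmetric, of _ n n _ n _ n] mult_smult_assoc_mat[of _ n n])
  then have "det x \<cdot>\<^sub>m adj_mat ?A = det ?A \<cdot>\<^sub>m x"
    unfolding adj_mat(3)[OF x] using adj_mat(1)[OF A] right_mult_one_mat[OF adj_mat(1)[OF A]]
    by (simp add: mult_smult_distrib[of _ n n _ n])
  then have "(det x \<cdot>\<^sub>m adj_mat ?A) $$ (i, j) = (det ?A \<cdot>\<^sub>m x) $$ (i, j)" for i j by simp
  then have "det x * adj_mat ?A $$ (i, j) = det ?A * x $$ (i, j)" if "i < n" "j < n" for i j
    using that x A adj_mat(1)[OF A] by (metis carrier_matD index_smult_mat(1))
  then show "x = (det x / det ?A) \<cdot>\<^sub>m adj_mat ?A"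
    using x A dA adj_mat(1)[OF A] by (intro eq_matI) (auto simp: field_simps)
qed

text \<open>A cyclic permutation matrix has zero diagonal.\<close>

lemma ex_invertible_zero_diag:
  assumes "2 \<le> n"
  shows "\<exists>A :: 'k::field mat. A \<in> carrier_mat n n \<and> det A \<noteq> 0 \<and> (\<forall>i<n. A $$ (i, i) = 0)"
proof -
  define A :: "'k mat" where "A = mat n n (\<lambda>(i, j). if j = Suc i mod n then 1 else 0)"
  have A: "A \<in> carrier_mat n n" by (simp add: A_def)
  have inj: "i = j" if "Suc i mod n = Suc j mod n" "i < n" "j < n" for i j
    using that by (auto simp: mod_Suc split: if_splits)
  have "A * transpose_mat A = 1\<^sub>m n"
  proof (rule eq_matI)
    fix i j assume "i < dim_row (1\<^sub>m n :: 'k mat)" "j < dim_col (1\<^sub>m n :: 'k mat)"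
    then have ij: "i < n" "j < n" by simp_all
    have "(A * transpose_mat A) $$ (i, j) = (\<Sum>c\<in>{0..<n}. A $$ (i, c) * A $$ (j, c))"
      using ij A by (simp add: scalar_prod_def)
    also have "\<dots> = (\<Sum>c\<in>{0..<n}. if c = Suc i mod n then (if c = Suc j mod n then 1 else 0) else 0)"
      using ij by (intro sum.cong) (simp_all add: A_def)
    also have "\<dots> = (if i = j then 1 else 0)"
      using inj[of i j] ij by auto
    finally show "(A * transpose_mat A) $$ (i, j) = 1\<^sub>m n $$ (i, j)" using ij by simp
  qed (simp_all add: A_def)
  then have "det A * det (transpose_mat A) = 1"
    using det_mult[of A n "transpose_mat A"] A by simp
  then have "det A \<noteq> 0" by auto
  moreover have "A $$ (i, i) = 0" if "i < n" for i
    using that assms by (auto simp: A_def mod_Suc)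
  ultimately show ?thesis using A by blast
qed

text \<open>A generic change of one entry keeps the cyclic matrix invertible.\<close>

lemma ex_invertible_one_entry:
  assumes "2 \<le> n" "a < n" "b < n"
  shows "\<exists>A :: 'k::alg_closed_field mat. A \<in> carrier_mat n n \<and> det A \<noteq> 0 \<and> A $$ (a, b) \<noteq> 0 \<and>
    (\<forall>i<n. (i, i) \<noteq> (a, b) \<longrightarrow> A $$ (i, i) = 0)"
proof -
  obtain A :: "'k mat" where A: "A \<in> carrier_mat n n" "det A \<noteq> 0" "\<forall>i<n. A $$ (i, i) = 0"
    using ex_invertible_zero_diag[OF assms(1)] by blast
  define M where "M s = mat n n (\<lambda>ij. A $$ ij + (if ij = (a, b) then s else 0))" for s
  have M: "M s \<in> carrier_mat n n" for s by (simp add: M_def)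
  have "M 0 = A" using A(1) by (intro eq_matI) (auto simp: M_def)
  have pf: "poly_fun (\<lambda>s. s) (\<lambda>s. M s $$ (i, j))" if "i < n" "j < n" for i j
  proof (cases "(i, j) = (a, b)")
    case True
    then have "M s $$ (i, j) = A $$ (i, j) + s" for s using that by (simp add: M_def)
    then show ?thesis by (simp add: poly_fun_add)
  next
    case False
    then have "M s $$ (i, j) = A $$ (i, j)" for s using that unfolding M_def by (simp only: index_mat if_False) simp
    then show ?thesis by simp
  qed
  define g where "g k = (if k = (0::nat) then (\<lambda>s. det (M s)) else (\<lambda>s. M s $$ (a, b)))" for k
  have "\<exists>s. \<forall>k\<in>{0, 1}. g k s \<noteq> 0"
  proof (rule generic_parameter)
    show "poly_fun (\<lambda>s. s) (g k)" for k
      unfolding g_def using pf assms by (auto intro!: poly_fun_det[of _ n] M)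
    show "g k (if k = 0 then 0 else 1 - A $$ (a, b)) \<noteq> 0" for k
      unfolding g_def using \<open>M 0 = A\<close> A(2) assms by (simp add: M_def)
  qed simp
  then obtain s where s: "det (M s) \<noteq> 0" "M s $$ (a, b) \<noteq> 0" by (auto simp: g_def)
  have "M s $$ (i, i) = 0" if "i < n" "(i, i) \<noteq> (a, b)" for i
    using that A(3) by (auto simp: M_def)
  then show ?thesis using s M by blast
qed

text \<open>
  Inverting makes the set linear: two of its points are joined by the image, under
  \<open>A \<mapsto> \<mu> * adj A\<close>, of the segment between their adjugates.
\<close>

theorem primeideal_zero_diag_inverse_ideal:
  assumes D: "D \<subseteq> {..<n}" and n: "2 \<le> n"
  shows "primeideal (zero_diag_inverse_ideal n D :: 'k::alg_closed_field matrix_poly set) (matrix_poly_ring n)"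
  unfolding zero_diag_inverse_ideal_def matrix_poly_ring_def
proof (rule primeideal_vanishing_ideal)
  obtain A :: "'k mat" where "A \<in> carrier_mat n n" "det A \<noteq> 0" "\<forall>i<n. A $$ (i, i) = 0"
    using ex_invertible_zero_diag[OF n] by blast
  then have "1 \<cdot>\<^sub>m adj_mat A \<in> zero_diag_inverse n D"
    using D by (intro smult_adj_mat_mem(1)) auto
  then show "entries n ` (zero_diag_inverse n D :: 'k mat set) \<noteq> {}" by blast
next
  fix v w :: "nat \<times> nat \<Rightarrow> 'k"
  assume "v \<in> entries n ` zero_diag_inverse n D" "w \<in> entries n ` zero_diag_inverse n D"
  then obtain x y where xy: "x \<in> zero_diag_inverse n D" "y \<in> zero_diag_inverse n D"
    and vw: "v = entries n x" "w = entries n y" by blast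
  note X = zero_diag_inverseE[OF xy(1)] and Y = zero_diag_inverseE[OF xy(2)]
  define A where "A s = (1 - s) \<cdot>\<^sub>m adj_mat x + s \<cdot>\<^sub>m adj_mat y" for s
  define \<mu> where "\<mu> s = (1 - s) * (det x / det (adj_mat x)) + s * (det y / det (adj_mat y))" for s
  have A: "A s \<in> carrier_mat n n" for s using X(3) Y(3) by (simp add: A_def)
  have A_index: "A s $$ (i, j) = (1 - s) * adj_mat x $$ (i, j) + s * adj_mat y $$ (i, j)"
    if "i < n" "j < n" for s i j using X(1) Y(1) that by (simp add: A_def)
  have "A 0 = adj_mat x" "A 1 = adj_mat y" using X(1) Y(1) A_index by (auto intro!: eq_matI simp: A_def)
  have A_poly: "poly_fun (\<lambda>s. s) (\<lambda>s. A s $$ (i, j))" if "i < n" "j < n" for i j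
    by (simp add: A_index[OF that] poly_fun_add poly_fun_mult poly_fun_diff)
  have \<mu>_poly: "poly_fun (\<lambda>s. s) \<mu>"
    unfolding \<mu>_def by (intro poly_fun_add poly_fun_mult poly_fun_diff poly_fun_const poly_fun_param)
  define \<gamma> where "\<gamma> s = entries n (\<mu> s \<cdot>\<^sub>m adj_mat (A s))" for s
  define g where "g s = \<mu> s * det (A s)" for s
  have "\<gamma> 0 = v" "\<gamma> 1 = w"
    using X(6) Y(6) \<open>A 0 = adj_mat x\<close> \<open>A 1 = adj_mat y\<close> by (simp_all add: \<gamma>_def \<mu>_def vw)
  moreover have "poly_fun (\<lambda>s. s) (\<lambda>s. \<gamma> s ij)" for ij
  proof (cases ij)
    case (Pair i j)
    have "\<gamma> s ij = (if i < n \<and> j < n then \<mu> s * adj_mat (A s) $$ (i, j) else 0)" for s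
      using A[of s] by (auto simp: \<gamma>_def entries_def Pair)
    then show ?thesis
      using poly_fun_adj_mat[of A n, OF A A_poly, of i j] \<mu>_poly
      by (cases "i < n \<and> j < n") (simp_all add: poly_fun_mult)
  qed
  moreover have "poly_fun (\<lambda>s. s) g"
    unfolding g_def by (intro poly_fun_mult \<mu>_poly poly_fun_det[of _ n] A A_poly)
  moreover have "g 0 \<noteq> 0"
    using X(2,4) \<open>A 0 = adj_mat x\<close> by (simp add: g_def \<mu>_def)
  moreover have "\<gamma> s \<in> entries n ` zero_diag_inverse n D" if "g s \<noteq> 0" for s
    unfolding \<gamma>_def
  proof (intro imageI smult_adj_mat_mem(1) A D)
    show "A s $$ (i, i) = 0" if "i \<in> D" for i
      using that D X(5) Y(5) by (subst A_index) auto
  qed (use that in \<open>auto simp: g_def\<close>)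
  ultimately show "\<exists>\<gamma> g. \<gamma> 0 = v \<and> \<gamma> 1 = w \<and> (\<forall>x. poly_fun (\<lambda>s. s) (\<lambda>s. \<gamma> s x)) \<and>
      poly_fun (\<lambda>s. s) g \<and> g 0 \<noteq> 0 \<and> (\<forall>s. g s \<noteq> 0 \<longrightarrow> \<gamma> s \<in> entries n ` zero_diag_inverse n D)"
    by (intro exI[of _ \<gamma>] exI[of _ g]) simp
qed

section \<open>The saturation\<close>

text \<open>
  Killing the indeterminates outside \<open>V\<close> is a retraction onto \<open>poly_ring V\<close>, so that an ideal of
  \<open>poly_ring V\<close> is the restriction of its preimage.
\<close>

definition restrict_vars :: "'x set \<Rightarrow> ('x, 'k::comm_ring_1) mpoly \<Rightarrow> ('x, 'k) mpoly" where
  "restrict_vars V = mpoly_eval Const (\<lambda>x. if x \<in> V then Var x else 0)"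

lemma comm_ring_hom_restrict_vars: "comm_ring_hom (restrict_vars V)"
  unfolding restrict_vars_def by (rule comm_ring_hom.comm_ring_hom_mpoly_eval[OF comm_ring_hom_Const])

lemma restrict_vars_id: "indets f \<subseteq> V \<Longrightarrow> restrict_vars V f = f"
proof -
  assume V: "indets f \<subseteq> V"
  have "restrict_vars V f = mpoly_eval Const Var f"
    unfolding restrict_vars_def using V by (intro mpoly_eval_cong) auto
  then show ?thesis by simp
qed

lemma indets_restrict_vars: "indets (restrict_vars V f) \<subseteq> V"
  unfolding restrict_vars_def by (rule indets_mpoly_eval_Const) auto

lemma type_ideal_restrict_vars:
  assumes "ideal J (poly_ring V :: ('a, 'b::comm_ring_1) mpoly ring)"
  shows "type_ideal {f. restrict_vars V f \<in> J}"
proof -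
  interpret \<phi>: comm_ring_hom "restrict_vars V" by (rule comm_ring_hom_restrict_vars)
  show ?thesis
  proof
    fix a b r :: "('a, 'b) mpoly"
    assume a: "a \<in> {f. restrict_vars V f \<in> J}"
    then show "r * a \<in> {f. restrict_vars V f \<in> J}"
      using poly_ideal_closed(3)[OF assms _ indets_restrict_vars, of "restrict_vars V a" r]
      by (simp add: \<phi>.hom_mult)
    assume "b \<in> {f. restrict_vars V f \<in> J}"
    with a show "a + b \<in> {f. restrict_vars V f \<in> J}"
      by (simp add: \<phi>.hom_add poly_ideal_closed(2)[OF assms])
  qed (simp add: \<phi>.hom_zero poly_ideal_closed(1)[OF assms])
qed

lemma nat_pow_poly_ring: "d [^]\<^bsub>poly_ring V\<^esub> (k::nat) = d ^ k"
proof (induction k)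
  case (Suc k)
  then show ?case by (simp add: nat_pow_def poly_ring_simps mult.commute)
qed (simp add: nat_pow_def poly_ring_simps)

definition mdeg :: "('x \<Rightarrow>\<^sub>0 nat) \<Rightarrow> nat" where
  "mdeg m = (\<Sum>x\<in>keys m. lookup m x)"

lemma monom_eval_scale: "monom_eval (\<lambda>x. c * v x) m = c ^ mdeg m * monom_eval v m"
  by (simp add: monom_eval_def mdeg_def power_mult_distrib prod.distrib power_sum)

lemma adj_diag_mem_principal_minor_ideal:
  "i < n \<Longrightarrow> adj_mat (generic_matrix n) $$ (i, i) \<in> principal_minor_ideal n (n - 1)"
  by (subst principal_minor_ideal_eq) (auto intro: genideal_mem)

lemma ideal_principal_minor_ideal:
  assumes "0 < n" shows "ideal (principal_minor_ideal n (n - 1)) (poly_ring ({..<n} \<times> {..<n}))"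
  unfolding principal_minor_ideal_eq[OF assms]
  using indets_adj_generic_matrix by (intro genideal_poly_ring_ideal) blast

lemma principal_minor_ideal_eval_mem:
  assumes "comm_ring_hom h" "type_ideal p" "x \<in> carrier_mat n n" "0 < n"
    and diag: "\<And>i. i < n \<Longrightarrow> adj_mat x $$ (i, i) \<in> p"
    and f: "f \<in> principal_minor_ideal n (n - 1)"
  shows "mpoly_eval h (entries n x) f \<in> p"
proof -
  let ?J = "{f. indets f \<subseteq> {..<n} \<times> {..<n} \<and> mpoly_eval h (entries n x) f \<in> p}"
  have "ideal ?J (poly_ring ({..<n} \<times> {..<n}))"
    by (intro ideal_preimage comm_ring_hom.comm_ring_hom_mpoly_eval assms)
  moreover have "{adj_mat (generic_matrix n) $$ (i, i) | i. i < n} \<subseteq> ?J"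
    using diag indets_adj_generic_matrix eval_adj_generic_matrix[OF assms(1,3)] by fastforce
  ultimately have "principal_minor_ideal n (n - 1) \<subseteq> ?J"
    unfolding principal_minor_ideal_eq[OF assms(4)] by (rule genideal_least)
  then show ?thesis using f by blast
qed

text \<open>
  Let \<open>B\<close> be the adjugate of the generic matrix \<open>X\<close> and \<open>B0\<close> the matrix that arises from it by
  clearing the diagonal. Modulo the principal minors, \<open>B0 * X = \<Delta>\<close>, so that \<open>X\<close> is proportional
  to \<open>adj B0\<close>, with factors that are powers of \<open>\<Delta>\<close>. Substituting \<open>adj B0\<close> for \<open>X\<close> kills every
  polynomial that vanishes on the matrices whose inverse has zero diagonal.
\<close>

theorem saturated_principal_minor_ideal_eq:
  assumes n: "2 \<le> n"
  shows "(saturated_principal_minor_ideal n (n - 1) :: 'k::alg_closed_field matrix_poly set) =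
    zero_diag_inverse_ideal n {..<n}"
proof
  have n0: "0 < n" using n by simp
  show "saturated_principal_minor_ideal n (n - 1) \<subseteq> (zero_diag_inverse_ideal n {..<n} :: 'k matrix_poly set)"
  proof
    fix f :: "'k matrix_poly" assume "f \<in> saturated_principal_minor_ideal n (n - 1)"
    then obtain k where f: "indets f \<subseteq> {..<n} \<times> {..<n}"
      "det (generic_matrix n) ^ k * f \<in> principal_minor_ideal n (n - 1)"
      by (auto simp: saturated_principal_minor_ideal_def saturation_def matrix_poly_ring_def
          nat_pow_poly_ring poly_ring_simps)
    have "eval_at (entries n x) f = 0" if x: "x \<in> zero_diag_inverse n {..<n}" for x
    proof -
      note X = zero_diag_inverseE[OF x]
      interpret e: comm_ring_hom "eval_at (entries n x)" by (rule comm_ring_hom_eval_point)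
      have "eval_at (entries n x) (det (generic_matrix n) ^ k * f) \<in> {0}"
        by (rule principal_minor_ideal_eval_mem[OF comm_ring_hom_id type_prime.axioms(1)[OF type_prime_zero]
              X(1) n0 _ f(2)]) (simp add: X(5))
      then have "det x ^ k * eval_at (entries n x) f = 0"
        unfolding e.hom_mult e.hom_power eval_det_generic_matrix[OF comm_ring_hom_id X(1)] by (rule singletonD)
      then show ?thesis using X(2) by (simp only: mult_eq_0_iff power_eq_0_iff) blast
    qed
    then show "f \<in> zero_diag_inverse_ideal n {..<n}" using f(1) by (simp add: mem_zero_diag_inverse_ideal)
  qed
  show "zero_diag_inverse_ideal n {..<n} \<subseteq> (saturated_principal_minor_ideal n (n - 1) :: 'k matrix_poly set)"
  proof
    fix f :: "'k matrix_poly" assume f: "f \<in> zero_diag_inverse_ideal n {..<n}"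
    let ?V = "{..<n} \<times> {..<n}"
    have fV: "indets f \<subseteq> ?V" and f0: "\<And>x. x \<in> zero_diag_inverse n {..<n} \<Longrightarrow> eval_at (entries n x) f = 0"
      using f by (auto simp: mem_zero_diag_inverse_ideal)
    define P where "P = {g :: 'k matrix_poly. restrict_vars ?V g \<in> principal_minor_ideal n (n - 1)}"
    interpret P: type_ideal P
      unfolding P_def by (rule type_ideal_restrict_vars[OF ideal_principal_minor_ideal[OF n0]])
    have P_iff: "g \<in> P \<longleftrightarrow> g \<in> principal_minor_ideal n (n - 1)" if "indets g \<subseteq> ?V" for g
      using restrict_vars_id[OF that] by (simp add: P_def)
    define X where "X = (generic_matrix n :: 'k matrix_poly mat)"
    have X: "X \<in> carrier_mat n n" by (simp add: X_def)
    define \<Delta> where "\<Delta> = det X"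
    define B where "B = adj_mat X"
    have B: "B \<in> carrier_mat n n" unfolding B_def by (rule adj_mat(1)[OF X])
    have diag: "B $$ (i, i) \<in> P" if "i < n" for i
      unfolding B_def X_def P_iff[OF indets_adj_generic_matrix[OF that that]]
      by (rule adj_diag_mem_principal_minor_ideal[OF that])
    define B0 where "B0 = mat n n (\<lambda>(i, j). if i = j then 0 else B $$ (i, j))"
    have B0: "B0 \<in> carrier_mat n n" by (simp add: B0_def)
    have B0_cong: "B0 $$ (i, j) - B $$ (i, j) \<in> P" if "i < n" "j < n" for i j
      using that P.uminus_mem[OF diag, of i] by (auto simp: B0_def P.zero_mem)
    define \<delta> where "\<delta> = det B0"
    define C where "C = adj_mat B0"
    have X_cong: "\<delta> * X $$ (l, j) - \<Delta> * C $$ (l, j) \<in> P" if lj: "l < n" "j < n" for l j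
    proof -
      have "(\<Sum>k<n. B0 $$ (i, k) * X $$ (k, j)) - (if i = j then \<Delta> else 0) \<in> P" if i: "i < n" for i
      proof -
        have "(\<Sum>k<n. B0 $$ (i, k) * X $$ (k, j)) - (\<Sum>k<n. B $$ (i, k) * X $$ (k, j)) \<in> P"
          by (intro P.cong_sum P.cong_mult) (use B0_cong[OF i] P.zero_mem in auto)
        then show ?thesis
          unfolding B_def adj_mat_mult[OF X i lj(2)] \<Delta>_def .
      qed
      then have "(\<Sum>i<n. C $$ (l, i) * (\<Sum>k<n. B0 $$ (i, k) * X $$ (k, j))) -
          (\<Sum>i<n. C $$ (l, i) * (if i = j then \<Delta> else 0)) \<in> P"
        by (intro P.cong_sum P.cong_mult) (simp_all add: P.zero_mem)
      also have "(\<Sum>i<n. C $$ (l, i) * (\<Sum>k<n. B0 $$ (i, k) * X $$ (k, j))) =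
          (\<Sum>k<n. (\<Sum>i<n. C $$ (l, i) * B0 $$ (i, k)) * X $$ (k, j))"
        unfolding sum_distrib_left sum_distrib_right mult.assoc by (rule sum.swap)
      also have "\<dots> = (\<Sum>k<n. if k = l then \<delta> * X $$ (l, j) else 0)"
        unfolding C_def \<delta>_def using adj_mat_mult[OF B0 lj(1)] by (intro sum.cong) auto
      also have "\<dots> = \<delta> * X $$ (l, j)" using lj by simp
      also have "(\<Sum>i<n. C $$ (l, i) * (if i = j then \<Delta> else 0)) = \<Delta> * C $$ (l, j)"
        using lj by (simp add: if_distrib[of "\<lambda>x. _ * x"] mult.commute cong: if_cong)
      finally show ?thesis .
    qed
    (* a bound on the degrees of the terms of f, which are made homogeneous with powers of \<delta> *)
    define N where "N = Max (insert 0 (mdeg ` keys f))"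
    have N: "mdeg m \<le> N" if "m \<in> keys f" for m
      unfolding N_def using that by (intro Max_ge) auto
    define h where "h = (\<Sum>m\<in>keys f. Const (lookup f m) * \<delta> ^ (N - mdeg m) *
        monom_eval (\<lambda>ij. \<Delta> * C $$ ij) m)"
    have "\<delta> ^ N * f - h \<in> P"
    proof -
      have "\<delta> ^ N * f = (\<Sum>m\<in>keys f. \<delta> ^ N * (Const (lookup f m) * monom_eval Var m))"
        unfolding sum_distrib_left[symmetric] mpoly_eval_def[symmetric] mpoly_eval_Const_Var ..
      also have "\<dots> = (\<Sum>m\<in>keys f. Const (lookup f m) * \<delta> ^ (N - mdeg m) *
          monom_eval (\<lambda>ij. \<delta> * Var ij) m)"
      proof (rule sum.cong[OF refl])
        fix m assume "m \<in> keys f"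
        then have "\<delta> ^ N = \<delta> ^ (N - mdeg m) * \<delta> ^ mdeg m" using N by (simp flip: power_add)
        then show "\<delta> ^ N * (Const (lookup f m) * monom_eval Var m) =
            Const (lookup f m) * \<delta> ^ (N - mdeg m) * monom_eval (\<lambda>ij. \<delta> * Var ij) m"
          unfolding monom_eval_scale by (simp add: ac_simps)
      qed
      also have "\<dots> - h \<in> P"
        unfolding h_def
      proof (rule P.cong_sum, rule P.cong_mult, simp add: P.zero_mem, rule P.cong_monom_eval)
        fix m ij assume "m \<in> keys f" "ij \<in> keys m"
        then have "ij \<in> ?V" using fV by (auto simp: indets_def)
        then show "\<delta> * Var ij - \<Delta> * C $$ ij \<in> P"
          using X_cong[of "fst ij" "snd ij"] by (auto simp: X_def generic_matrix_def)
      qed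
      finally show ?thesis .
    qed
    moreover have "h * (\<delta> * \<Delta>) = 0"
    proof (rule mpoly_eq_0_iff[THEN iffD2], rule allI)
      fix v :: "nat \<times> nat \<Rightarrow> 'k"
      let ?e = "eval_at v"
      interpret e: comm_ring_hom ?e by (rule comm_ring_hom_eval_point)
      define x where "x = map_mat ?e X"
      have x: "x \<in> carrier_mat n n" using X by (simp add: x_def)
      define b where "b = map_mat ?e B0"
      have b: "b \<in> carrier_mat n n" using B0 by (simp add: b_def)
      have e\<Delta>: "?e \<Delta> = det x" unfolding x_def \<Delta>_def by (rule e.hom_det[symmetric])
      have e\<delta>: "?e \<delta> = det b" unfolding b_def \<delta>_def by (rule e.hom_det[symmetric])
      have eC: "?e (C $$ (i, j)) = adj_mat b $$ (i, j)" if "i < n" "j < n" for i j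
        unfolding b_def C_def by (rule e.hom_adj_mat[OF B0 that])
      have "?e h = 0" if nz: "det x \<noteq> 0" "det b \<noteq> 0"
      proof -
        define y where "y = (det x / det b) \<cdot>\<^sub>m adj_mat b"
        have "b $$ (i, i) = 0" if "i \<in> {..<n}" for i
          using that by (simp add: b_def B0_def e.hom_zero)
        then have "y \<in> zero_diag_inverse n {..<n}"
          unfolding y_def using nz by (intro smult_adj_mat_mem(1) b) simp_all
        then have "eval_at (entries n y) f = 0" by (rule f0)
        have "?e h = (\<Sum>m\<in>keys f. ?e (Const (lookup f m) * \<delta> ^ (N - mdeg m) *
            monom_eval (\<lambda>ij. \<Delta> * C $$ ij) m))"
          unfolding h_def by (rule comm_ring_hom.mpoly_eval_sum[OF comm_ring_hom_id])
        also have "\<dots> = (\<Sum>m\<in>keys f. det b ^ N * (lookup f m * monom_eval (entries n y) m))"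
        proof (rule sum.cong[OF refl])
          fix m assume m: "m \<in> keys f"
          have "monom_eval (\<lambda>ij. ?e (\<Delta> * C $$ ij)) m = monom_eval (\<lambda>ij. det b * entries n y ij) m"
          proof (rule monom_eval_cong)
            fix ij assume "ij \<in> keys m"
            then have "ij \<in> ?V" using m fV by (auto simp: indets_def)
            then obtain i j where ij: "ij = (i, j)" "i < n" "j < n" by auto
            show "?e (\<Delta> * C $$ ij) = det b * entries n y ij"
              unfolding ij(1) e.hom_mult e\<Delta> eC[OF ij(2,3)]
              using ij(2,3) nz b by (simp add: entries_def y_def)
          qed
          also have "\<dots> = det b ^ mdeg m * monom_eval (entries n y) m" by (rule monom_eval_scale)
          finally have ev: "?e (monom_eval (\<lambda>ij. \<Delta> * C $$ ij) m) = det b ^ mdeg m * monom_eval (entries n y) m"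
            unfolding e.hom_monom_eval .
          have "det b ^ N = det b ^ (N - mdeg m) * det b ^ mdeg m" using N[OF m] by (simp flip: power_add)
          then show "?e (Const (lookup f m) * \<delta> ^ (N - mdeg m) * monom_eval (\<lambda>ij. \<Delta> * C $$ ij) m) =
              det b ^ N * (lookup f m * monom_eval (entries n y) m)"
            unfolding e.hom_mult e.hom_power ev e\<delta> comm_ring_hom.mpoly_eval_Const[OF comm_ring_hom_id]
            by (simp only: ac_simps)
        qed
        also have "\<dots> = det b ^ N * eval_at (entries n y) f"
          unfolding mpoly_eval_def sum_distrib_left ..
        finally show ?thesis using \<open>eval_at (entries n y) f = 0\<close> by (simp only: mult_zero_right)
      qed
      then show "?e (h * (\<delta> * \<Delta>)) = 0"
        unfolding e.hom_mult e\<Delta> e\<delta> by (metis mult_zero_left mult_zero_right)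
    qed
    ultimately have "(\<delta> ^ N * f) * (\<delta> * \<Delta>) \<in> P"
      using P.mult_mem'[of "\<delta> ^ N * f - h" "\<delta> * \<Delta>"] by (simp add: left_diff_distrib)
    then have "(\<Delta> * \<delta>) ^ Suc N * f \<in> P"
      using P.mult_mem[of "(\<delta> ^ N * f) * (\<delta> * \<Delta>)" "\<Delta> ^ N"] by (simp add: power_mult_distrib ac_simps)
    moreover have "\<Delta> * \<delta> - \<Delta> ^ n \<in> P"
    proof -
      have "det B * \<Delta> = \<Delta> ^ n"
        using det_mult[OF B X] adj_mat(3)[OF X] by (simp add: B_def \<Delta>_def)
      moreover have "\<delta> - det B \<in> P" unfolding \<delta>_def by (rule P.cong_det[OF B0 B B0_cong])
      ultimately show ?thesis using P.mult_mem[of "\<delta> - det B" \<Delta>] by (simp add: algebra_simps)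
    qed
    then have "(\<Delta> * \<delta>) ^ Suc N * f - (\<Delta> ^ n) ^ Suc N * f \<in> P"
      by (intro P.cong_mult P.cong_power) (simp_all add: P.zero_mem)
    ultimately have "\<Delta> ^ (n * Suc N) * f \<in> P"
      unfolding power_mult using P.mem_cong by blast
    moreover have "indets (\<Delta> ^ (n * Suc N) * f) \<subseteq> ?V"
      using indets_mult[of "\<Delta> ^ (n * Suc N)" f] indets_power[of \<Delta> "n * Suc N"]
        indets_det_generic_matrix[of n, where 'k = 'k] fV
      unfolding \<Delta>_def X_def by blast
    ultimately have "\<Delta> ^ (n * Suc N) * f \<in> principal_minor_ideal n (n - 1)" using P_iff by blast
    then show "f \<in> saturated_principal_minor_ideal n (n - 1)"
      using fV by (auto simp: saturated_principal_minor_ideal_def saturation_def matrix_poly_ring_def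
          nat_pow_poly_ring poly_ring_simps \<Delta>_def X_def simp del: power_Suc mult_Suc_right)
  qed
qed

section \<open>Singular points off the determinantal variety\<close>

lemma poly_fun_poly:
  assumes "poly_fun h g" shows "poly_fun h (\<lambda>s. poly q (g s))"
proof -
  obtain g' where "\<forall>s. g s = poly g' (h s)" using assms unfolding poly_fun_def by blast
  then show ?thesis unfolding poly_fun_def by (intro exI[of _ "pcompose q g'"]) (simp add: poly_pcompose)
qed

lemma poly_fun_entries:
  assumes "\<And>i j. i < n \<Longrightarrow> j < n \<Longrightarrow> poly_fun h (\<lambda>s. Y s $$ (i, j))"
  shows "poly_fun h (\<lambda>s. entries n (Y s) ij)"
proof (cases ij)
  case (Pair i j)
  then show ?thesis using assms[of i j] by (cases "i < n \<and> j < n") (simp_all only: entries_def prod.case if_True if_False, simp_all)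
qed

text \<open>The elementary matrix \<open>1 + c * d\<^sup>T\<close>; it is used for \<open>d\<^sup>T * c = 0\<close>.\<close>

definition transvection :: "nat \<Rightarrow> (nat \<Rightarrow> 'a) \<Rightarrow> (nat \<Rightarrow> 'a) \<Rightarrow> 'a::comm_ring_1 mat" where
  "transvection n c d = mat n n (\<lambda>(i, j). (if i = j then 1 else 0) + c i * d j)"

lemma transvection_carrier [simp]: "transvection n c d \<in> carrier_mat n n"
  by (simp add: transvection_def)

lemma transvection_mult:
  assumes "A \<in> carrier_mat n n" "i < n" "j < n"
  shows "(transvection n c d * A) $$ (i, j) = A $$ (i, j) + c i * (\<Sum>k<n. d k * A $$ (k, j))"
proof -
  have "(transvection n c d * A) $$ (i, j) =
      (\<Sum>k<n. (if k = i then A $$ (i, j) else 0) + c i * (d k * A $$ (k, j)))"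
    using assms by (auto simp: transvection_def scalar_prod_def lessThan_atLeast0 algebra_simps intro!: sum.cong)
  then show ?thesis using assms(2) by (simp add: sum.distrib sum_distrib_left)
qed

lemma mult_transvection:
  assumes "A \<in> carrier_mat n n" "i < n" "j < n"
  shows "(A * transvection n c d) $$ (i, j) = A $$ (i, j) + (\<Sum>k<n. A $$ (i, k) * c k) * d j"
proof -
  have "(A * transvection n c d) $$ (i, j) =
      (\<Sum>k<n. (if k = j then A $$ (i, j) else 0) + A $$ (i, k) * c k * d j)"
    using assms by (auto simp: transvection_def scalar_prod_def lessThan_atLeast0 algebra_simps intro!: sum.cong)
  then show ?thesis using assms(3) by (simp add: sum.distrib sum_distrib_right)
qed

lemma transvection_inverse:
  assumes "(\<Sum>k<n. d k * c k) = 0"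
  shows "transvection n c d * transvection n (\<lambda>k. - c k) d = 1\<^sub>m n"
proof (rule eq_matI)
  fix i j assume "i < dim_row (1\<^sub>m n :: 'a mat)" "j < dim_col (1\<^sub>m n :: 'a mat)"
  then have ij: "i < n" "j < n" by simp_all
  have "(\<Sum>k<n. d k * transvection n (\<lambda>k. - c k) d $$ (k, j)) =
      (\<Sum>k<n. (if k = j then d j else 0) - d k * c k * d j)"
    using ij by (intro sum.cong) (auto simp: transvection_def algebra_simps)
  also have "\<dots> = d j" using assms ij by (simp add: sum_subtractf flip: sum_distrib_right)
  finally show "(transvection n c d * transvection n (\<lambda>k. - c k) d) $$ (i, j) = 1\<^sub>m n $$ (i, j)"
    using ij by (simp add: transvection_mult[OF transvection_carrier]) (simp add: transvection_def)
qed (simp_all add: transvection_def)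

lemma transvection_inverse':
  assumes "(\<Sum>k<n. d k * c k) = 0"
  shows "transvection n (\<lambda>k. - c k) d * transvection n c d = 1\<^sub>m n"
  using transvection_inverse[where c = "\<lambda>k. - c k" and d = d and n = n] assms by (simp add: sum_negf)

lemma adj_transvection_mult:
  assumes "(\<Sum>k<n. d k * c k) = 0" "A \<in> carrier_mat n n" "i < n" "j < n"
  shows "adj_mat (transvection n c d * A) $$ (i, j) =
    det (transvection n c d) * (adj_mat A $$ (i, j) - (\<Sum>k<n. adj_mat A $$ (i, k) * c k) * d j)"
proof -
  have "(\<Sum>k<n. adj_mat A $$ (i, k) * transvection n (\<lambda>k. - c k) d $$ (k, j)) =
      (adj_mat A * transvection n (\<lambda>k. - c k) d) $$ (i, j)"
    using assms by (simp add: scalar_prod_def lessThan_atLeast0 transvection_def)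
  also have "\<dots> = adj_mat A $$ (i, j) - (\<Sum>k<n. adj_mat A $$ (i, k) * c k) * d j"
    by (subst mult_transvection[OF adj_mat(1)[OF assms(2)] assms(3,4)]) (simp add: sum_negf)
  finally show ?thesis
    using adj_mat_mult_left[OF transvection_carrier transvection_carrier transvection_inverse[OF assms(1)] assms(2-4)]
    by simp
qed

lemma adj_mult_transvection:
  assumes "(\<Sum>k<n. d k * c k) = 0" "A \<in> carrier_mat n n" "i < n" "j < n"
  shows "adj_mat (A * transvection n c d) $$ (i, j) =
    det (transvection n c d) * (adj_mat A $$ (i, j) - c i * (\<Sum>k<n. d k * adj_mat A $$ (k, j)))"
proof -
  have "(\<Sum>k<n. transvection n (\<lambda>k. - c k) d $$ (i, k) * adj_mat A $$ (k, j)) =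
      (transvection n (\<lambda>k. - c k) d * adj_mat A) $$ (i, j)"
    using assms by (simp add: scalar_prod_def lessThan_atLeast0 transvection_def)
  also have "\<dots> = adj_mat A $$ (i, j) - c i * (\<Sum>k<n. d k * adj_mat A $$ (k, j))"
    by (subst transvection_mult[OF adj_mat(1)[OF assms(2)] assms(3,4)]) simp
  finally show ?thesis
    using adj_mat_mult_right[OF transvection_carrier transvection_carrier transvection_inverse'[OF assms(1)] assms(2-4)]
    by simp
qed

lemma (in type_prime) unit_notin: "a * b = 1 \<Longrightarrow> a \<notin> p"
  using one_notin mult_mem'[of a b] by auto

lemma (in type_prime) det_transvection_notin:
  assumes "(\<Sum>k<n. d k * c k) = 0" shows "det (transvection n c d) \<notin> p"
proof (rule unit_notin)
  show "det (transvection n c d) * det (transvection n (\<lambda>k. - c k) d) = 1"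
    using det_mult[OF transvection_carrier transvection_carrier, of n c d "\<lambda>k. - c k" d]
      transvection_inverse[OF assms] by simp
qed

lemma (in type_prime) field_hom_notin:
  fixes h :: "'k::field \<Rightarrow> 'a"
  assumes "comm_ring_hom h" "s \<noteq> 0" shows "h s \<notin> p"
proof (rule unit_notin)
  interpret h: comm_ring_hom h by fact
  show "h s * h (inverse s) = 1" using assms(2) by (simp flip: h.hom_mult)
qed

lemma (in type_prime) mem_by_specialization:
  fixes h :: "'k::alg_closed_field \<Rightarrow> 'a"
  assumes "comm_ring_hom h" "poly_fun h g" "\<And>s. s \<noteq> 0 \<Longrightarrow> g s \<in> p"
  shows "g 0 \<in> p"
proof (rule ccontr)
  assume "g 0 \<notin> p"
  then have "finite {s. g s \<in> p}" by (rule finite_parameters[OF assms(1,2)])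
  moreover have "UNIV = insert 0 {s. g s \<in> p}" using assms(3) by auto
  ultimately show False using infinite_alg_closed_field[where 'k = 'k] by (metis finite.insertI)
qed

text \<open>
  A matrix \<open>x\<close> that is singular modulo a prime \<open>p\<close>, with \<open>n - 1\<close> as its rank, has an adjugate
  \<open>u * v\<^sup>T\<close> of rank one, and its principal minors lie in \<open>p\<close> iff \<open>u\<close> and \<open>v\<close> have disjoint supports.
  If the supports cover all indices, \<open>x\<close> is the limit of invertible matrices with the same
  property: adding \<open>r\<close> to an entry of \<open>x\<close> makes it invertible and leaves \<open>u\<close> and \<open>v\<close> as a column
  and a row of the adjugate, and adding multiples of that column to the others or of that row to
  the others restores the zeros of the diagonal.
\<close>

lemma (in type_prime) singular_specialization:
  fixes h :: "'k::alg_closed_field \<Rightarrow> 'a"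
  assumes h: "comm_ring_hom h"
    and f: "\<And>y. y \<in> carrier_mat n n \<Longrightarrow> det y \<notin> p \<Longrightarrow> (\<And>i. i < n \<Longrightarrow> adj_mat y $$ (i, i) \<in> p) \<Longrightarrow>
      mpoly_eval h (entries n y) f \<in> p"
    and x: "x \<in> carrier_mat n n" "det x \<in> p" "\<And>i. i < n \<Longrightarrow> adj_mat x $$ (i, i) \<in> p"
    and ab: "a < n" "b < n" "adj_mat x $$ (a, b) \<notin> p"
    and supp: "\<And>i. i < n \<Longrightarrow> adj_mat x $$ (i, b) \<notin> p \<or> adj_mat x $$ (a, i) \<notin> p"
  shows "mpoly_eval h (entries n x) f \<in> p"
proof -
  interpret h: comm_ring_hom h by fact
  define u where "u i = adj_mat x $$ (i, b)" for i
  define v where "v i = adj_mat x $$ (a, i)" for i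
  define X where "X r = mat n n (\<lambda>ij. x $$ ij + (if ij = (b, a) then r else 0))" for r
  have X: "X r \<in> carrier_mat n n" for r by (simp add: X_def)
  have X0: "X 0 = x" using x(1) by (intro eq_matI) (auto simp: X_def)
  have X_index: "X r $$ (i, j) = x $$ (i, j) + (if i = b \<and> j = a then r else 0)" if "i < n" "j < n" for r i j
    using that by (simp add: X_def)
  have col_b: "adj_mat (X r) $$ (i, b) = u i" if "i < n" for r i
  proof -
    have "mat_delete (X r) b i = mat_delete x b i"
      using x(1) that ab by (intro eq_matI) (auto simp: mat_delete_def X_def)
    then show ?thesis
      using that ab by (simp add: u_def adj_mat_index[OF X] adj_mat_index[OF x(1)] cofactor_def)
  qed
  have row_a: "adj_mat (X r) $$ (a, j) = v j" if "j < n" for r j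
  proof -
    have "mat_delete (X r) j a = mat_delete x j a"
      using x(1) that ab by (intro eq_matI) (auto simp: mat_delete_def X_def)
    then show ?thesis
      using that ab by (simp add: v_def adj_mat_index[OF X] adj_mat_index[OF x(1)] cofactor_def)
  qed
  have det_X: "det (X r) = det x + r * u a" for r
  proof -
    have "det (X r) = (\<Sum>j<n. X r $$ (b, j) * adj_mat (X r) $$ (j, b))"
      using mult_adj_mat[OF X ab(2) ab(2), of r] by simp
    also have "\<dots> = (\<Sum>j<n. x $$ (b, j) * u j + (if j = a then r * u a else 0))"
      using ab(2) by (intro sum.cong) (auto simp: col_b X_index algebra_simps)
    also have "\<dots> = det x + r * u a"
      using mult_adj_mat[OF x(1) ab(2) ab(2)] ab(1) by (simp add: sum.distrib u_def)
    finally show ?thesis .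
  qed
  have "\<exists>k. \<forall>r. adj_mat (X r) $$ (i, i) = adj_mat x $$ (i, i) + r * poly k r" if "i < n" for i
  proof -
    have "poly_fun (\<lambda>r. r) (\<lambda>r. X r $$ (i, j))" if "i < n" "j < n" for i j
    proof (cases "i = b \<and> j = a")
      case True
      then have "(\<lambda>r. X r $$ (i, j)) = (\<lambda>r. x $$ (i, j) + r)" using X_index[OF that] by auto
      then show ?thesis by (simp add: poly_fun_add)
    next
      case False
      then have "(\<lambda>r. X r $$ (i, j)) = (\<lambda>r. x $$ (i, j))" using X_index[OF that] by auto
      then show ?thesis by simp
    qed
    then have "poly_fun (\<lambda>r. r) (\<lambda>r. adj_mat (X r) $$ (i, i))"
      using that by (intro poly_fun_adj_mat[of X n] X)
    then obtain q where q: "\<And>r. adj_mat (X r) $$ (i, i) = poly q r" unfolding poly_fun_def by blast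
    obtain q0 k where qk: "q = pCons q0 k" by (cases q)
    have "q0 = adj_mat x $$ (i, i)" using q[of 0] X0 qk by simp
    then show ?thesis using q qk by auto
  qed
  then obtain k where k: "\<And>i r. i < n \<Longrightarrow> adj_mat (X r) $$ (i, i) = adj_mat x $$ (i, i) + r * poly (k i) r"
    by metis
  (* the multiples of column b and row a that restore the diagonal have the denominators t i; the
     parameter of the curve is multiplied by their product to clear them *)
  define t where "t i = (if u i \<notin> p then u i else v i)" for i
  have t: "t i \<notin> p" if "i < n" for i using supp[OF that] by (auto simp: t_def u_def v_def)
  define \<tau> where "\<tau> = (\<Prod>i<n. t i)"
  define w where "w i = (\<Prod>j\<in>{..<n} - {i}. t j)" for i
  have \<tau>: "\<tau> = t i * w i" if "i < n" for i
    unfolding \<tau>_def w_def using that by (intro prod.remove) auto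
  have "\<tau> \<notin> p" unfolding \<tau>_def using t by (intro prod_notin) auto
  define e where "e i s = - (h s * poly (k i) (h s * \<tau>) * w i)" for i s
  define \<alpha> where "\<alpha> s i = (if u i \<notin> p then e i s else 0)" for s i
  define \<beta> where "\<beta> s i = (if u i \<notin> p then 0 else e i s)" for s i
  have "u a \<notin> p" using ab(3) by (simp add: u_def)
  have "u b \<in> p" using x(3)[OF ab(2)] by (simp add: u_def)
  let ?\<delta> = "\<lambda>b i. if i = b then 1 else (0::'a)"
  have sum_\<delta>: "(\<Sum>k<n. ?\<delta> c k * g k) = g c" "(\<Sum>k<n. g k * ?\<delta> c k) = g c" if "c < n" for c and g :: "nat \<Rightarrow> 'a"
    using that by (simp_all add: if_distrib[of "\<lambda>x. x * _"] if_distrib[of "\<lambda>x. _ * x"] cong: if_cong)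
  define E1 where "E1 s = transvection n (?\<delta> b) (\<lambda>i. - \<alpha> s i)" for s
  define E2 where "E2 s = transvection n (\<lambda>i. - \<beta> s i) (?\<delta> a)" for s
  have ortho1: "(\<Sum>k<n. - \<alpha> s k * ?\<delta> b k) = 0" for s
    using \<open>u b \<in> p\<close> by (subst sum_\<delta>(2)[OF ab(2)]) (simp add: \<alpha>_def)
  have ortho2: "(\<Sum>k<n. ?\<delta> a k * - \<beta> s k) = 0" for s
    using \<open>u a \<notin> p\<close> by (subst sum_\<delta>(1)[OF ab(1)]) (simp add: \<beta>_def)
  define Y where "Y s = E1 s * (X (h s * \<tau>) * E2 s)" for s
  have XE: "X r * E2 s \<in> carrier_mat n n" for r s
    unfolding E2_def by (rule mult_carrier_mat[OF X transvection_carrier])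
  have Y: "Y s \<in> carrier_mat n n" for s
    unfolding Y_def E1_def using mult_carrier_mat[OF transvection_carrier XE] .
  have XE_index: "(X r * E2 s) $$ (i, j) = X r $$ (i, j) + (\<Sum>l<n. X r $$ (i, l) * - \<beta> s l) * ?\<delta> a j"
    if "i < n" "j < n" for r s i j
    unfolding E2_def by (rule mult_transvection[OF X that])
  have Y_index: "Y s $$ (i, j) = (X (h s * \<tau>) * E2 s) $$ (i, j) +
      ?\<delta> b i * (\<Sum>l<n. - \<alpha> s l * (X (h s * \<tau>) * E2 s) $$ (l, j))" if "i < n" "j < n" for s i j
    unfolding Y_def E1_def by (rule transvection_mult[OF XE that])
  have e_poly: "poly_fun h (e i)" for i
    unfolding e_def
    using poly_fun_mult[OF poly_fun_const[of h "-1"] poly_fun_mult[OF poly_fun_mult[OF poly_fun_param[of h]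
      poly_fun_poly[OF poly_fun_mult[OF poly_fun_param poly_fun_const]]] poly_fun_const]]
    by simp
  have \<alpha>_poly: "poly_fun h (\<lambda>s. - \<alpha> s i)" and \<beta>_poly: "poly_fun h (\<lambda>s. - \<beta> s i)" for i
    using poly_fun_mult[OF poly_fun_const[of h "-1"] e_poly[of i]]
    by (cases "u i \<in> p"; simp add: \<alpha>_def \<beta>_def)+
  have X_poly: "poly_fun h (\<lambda>s. X (h s * \<tau>) $$ (i, j))" if "i < n" "j < n" for i j
    unfolding X_index[OF that]
    by (cases "i = b"; cases "j = a") (simp_all add: poly_fun_add poly_fun_mult)
  have XE_poly: "poly_fun h (\<lambda>s. (X (h s * \<tau>) * E2 s) $$ (i, j))" if "i < n" "j < n" for i j
    unfolding XE_index[OF that]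
    by (intro poly_fun_add poly_fun_mult poly_fun_sum poly_fun_const X_poly \<beta>_poly) (use that in auto)
  have Y_poly: "poly_fun h (\<lambda>s. Y s $$ (i, j))" if "i < n" "j < n" for i j
    unfolding Y_index[OF that]
    by (intro poly_fun_add poly_fun_mult poly_fun_sum poly_fun_const XE_poly \<alpha>_poly) (use that in auto)
  have "e i 0 = 0" for i by (simp add: e_def h.hom_zero)
  then have "\<alpha> 0 i = 0" "\<beta> 0 i = 0" for i by (auto simp: \<alpha>_def \<beta>_def)
  then have "Y 0 $$ (i, j) = x $$ (i, j)" if "i < n" "j < n" for i j
    using that by (simp add: Y_index XE_index X_index h.hom_zero)
  then have Y0: "Y 0 = x" using Y[of 0] x(1) by (intro eq_matI) auto
  have Y_mem: "mpoly_eval h (entries n (Y s)) f \<in> p" if s: "s \<noteq> 0" for s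
  proof (rule f[OF Y])
    have "det (Y s) = det (E1 s) * (det (X (h s * \<tau>)) * det (E2 s))"
      unfolding Y_def using det_mult[OF _ XE, of "E1 s"] det_mult[OF X, of "E2 s"] by (simp add: E1_def E2_def)
    moreover have "det (E1 s) \<notin> p" "det (E2 s) \<notin> p"
      unfolding E1_def E2_def by (rule det_transvection_notin[OF ortho1], rule det_transvection_notin[OF ortho2])
    moreover have "det (X (h s * \<tau>)) \<notin> p"
    proof -
      have "h s * \<tau> * u a \<notin> p"
        using \<open>\<tau> \<notin> p\<close> \<open>u a \<notin> p\<close> field_hom_notin[OF h s] by (simp add: mult_mem_iff)
      then show ?thesis
        unfolding det_X using x(2) mem_cong[of "det x + h s * \<tau> * u a" "h s * \<tau> * u a"] by simp
    qed
    ultimately show "det (Y s) \<notin> p" by (simp add: mult_mem_iff)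
  next
    fix i assume i: "i < n"
    let ?r = "h s * \<tau>"
    have adj_XE: "adj_mat (X ?r * E2 s) $$ (i, j) = det (E2 s) * (adj_mat (X ?r) $$ (i, j) + \<beta> s i * v j)"
      if "j < n" for j
    proof -
      have "adj_mat (X ?r * E2 s) $$ (i, j) =
          det (E2 s) * (adj_mat (X ?r) $$ (i, j) - - \<beta> s i * (\<Sum>k<n. ?\<delta> a k * adj_mat (X ?r) $$ (k, j)))"
        unfolding E2_def by (rule adj_mult_transvection[OF ortho2 X i that])
      then show ?thesis unfolding sum_\<delta>(1)[OF ab(1)] row_a[OF that] by simp
    qed
    have "adj_mat (Y s) $$ (i, i) = det (E1 s) * (adj_mat (X ?r * E2 s) $$ (i, i) -
        (\<Sum>k<n. adj_mat (X ?r * E2 s) $$ (i, k) * ?\<delta> b k) * - \<alpha> s i)"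
      unfolding Y_def E1_def by (rule adj_transvection_mult[OF ortho1 XE i i])
    also have "\<dots> = det (E1 s) * det (E2 s) *
        (adj_mat (X ?r) $$ (i, i) + \<beta> s i * v i + u i * \<alpha> s i + \<beta> s i * \<alpha> s i * v b)"
      unfolding sum_\<delta>(2)[OF ab(2)] adj_XE[OF i] adj_XE[OF ab(2)] col_b[OF i] by (simp add: algebra_simps)
    also have "adj_mat (X ?r) $$ (i, i) + \<beta> s i * v i + u i * \<alpha> s i + \<beta> s i * \<alpha> s i * v b = adj_mat x $$ (i, i)"
      unfolding k[OF i] using \<tau>[OF i] by (simp add: \<alpha>_def \<beta>_def e_def t_def algebra_simps split: if_splits)
    finally show "adj_mat (Y s) $$ (i, i) \<in> p" using x(3)[OF i] by (simp add: mult_mem)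
  qed
  have "poly_fun h (\<lambda>s. mpoly_eval h (entries n (Y s)) f)"
    by (intro poly_fun_mpoly_eval poly_fun_entries Y_poly)
  from mem_by_specialization[OF h this Y_mem] show ?thesis by (simp add: Y0)
qed

text \<open>
  Common zeros of \<open>u\<close> and \<open>v\<close> are removed first, by adding multiples of a nonzero entry of \<open>u\<close> to
  them, which moves the kernel of \<open>x\<close> and keeps its rank.
\<close>

lemma (in type_prime) singular_specialization':
  fixes h :: "'k::alg_closed_field \<Rightarrow> 'a"
  assumes h: "comm_ring_hom h"
    and f: "\<And>y. y \<in> carrier_mat n n \<Longrightarrow> det y \<notin> p \<Longrightarrow> (\<And>i. i < n \<Longrightarrow> adj_mat y $$ (i, i) \<in> p) \<Longrightarrow>
      mpoly_eval h (entries n y) f \<in> p"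
    and x: "x \<in> carrier_mat n n" "det x \<in> p" "\<And>i. i < n \<Longrightarrow> adj_mat x $$ (i, i) \<in> p"
    and ab: "a < n" "b < n" "adj_mat x $$ (a, b) \<notin> p"
  shows "mpoly_eval h (entries n x) f \<in> p"
proof -
  interpret h: comm_ring_hom h by fact
  define D where "D = {i. adj_mat x $$ (i, b) \<in> p \<and> adj_mat x $$ (a, i) \<in> p}"
  have "a \<notin> D" using ab(3) by (simp add: D_def)
  let ?\<delta> = "\<lambda>i. if i = a then 1 else (0::'a)"
  define c where "c s i = (if i \<in> D then - h s else 0)" for s i
  have sum_\<delta>: "(\<Sum>k<n. ?\<delta> k * g k) = g a" for g :: "nat \<Rightarrow> 'a"
    using ab(1) by (simp add: if_distrib[of "\<lambda>x. x * _"] cong: if_cong)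
  have ortho: "(\<Sum>k<n. ?\<delta> k * c s k) = 0" for s
    using \<open>a \<notin> D\<close> by (subst sum_\<delta>) (simp add: c_def)
  define E where "E s = transvection n (c s) ?\<delta>" for s
  have E: "det (E s) \<notin> p" for s unfolding E_def by (rule det_transvection_notin[OF ortho])
  define Y where "Y s = x * E s" for s
  have Y: "Y s \<in> carrier_mat n n" for s unfolding Y_def E_def using x(1) by simp
  have Y_index: "Y s $$ (i, j) = x $$ (i, j) + (\<Sum>k<n. x $$ (i, k) * c s k) * ?\<delta> j" if "i < n" "j < n" for s i j
    unfolding Y_def E_def by (rule mult_transvection[OF x(1) that])
  have adj_Y: "adj_mat (Y s) $$ (i, j) = det (E s) * (adj_mat x $$ (i, j) + (if i \<in> D then h s * adj_mat x $$ (a, j) else 0))"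
    if "i < n" "j < n" for s i j
  proof -
    have "adj_mat (Y s) $$ (i, j) = det (E s) * (adj_mat x $$ (i, j) - c s i * (\<Sum>k<n. ?\<delta> k * adj_mat x $$ (k, j)))"
      unfolding Y_def E_def by (rule adj_mult_transvection[OF ortho x(1) that])
    then show ?thesis unfolding sum_\<delta> by (simp add: c_def)
  qed
  have c_poly: "poly_fun h (\<lambda>s. c s i)" for i
    using poly_fun_mult[OF poly_fun_const[of h "-1"] poly_fun_param[of h]] by (cases "i \<in> D") (simp_all add: c_def)
  have Y_poly: "poly_fun h (\<lambda>s. Y s $$ (i, j))" if "i < n" "j < n" for i j
    unfolding Y_index[OF that] by (intro poly_fun_add poly_fun_mult poly_fun_sum poly_fun_const c_poly)
  have "c 0 i = 0" for i by (simp add: c_def h.hom_zero)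
  then have "Y 0 $$ (i, j) = x $$ (i, j)" if "i < n" "j < n" for i j
    using that by (simp add: Y_index)
  then have Y0: "Y 0 = x" using Y[of 0] x(1) by (intro eq_matI) auto
  have Y_mem: "mpoly_eval h (entries n (Y s)) f \<in> p" if s: "s \<noteq> 0" for s
  proof (rule singular_specialization[OF h f Y _ _ ab(1,2)])
    show "det (Y s) \<in> p" unfolding Y_def E_def using det_mult[OF x(1), of "transvection n (c s) ?\<delta>"] x(2) by (simp add: mult_mem')
    show "adj_mat (Y s) $$ (i, i) \<in> p" if "i < n" for i
      unfolding adj_Y[OF that that] using x(3)[OF that]
      by (intro mult_mem add_mem) (auto simp: D_def zero_mem intro: mult_mem)
    show "adj_mat (Y s) $$ (a, b) \<notin> p"
      unfolding adj_Y[OF ab(1,2)] using \<open>a \<notin> D\<close> ab(3) E by (simp add: mult_mem_iff)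
    fix i assume i: "i < n"
    show "adj_mat (Y s) $$ (i, b) \<notin> p \<or> adj_mat (Y s) $$ (a, i) \<notin> p"
    proof (cases "i \<in> D")
      case True
      have "h s * adj_mat x $$ (a, b) \<notin> p" using field_hom_notin[OF h s] ab(3) by (simp add: mult_mem_iff)
      then have "adj_mat x $$ (i, b) + h s * adj_mat x $$ (a, b) \<notin> p"
        using True mem_cong[of "adj_mat x $$ (i, b) + h s * adj_mat x $$ (a, b)" "h s * adj_mat x $$ (a, b)"]
        by (simp add: D_def)
      then show ?thesis unfolding adj_Y[OF i ab(2)] using True E by (simp add: mult_mem_iff)
    next
      case False
      then show ?thesis
        unfolding adj_Y[OF i ab(2)] adj_Y[OF ab(1) i] using \<open>a \<notin> D\<close> E by (auto simp: mult_mem_iff D_def)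
    qed
  qed
  have "poly_fun h (\<lambda>s. mpoly_eval h (entries n (Y s)) f)"
    by (intro poly_fun_mpoly_eval poly_fun_entries Y_poly)
  from mem_by_specialization[OF h this Y_mem] show ?thesis by (simp add: Y0)
qed

lemma type_prime_restrict_vars:
  assumes "primeideal p (poly_ring V :: ('a, 'b::comm_ring_1) mpoly ring)"
  shows "type_prime {f. restrict_vars V f \<in> p}"
proof -
  interpret \<phi>: comm_ring_hom "restrict_vars V :: ('a, 'b) mpoly \<Rightarrow> _" by (rule comm_ring_hom_restrict_vars)
  interpret type_ideal "{f. restrict_vars V f \<in> p}"
    by (rule type_ideal_restrict_vars[OF primeideal.axioms(1)[OF assms]])
  show ?thesis
  proof
    have "(1 :: ('a, 'b) mpoly) \<notin> p"
    proof
      assume "(1 :: ('a, 'b) mpoly) \<in> p"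
      then have "carrier (poly_ring V) = p"
        using ideal.one_imp_carrier[OF primeideal.axioms(1)[OF assms]] by (simp add: poly_ring_simps)
      then show False using primeideal.I_notcarr[OF assms] by blast
    qed
    then show "1 \<notin> {f. restrict_vars V f \<in> p}" by (simp add: \<phi>.hom_one)
    fix a b :: "('a, 'b) mpoly" assume "a * b \<in> {f. restrict_vars V f \<in> p}"
    then have "restrict_vars V a * restrict_vars V b \<in> p" by (simp add: \<phi>.hom_mult)
    then show "a \<in> {f. restrict_vars V f \<in> p} \<or> b \<in> {f. restrict_vars V f \<in> p}"
      using primeideal.I_prime[OF assms, of "restrict_vars V a" "restrict_vars V b"]
        indets_restrict_vars[of V a] indets_restrict_vars[of V b]
      unfolding poly_ring_simps by blast
  qed
qed

text \<open>
  The generic matrix modulo \<open>p\<close> is the point to which this is applied. If its determinant is not in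
  \<open>p\<close>, then \<open>p\<close> contains the saturation by definition; otherwise some entry of its adjugate is not
  in \<open>p\<close>, its rank is \<open>n - 1\<close>, and it is a limit of invertible points.
\<close>

theorem prime_over_principal_minors:
  fixes p :: "'k::alg_closed_field matrix_poly set"
  assumes n: "2 \<le> n" and p: "primeideal p (matrix_poly_ring n)"
    and P: "principal_minor_ideal n (n - 1) \<subseteq> p"
  shows "determinantal_ideal n (n - 1) \<subseteq> p \<or> saturated_principal_minor_ideal n (n - 1) \<subseteq> p"
proof (cases "determinantal_ideal n (n - 1) \<subseteq> p")
  case False
  let ?V = "{..<n} \<times> {..<n}"
  let ?X = "generic_matrix n :: 'k matrix_poly mat"
  have n0: "0 < n" using n by simp
  define p' where "p' = {f. restrict_vars ?V f \<in> p}"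
  interpret p': type_prime p'
    unfolding p'_def using p type_prime_restrict_vars unfolding matrix_poly_ring_def by blast
  have p'_iff: "g \<in> p' \<longleftrightarrow> g \<in> p" if "indets g \<subseteq> ?V" for g
    using restrict_vars_id[OF that] by (simp add: p'_def)
  have diag: "adj_mat ?X $$ (i, i) \<in> p'" if "i < n" for i
    unfolding p'_iff[OF indets_adj_generic_matrix[OF that that]]
    using P adj_diag_mem_principal_minor_ideal[OF that] by blast
  obtain a b where ab: "a < n" "b < n" "adj_mat ?X $$ (a, b) \<notin> p"
    using determinantal_ideal_subset[OF primeideal.axioms(1)[OF p] n0] False by blast
  then have ab': "adj_mat ?X $$ (a, b) \<notin> p'" using p'_iff indets_adj_generic_matrix by blast
  have "saturated_principal_minor_ideal n (n - 1) \<subseteq> p"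
  proof
    fix f :: "'k matrix_poly" assume "f \<in> saturated_principal_minor_ideal n (n - 1)"
    then obtain k where f: "indets f \<subseteq> ?V" "det ?X ^ k * f \<in> principal_minor_ideal n (n - 1)"
      by (auto simp: saturated_principal_minor_ideal_def saturation_def matrix_poly_ring_def
          nat_pow_poly_ring poly_ring_simps)
    have gen: "mpoly_eval Const (entries n y) f \<in> p'"
      if y: "y \<in> carrier_mat n n" "det y \<notin> p'" "\<And>i. i < n \<Longrightarrow> adj_mat y $$ (i, i) \<in> p'" for y
    proof -
      interpret e: comm_ring_hom "mpoly_eval Const (entries n y)"
        by (rule comm_ring_hom.comm_ring_hom_mpoly_eval[OF comm_ring_hom_Const])
      have "mpoly_eval Const (entries n y) (det ?X ^ k * f) \<in> p'"
        by (rule principal_minor_ideal_eval_mem[OF comm_ring_hom_Const p'.type_ideal_axioms y(1) n0 y(3) f(2)])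
      then have "det y ^ k * mpoly_eval Const (entries n y) f \<in> p'"
        unfolding e.hom_mult e.hom_power eval_det_generic_matrix[OF comm_ring_hom_Const y(1)] .
      then show ?thesis using p'.power_mem[of "det y" k] y(2) p'.mult_mem_iff by blast
    qed
    have "mpoly_eval Const (entries n ?X) f \<in> p'"
    proof (cases "det ?X \<in> p'")
      case True
      show ?thesis
        by (rule p'.singular_specialization'[OF comm_ring_hom_Const gen generic_matrix_carrier True diag ab(1,2) ab'])
    next
      case False
      show ?thesis by (rule gen[OF generic_matrix_carrier False diag])
    qed
    also have "mpoly_eval Const (entries n ?X) f = mpoly_eval Const Var f"
      using f(1) by (intro mpoly_eval_cong) (auto simp: entries_def generic_matrix_def)
    finally show "f \<in> p" using p'_iff[OF f(1)] by simp
  qed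
  then show ?thesis ..
qed simp

section \<open>The two primes are incomparable\<close>

lemma primeideal_mult_mem:
  assumes "primeideal J (poly_ring V :: ('x, 'k::comm_ring_1) mpoly ring)"
    and "a * b \<in> J" "indets a \<subseteq> V" "indets b \<subseteq> V"
  shows "a \<in> J \<or> b \<in> J"
  using primeideal.I_prime[OF assms(1), of a b] assms(2-4) by (simp add: poly_ring_simps)

lemma adj_entry_notin_zero_diag_inverse_ideal:
  assumes "2 \<le> n" "D \<subseteq> {..<n}" "a < n" "b < n" "a = b \<longrightarrow> a \<notin> D"
  shows "adj_mat (generic_matrix n :: 'k::alg_closed_field matrix_poly mat) $$ (a, b) \<notin> zero_diag_inverse_ideal n D"
proof
  assume mem: "adj_mat (generic_matrix n :: 'k matrix_poly mat) $$ (a, b) \<in> zero_diag_inverse_ideal n D"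
  obtain A :: "'k mat" where A: "A \<in> carrier_mat n n" "det A \<noteq> 0" "A $$ (a, b) \<noteq> 0"
    "\<forall>i<n. (i, i) \<noteq> (a, b) \<longrightarrow> A $$ (i, i) = 0"
    using ex_invertible_one_entry[OF assms(1,3,4)] by blast
  have zero: "A $$ (i, i) = 0" if "i \<in> D" for i
    using A(4) that assms(2,5) by auto
  let ?x = "1 \<cdot>\<^sub>m adj_mat A"
  have x: "?x \<in> zero_diag_inverse n D" by (rule smult_adj_mat_mem(1)[OF A(1,2) zero assms(2)]) simp_all
  note X = zero_diag_inverseE[OF x]
  have "adj_mat ?x $$ (a, b) * (1 * det A) = det ?x * A $$ (a, b)"
    by (rule smult_adj_mat_mem(2)[OF A(1,2) zero assms(2) one_neq_zero assms(3,4)])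
  then have "adj_mat ?x $$ (a, b) \<noteq> 0" using A(2,3) X(2) by auto
  moreover have "eval_at (entries n ?x) (adj_mat (generic_matrix n) $$ (a, b)) = 0"
    using mem x by (simp only: mem_zero_diag_inverse_ideal)
  ultimately show False
    unfolding eval_adj_generic_matrix[OF comm_ring_hom_id X(1) assms(3,4)] by simp
qed

text \<open>
  For distinct \<open>i\<close>, \<open>j\<close> this is, up to sign, the minor of \<open>X\<close> that omits rows \<open>k\<close>, \<open>l\<close> and columns
  \<open>i\<close>, \<open>j\<close>.
\<close>

definition minor2 :: "nat \<Rightarrow> 'a::comm_ring_1 mat \<Rightarrow> nat \<Rightarrow> nat \<Rightarrow> nat \<Rightarrow> nat \<Rightarrow> 'a" where
  "minor2 n X i j k l = adj_mat (replace_col X (unit_vec n k) i) $$ (j, l)"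

lemma replace_col_carrier: "X \<in> carrier_mat n n \<Longrightarrow> replace_col X v i \<in> carrier_mat n n"
  by (auto simp: replace_col_def)

lemma minor2_eq_det:
  assumes "X \<in> carrier_mat n n" "j < n" "l < n"
  shows "minor2 n X i j k l = det (replace_col (replace_col X (unit_vec n k) i) (unit_vec n l) j)"
  unfolding minor2_def by (rule adj_mat_eq_det[OF replace_col_carrier[OF assms(1)] assms(2,3)])

lemma (in comm_ring_hom) hom_minor2:
  assumes "X \<in> carrier_mat n n" "i < n" "j < n" "k < n" "l < n"
  shows "hom (minor2 n X i j k l) = minor2 n (map_mat hom X) i j k l"
proof -
  have "map_mat hom (replace_col X (unit_vec n k) i) = replace_col (map_mat hom X) (unit_vec n k) i"
    using assms by (intro eq_matI) (auto simp: replace_col_def unit_vec_def)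
  then show ?thesis
    unfolding minor2_def hom_adj_mat[OF replace_col_carrier[OF assms(1)] assms(3,5)] by simp
qed

lemma indets_minor2:
  assumes "i < n" "j < n" "k < n" "l < n"
  shows "indets (minor2 n (generic_matrix n :: 'k::comm_ring_1 matrix_poly mat) i j k l) \<subseteq> {..<n} \<times> {..<n}"
  unfolding minor2_eq_det[OF generic_matrix_carrier assms(2,4)]
  by (rule indets_det[of _ n])
    (use assms in \<open>auto simp: replace_col_def generic_matrix_def unit_vec_def\<close>)

text \<open>
  If the inverse of \<open>X\<close> has zero diagonal, then two of its two-rowed minors that share an index are
  monomials in its entries, and Jacobi's identity turns both products into the same monomial, the one
  of the cycle \<open>0 \<rightarrow> 1 \<rightarrow> 2 \<rightarrow> 3 \<rightarrow> 0\<close>, up to the same power of the determinant.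
\<close>

definition cyclic_binomial :: "nat \<Rightarrow> 'a::comm_ring_1 mat \<Rightarrow> 'a" where
  "cyclic_binomial n X = minor2 n X 0 1 1 2 * minor2 n X 2 3 3 0 - minor2 n X 1 2 2 3 * minor2 n X 3 0 0 1"

lemma (in comm_ring_hom) hom_cyclic_binomial:
  assumes "X \<in> carrier_mat n n" "4 \<le> n"
  shows "hom (cyclic_binomial n X) = cyclic_binomial n (map_mat hom X)"
  unfolding cyclic_binomial_def hom_minus hom_mult using assms by (simp add: hom_minor2)

lemma indets_cyclic_binomial:
  assumes "4 \<le> n"
  shows "indets (cyclic_binomial n (generic_matrix n :: 'k::comm_ring_1 matrix_poly mat)) \<subseteq> {..<n} \<times> {..<n}"
proof -
  have m: "indets (minor2 n (generic_matrix n :: 'k matrix_poly mat) i j k l) \<subseteq> {..<n} \<times> {..<n}"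
    if "i < 4" "j < 4" "k < 4" "l < 4" for i j k l
    using that assms by (intro indets_minor2) auto
  show ?thesis
    unfolding cyclic_binomial_def
    by (intro order.trans[OF indets_diff] order.trans[OF indets_mult] Un_least m) simp_all
qed

text \<open>
  Jacobi's identity is at hand with an extra factor only; these factors are entries of the adjugate
  outside the prime ideal, which cancels them.
\<close>

lemma cyclic_binomial_mem:
  assumes n: "4 \<le> n"
  shows "cyclic_binomial n (generic_matrix n) \<in> (zero_diag_inverse_ideal n {..<n} :: 'k::alg_closed_field matrix_poly set)"
proof -
  let ?V = "{..<n} \<times> {..<n}"
  let ?X = "generic_matrix n :: 'k matrix_poly mat"
  let ?Q = "zero_diag_inverse_ideal n {..<n} :: 'k matrix_poly set"
  let ?y = "\<lambda>i j. adj_mat ?X $$ (i, j)"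
  have Q: "primeideal ?Q (poly_ring ?V)"
    using primeideal_zero_diag_inverse_ideal[of "{..<n}" n] n unfolding matrix_poly_ring_def by simp
  have y: "indets (?y i j) \<subseteq> ?V" "i \<noteq> j \<Longrightarrow> ?y i j \<notin> ?Q" if "i < 4" "j < 4" for i j
  proof -
    show "indets (?y i j) \<subseteq> ?V" using that n by (intro indets_adj_generic_matrix) auto
    show "i \<noteq> j \<Longrightarrow> ?y i j \<notin> ?Q"
      using that n by (intro adj_entry_notin_zero_diag_inverse_ideal) auto
  qed
  have ind: "indets (cyclic_binomial n ?X) \<subseteq> ?V" by (rule indets_cyclic_binomial[OF n])
  have drop: "g \<in> ?Q" if "i < 4" "j < 4" "i \<noteq> j" "indets g \<subseteq> ?V" "?y i j * g \<in> ?Q" for i j g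
    using primeideal_mult_mem[OF Q that(5) y(1)[OF that(1,2)] that(4)] y(2)[OF that(1-3)] by blast
  have ind1: "indets (?y 3 0 * cyclic_binomial n ?X) \<subseteq> ?V"
    by (intro order.trans[OF indets_mult] Un_least y(1) ind) simp_all
  have ind2: "indets (?y 2 3 * (?y 3 0 * cyclic_binomial n ?X)) \<subseteq> ?V"
    by (intro order.trans[OF indets_mult] Un_least y(1) ind) simp_all
  have ind3: "indets (?y 1 2 * (?y 2 3 * (?y 3 0 * cyclic_binomial n ?X))) \<subseteq> ?V"
    by (intro order.trans[OF indets_mult] Un_least y(1) ind) simp_all
  have "?y 0 1 * (?y 1 2 * (?y 2 3 * (?y 3 0 * cyclic_binomial n ?X))) \<in> ?Q"
    unfolding mem_zero_diag_inverse_ideal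
  proof (intro conjI ballI)
    show "indets (?y 0 1 * (?y 1 2 * (?y 2 3 * (?y 3 0 * cyclic_binomial n ?X)))) \<subseteq> ?V"
      by (intro order.trans[OF indets_mult] Un_least y(1) ind) simp_all
    fix x :: "'k mat" assume "x \<in> zero_diag_inverse n {..<n}"
    note x = zero_diag_inverseE[OF this]
    let ?e = "eval_at (entries n x)"
    interpret e: comm_ring_hom ?e by (rule comm_ring_hom_eval_point)
    define z where "z i j = adj_mat x $$ (i, j)" for i j
    have zero: "z i i = 0" if "i < 4" for i using x(5)[of i] that n by (simp add: z_def)
    have ez: "?e (?y i j) = z i j" if "i < 4" "j < 4" for i j
      unfolding z_def using that n by (intro eval_adj_generic_matrix comm_ring_hom_id x(1)) simp_all
    have eb: "?e (cyclic_binomial n ?X) = cyclic_binomial n x"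
      unfolding e.hom_cyclic_binomial[OF generic_matrix_carrier n] eval_generic_matrix[OF comm_ring_hom_id x(1)] ..
    have jac: "z a b = 0 \<or> z a b * z j l - z a l * z j b = det x * minor2 n x a j b l"
      if "a < 4" "b < 4" "j < 4" "l < 4" "j \<noteq> a" for a b j l
      using adj_mat_two_minor[OF x(1), of a b j l] that n by (simp add: z_def minor2_def)
    have "z 0 1 * (z 1 2 * (z 2 3 * (z 3 0 * cyclic_binomial n x))) = 0"
    proof (cases "z 0 1 = 0 \<or> z 1 2 = 0 \<or> z 2 3 = 0 \<or> z 3 0 = 0")
      case False
      have m: "z 0 1 * z 1 2 = det x * minor2 n x 0 1 1 2" "z 2 3 * z 3 0 = det x * minor2 n x 2 3 3 0"
        "z 1 2 * z 2 3 = det x * minor2 n x 1 2 2 3" "z 3 0 * z 0 1 = det x * minor2 n x 3 0 0 1"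
        using jac[of 0 1 1 2] jac[of 2 3 3 0] jac[of 1 2 2 3] jac[of 3 0 0 1] False zero by simp_all
      have "det x * det x * cyclic_binomial n x =
          (det x * minor2 n x 0 1 1 2) * (det x * minor2 n x 2 3 3 0) -
          (det x * minor2 n x 1 2 2 3) * (det x * minor2 n x 3 0 0 1)"
        by (simp add: cyclic_binomial_def algebra_simps)
      also have "\<dots> = 0" unfolding m[symmetric] by simp
      finally show ?thesis using x(2) by simp
    qed auto
    then show "?e (?y 0 1 * (?y 1 2 * (?y 2 3 * (?y 3 0 * cyclic_binomial n ?X)))) = 0"
      by (simp only: e.hom_mult eb ez zero_less_numeral one_less_numeral_iff semiring_norm numeral_less_iff)
  qed
  from drop[OF _ _ _ ind3 this] have "?y 1 2 * (?y 2 3 * (?y 3 0 * cyclic_binomial n ?X)) \<in> ?Q" by simp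
  from drop[OF _ _ _ ind2 this] have "?y 2 3 * (?y 3 0 * cyclic_binomial n ?X) \<in> ?Q" by simp
  from drop[OF _ _ _ ind1 this] have "?y 3 0 * cyclic_binomial n ?X \<in> ?Q" by simp
  from drop[OF _ _ _ ind this] show ?thesis by simp
qed

text \<open>
  On matrices of rank \<open>n - 2\<close> the minors factor through the row and the column space, and the two
  products involve different index pairs; an explicit matrix, with a block of four rows and columns
  of rank two, separates them.
\<close>

definition block4 :: "nat \<Rightarrow> (nat \<Rightarrow> nat \<Rightarrow> 'a) \<Rightarrow> 'a::comm_ring_1 mat" where
  "block4 n m = mat n n (\<lambda>(i, j). if i < 4 \<and> j < 4 then m i j else if i = j then 1 else 0)"

lemma replace_col_block4:
  assumes "a < 4" "k < 4" "4 \<le> n"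
  shows "replace_col (block4 n m) (unit_vec n k) a = block4 n (\<lambda>i j. if j = a then (if i = k then 1 else 0) else m i j)"
  using assms by (intro eq_matI) (auto simp: replace_col_def block4_def)

lemma less_4: "(i::nat) < 4 \<longleftrightarrow> i = 0 \<or> i = 1 \<or> i = 2 \<or> i = 3"
  by auto

lemma block4_mult_vec:
  assumes "4 \<le> n" "i < n"
  shows "(block4 n m *\<^sub>v vec n v) $ i =
    (if i < 4 then m i 0 * v 0 + m i 1 * v 1 + m i 2 * v 2 + m i 3 * v 3 else v i)"
proof -
  have split: "{0..<n} = {0, 1, 2, 3} \<union> {4..<n}" using assms(1) by auto
  have "(block4 n m *\<^sub>v vec n v) $ i = (\<Sum>j\<in>{0..<n}. block4 n m $$ (i, j) * v j)"
    using assms by (simp add: block4_def scalar_prod_def)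
  also have "\<dots> = (\<Sum>j\<in>{0, 1, 2, 3}. block4 n m $$ (i, j) * v j) + (\<Sum>j\<in>{4..<n}. block4 n m $$ (i, j) * v j)"
    unfolding split by (rule sum.union_disjoint) auto
  also have "(\<Sum>j\<in>{4..<n}. block4 n m $$ (i, j) * v j) = (\<Sum>j\<in>{4..<n}. if j = i then v i else 0)"
    using assms by (intro sum.cong) (auto simp: block4_def)
  finally show ?thesis
    using assms by (auto simp: block4_def algebra_simps)
qed

lemma det_block4_nonzero:
  fixes m :: "nat \<Rightarrow> nat \<Rightarrow> 'k::field"
  assumes n: "4 \<le> n"
    and inj: "\<And>v. (\<And>i. i < 4 \<Longrightarrow> m i 0 * v 0 + m i 1 * v 1 + m i 2 * v 2 + m i 3 * v 3 = 0) \<Longrightarrow>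
      v 0 = 0 \<and> v 1 = 0 \<and> v 2 = 0 \<and> v (3::nat) = 0"
  shows "det (block4 n m) \<noteq> 0"
proof
  assume "det (block4 n m) = 0"
  moreover have "block4 n m \<in> carrier_mat n n" by (simp add: block4_def)
  ultimately obtain v where v: "v \<in> carrier_vec n" "v \<noteq> 0\<^sub>v n" "block4 n m *\<^sub>v v = 0\<^sub>v n"
    using det_0_iff_vec_prod_zero by blast
  have v_eq: "vec n (($) v) = v" using v(1) by (intro eq_vecI) auto
  have eq: "(if i < 4 then m i 0 * v $ 0 + m i 1 * v $ 1 + m i 2 * v $ 2 + m i 3 * v $ 3 else v $ i) = 0"
    if "i < n" for i
    using block4_mult_vec[OF n that, of m "($) v"] v(3) that by (simp add: v_eq)
  then have "v $ 0 = 0 \<and> v $ 1 = 0 \<and> v $ 2 = 0 \<and> v $ 3 = 0"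
    using inj[of "($) v"] n by (metis less_le_trans)
  then have "v $ i = 0" if "i < n" for i
    using eq[OF that] less_4[of i] by (cases "i < 4") auto
  then have "v = 0\<^sub>v n" using v(1) by (intro eq_vecI) auto
  with v(2) show False by blast
qed

lemma cyclic_binomial_notin:
  assumes n: "4 \<le> n"
  shows "cyclic_binomial n (generic_matrix n) \<notin> (determinantal_ideal n (n - 1) :: 'k::alg_closed_field matrix_poly set)"
proof
  assume mem: "cyclic_binomial n (generic_matrix n) \<in> (determinantal_ideal n (n - 1) :: 'k matrix_poly set)"
  define y :: "nat \<Rightarrow> nat \<Rightarrow> 'k" where "y k i = (if k = 0 then (if i = 0 \<or> i = 1 then 1 else 0) else
    if k = 1 then (if i = 2 \<or> i = 3 then 1 else 0) else (if i = k + 2 then 1 else 0))" for k i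
  define z :: "nat \<Rightarrow> nat \<Rightarrow> 'k" where "z k j = (if k = 0 then (if j = 0 \<or> j = 2 then 1 else 0) else
    if k = 1 then (if j = 1 \<or> j = 3 then 1 else 0) else (if j = k + 2 then 1 else 0))" for k j
  define m :: "nat \<Rightarrow> nat \<Rightarrow> 'k" where "m i j = y 0 i * z 0 j + y 1 i * z 1 j" for i j
  let ?x = "block4 n m"
  have x: "?x \<in> carrier_mat n n" by (simp add: block4_def)
  have low: "low_rank_point (n - 2) y z (i, j) = ?x $$ (i, j)" if "i < n" "j < n" for i j
  proof -
    have split: "{..<n - 2} = {0, 1} \<union> {2..<n - 2}" using n by auto
    have "low_rank_point (n - 2) y z (i, j) = (\<Sum>k\<in>{0, 1}. y k i * z k j) + (\<Sum>k\<in>{2..<n - 2}. y k i * z k j)"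
      unfolding low_rank_point_def prod.case split by (rule sum.union_disjoint) auto
    also have "(\<Sum>k\<in>{0, 1}. y k i * z k j) = m i j" by (simp add: m_def)
    also have "(\<Sum>k\<in>{2..<n - 2}. y k i * z k j) = (\<Sum>k\<in>{2..<n - 2}. if i = k + 2 then (if i = j then 1 else 0) else 0)"
    proof (rule sum.cong[OF refl])
      fix k assume "k \<in> {2..<n - 2}"
      then have "y k i = (if i = k + 2 then 1 else 0)" "z k j = (if j = k + 2 then 1 else 0)"
        by (simp_all add: y_def z_def)
      then show "y k i * z k j = (if i = k + 2 then (if i = j then 1 else 0) else 0)" by simp
    qed
    also have "\<dots> = (if 4 \<le> i \<and> i = j then 1 else 0)"
    proof (cases "4 \<le> i")
      case True
      have "(\<Sum>k\<in>{2..<n - 2}. if i = k + 2 then (if i = j then 1 else 0) else 0) =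
          (\<Sum>k\<in>{2..<n - 2}. if k = i - 2 then (if i = j then 1 else 0) else (0::'k))"
      proof (rule sum.cong[OF refl])
        fix k
        have "i = k + 2 \<longleftrightarrow> k = i - 2" using True by arith
        then show "(if i = k + 2 then (if i = j then 1 else 0) else 0) =
            (if k = i - 2 then (if i = j then 1 else 0) else (0::'k))" by simp
      qed
      then show ?thesis using True that by simp linarith
    next
      case False
      then show ?thesis by (intro trans[OF sum.neutral]) auto
    qed
    finally have low: "low_rank_point (n - 2) y z (i, j) = m i j + (if 4 \<le> i \<and> i = j then 1 else 0)" .
    show ?thesis
    proof (cases "i < 4 \<and> j < 4")
      case True
      then show ?thesis using low that by (simp add: block4_def)
    next
      case False
      then have "m i j = 0"
        by (cases "i < 4") (simp_all add: m_def y_def z_def)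
      then show ?thesis using low that False by (auto simp: block4_def)
    qed
  qed
  let ?e = "eval_at (entries n ?x)"
  interpret e: comm_ring_hom ?e by (rule comm_ring_hom_eval_point)
  have "Suc (n - 2) = n - 1" using n by simp
  then have "eval_at (low_rank_point (n - 2) y z) (cyclic_binomial n (generic_matrix n)) = 0"
    using mem mem_determinantal_ideal_iff[of _ n "n - 2"] by metis
  also have "eval_at (low_rank_point (n - 2) y z) (cyclic_binomial n (generic_matrix n)) =
      ?e (cyclic_binomial n (generic_matrix n))"
    using indets_cyclic_binomial[OF n, where 'k = 'k] low
    by (intro mpoly_eval_cong) (auto simp: entries_def)
  also have "\<dots> = cyclic_binomial n ?x"
    unfolding e.hom_cyclic_binomial[OF generic_matrix_carrier n] eval_generic_matrix[OF comm_ring_hom_id x] ..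
  finally have zero: "cyclic_binomial n ?x = 0" .
  let ?c = "\<lambda>i k. if i = k then 1 else (0::'k)"
  have minor2: "minor2 n ?x a j b l = det (block4 n (\<lambda>i c. if c = j then ?c i l else if c = a then ?c i b else m i c))"
    if "a < 4" "j < 4" "b < 4" "l < 4" for a j b l
    using that n by (simp add: minor2_eq_det[OF x] replace_col_block4)
  have "minor2 n ?x 0 1 1 2 = det (block4 n (\<lambda>i c. if c = 1 then ?c i 2 else if c = 0 then ?c i 1 else m i c))"
    by (rule minor2) simp_all
  also have "\<dots> \<noteq> 0"
  proof (rule det_block4_nonzero[OF n], goal_cases)
    case (1 v)
    from 1[of 0] 1[of 1] 1[of 2] 1[of 3] show ?case by (auto simp: m_def y_def z_def)
  qed
  finally have nonzero: "minor2 n ?x 0 1 1 2 \<noteq> 0" .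
  have "minor2 n ?x 2 3 3 0 = det (block4 n (\<lambda>i c. if c = 3 then ?c i 0 else if c = 2 then ?c i 3 else m i c))"
    by (rule minor2) simp_all
  also have "\<dots> \<noteq> 0"
  proof (rule det_block4_nonzero[OF n], goal_cases)
    case (1 v)
    from 1[of 0] 1[of 1] 1[of 2] 1[of 3] show ?case by (auto simp: m_def y_def z_def)
  qed
  finally have nonzero': "minor2 n ?x 2 3 3 0 \<noteq> 0" .
  have "minor2 n ?x 1 2 2 3 = 0"
  proof -
    let ?N = "block4 n (\<lambda>i c. if c = 2 then ?c i 3 else if c = 1 then ?c i 2 else m i c)"
    let ?v = "\<lambda>i. if i = 1 \<or> i = 2 then 1 else if i = 3 then -1 else (0::'k)"
    have N: "?N \<in> carrier_mat n n" by (simp add: block4_def)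
    have "?N *\<^sub>v vec n ?v = 0\<^sub>v n"
    proof (rule eq_vecI)
      fix i assume "i < dim_vec (0\<^sub>v n)"
      then have i: "i < n" by simp
      show "(?N *\<^sub>v vec n ?v) $ i = 0\<^sub>v n $ i"
        unfolding block4_mult_vec[OF n i] using i less_4[of i] by (auto simp: m_def y_def z_def)
    qed (simp add: block4_def)
    moreover have "vec n ?v \<noteq> 0\<^sub>v n"
    proof
      assume "vec n ?v = 0\<^sub>v n"
      then have "vec n ?v $ 1 = 0\<^sub>v n $ 1" by simp
      then show False using n by simp
    qed
    moreover have "vec n ?v \<in> carrier_vec n" by simp
    ultimately have "\<exists>v. v \<in> carrier_vec n \<and> v \<noteq> 0\<^sub>v n \<and> ?N *\<^sub>v v = 0\<^sub>v n" by blast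
    then have "det ?N = 0" by (rule det_0_iff_vec_prod_zero[OF N, THEN iffD2])
    moreover have "minor2 n ?x 1 2 2 3 = det ?N" by (rule minor2) simp_all
    ultimately show ?thesis by simp
  qed
  then show False using zero nonzero nonzero' by (simp add: cyclic_binomial_def)
qed

theorem incomparable:
  assumes n: "4 \<le> n"
  shows "\<not> determinantal_ideal n (n - 1) \<subseteq> (zero_diag_inverse_ideal n {..<n} :: 'k::alg_closed_field matrix_poly set)"
    and "\<not> zero_diag_inverse_ideal n {..<n} \<subseteq> (determinantal_ideal n (n - 1) :: 'k matrix_poly set)"
proof -
  show "\<not> zero_diag_inverse_ideal n {..<n} \<subseteq> (determinantal_ideal n (n - 1) :: 'k matrix_poly set)"
    using cyclic_binomial_mem[OF n] cyclic_binomial_notin[OF n] by blast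
  have "adj_mat (generic_matrix n) $$ (0, 1) \<in> (determinantal_ideal n (n - 1) :: 'k matrix_poly set)"
    using n by (intro adj_mat_mem_determinantal_ideal) auto
  moreover have "adj_mat (generic_matrix n) $$ (0, 1) \<notin> (zero_diag_inverse_ideal n {..<n} :: 'k matrix_poly set)"
    using n by (intro adj_entry_notin_zero_diag_inverse_ideal) auto
  ultimately show "\<not> determinantal_ideal n (n - 1) \<subseteq> (zero_diag_inverse_ideal n {..<n} :: 'k matrix_poly set)"
    by blast
qed

section \<open>Lengths of chains of primes\<close>

text \<open>
  Families of \<open>d\<close> polynomials that are algebraically independent in the residue ring of \<open>p\<close>; the
  largest such \<open>d\<close> is the dimension of the corresponding variety.
\<close>

definition alg_indep_mod :: "('x, 'k::comm_ring_1) mpoly set \<Rightarrow> (nat \<Rightarrow> ('x, 'k) mpoly) \<Rightarrow> nat \<Rightarrow> bool" where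
  "alg_indep_mod p y d \<longleftrightarrow>
     (\<forall>F. indets F \<subseteq> {..<d} \<longrightarrow> mpoly_eval Const y F \<in> p \<longrightarrow> F = 0)"

text \<open>
  Passing to a smaller prime adds an independent element: in a relation of least degree in an element
  \<open>g\<close> of the difference, the part without \<open>g\<close> is a relation modulo the larger prime, hence zero, and
  the rest can be divided by \<open>g\<close>.
\<close>

lemma alg_indep_mod_extend:
  fixes p p' :: "('x, 'k::comm_ring_1) mpoly set"
  assumes p: "primeideal p (poly_ring V)" and p': "ideal p' (poly_ring V)" "p \<subseteq> p'"
    and g: "g \<in> p'" "g \<notin> p"
    and y: "\<And>i. i < d \<Longrightarrow> indets (y i) \<subseteq> V" "alg_indep_mod p' y d"
  shows "alg_indep_mod p (y(d := g)) (Suc d)"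
proof -
  let ?y = "y(d := g)"
  have gV: "indets g \<subseteq> V" using poly_ideal_closed(4)[OF p'(1)] g(1) by blast
  have yV: "indets (?y i) \<subseteq> V" if "i < Suc d" for i using that gV y(1) by (auto simp: less_Suc_eq)
  interpret e: comm_ring_hom "mpoly_eval (Const :: 'k \<Rightarrow> ('x, 'k) mpoly) ?y"
    by (rule comm_ring_hom.comm_ring_hom_mpoly_eval[OF comm_ring_hom_Const])
  have eV: "indets (mpoly_eval Const ?y F) \<subseteq> V" if "indets F \<subseteq> {..<Suc d}" for F :: "(nat, 'k) mpoly"
    using that by (intro indets_mpoly_eval_Const yV) auto
  have "F = 0" if "indets F \<subseteq> {..<Suc d}" "mpoly_eval Const ?y F \<in> p"
    "\<And>m. m \<in> keys F \<Longrightarrow> lookup m d < N" for F N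
    using that
  proof (induction N arbitrary: F)
    case 0
    show ?case
    proof (rule poly_mapping_eqI)
      fix m show "lookup F m = lookup 0 m"
        using "0.prems"(3)[of m] by (auto simp: in_keys_iff)
    qed
  next
    case (Suc N)
    let ?s = "\<lambda>m. single m (lookup F m)"
    let ?x = "single d (1::nat)"
    define K0 where "K0 = {m \<in> keys F. lookup m d = 0}"
    define F0 where "F0 = (\<Sum>m\<in>K0. ?s m)"
    define F1 where "F1 = (\<Sum>m\<in>keys F - K0. single (m - ?x) (lookup F m))"
    have keyF: "keys m \<subseteq> {..<Suc d}" if "m \<in> keys F" for m
      using Suc.prems(1) that by (auto simp: indets_def)
    have "K0 \<subseteq> keys F" by (auto simp: K0_def)
    have "?s m = Var d * single (m - ?x) (lookup F m)"
      if "m \<in> keys F - K0" for m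
    proof -
      have "0 < lookup m d" using that by (auto simp: K0_def)
      then have "?x + (m - ?x) = m"
        by (intro poly_mapping_eqI) (auto simp: lookup_add lookup_minus lookup_single when_def)
      then show ?thesis by (simp add: Var_def mult_single)
    qed
    then have "Var d * F1 = (\<Sum>m\<in>keys F - K0. ?s m)"
      unfolding F1_def sum_distrib_left by (intro sum.cong) simp_all
    moreover have "F = (\<Sum>m\<in>keys F - K0. ?s m) + (\<Sum>m\<in>K0. ?s m)"
      using poly_mapping_sum_monomials[of F] sum.subset_diff[OF \<open>K0 \<subseteq> keys F\<close>, of ?s] by simp
    ultimately have F: "F = F0 + Var d * F1" by (simp add: F0_def add.commute)
    have F0_ind: "indets F0 \<subseteq> {..<d}"
    proof -
      have "keys m \<subseteq> {..<d}" if "m \<in> K0" for m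
      proof -
        have "d \<notin> keys m" using that by (simp add: K0_def in_keys_iff)
        then show ?thesis using keyF[of m] that by (force simp: K0_def less_Suc_eq)
      qed
      then show ?thesis
        unfolding F0_def by (intro order.trans[OF indets_sum] UN_least order.trans[OF indets_single])
    qed
    have F1_keys: "\<exists>m'\<in>keys F. m = m' - ?x \<and> 0 < lookup m' d"
      if "m \<in> keys F1" for m
    proof -
      have "m \<in> (\<Union>m'\<in>keys F - K0. keys (single (m' - ?x) (lookup F m')))"
        using that unfolding F1_def by (rule subsetD[OF keys_sum_subset])
      then obtain m' where "m' \<in> keys F - K0" "m = m' - ?x" by (auto split: if_splits)
      then show ?thesis by (intro bexI[of _ m']) (auto simp: K0_def)
    qed
    have F1_ind: "indets F1 \<subseteq> {..<Suc d}"
    proof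
      fix i assume "i \<in> indets F1"
      then obtain m where "m \<in> keys F1" "i \<in> keys m" by (auto simp: indets_def)
      then obtain m' where "m' \<in> keys F" "i \<in> keys (m' - ?x)" using F1_keys by blast
      then have "i \<in> keys m'" by (auto simp: in_keys_iff lookup_minus)
      then show "i \<in> {..<Suc d}" using keyF \<open>m' \<in> keys F\<close> by blast
    qed
    have eF: "mpoly_eval Const ?y F = mpoly_eval Const ?y F0 + g * mpoly_eval Const ?y F1"
      unfolding F e.hom_add e.hom_mult comm_ring_hom.mpoly_eval_Var[OF comm_ring_hom_Const] by simp
    have "g * mpoly_eval Const ?y F1 \<in> p'"
      using poly_ideal_closed(3)[OF p'(1) g(1) eV[OF F1_ind]] by (simp add: mult.commute)
    moreover have "mpoly_eval Const ?y F \<in> p'" using Suc.prems(2) p'(2) by blast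
    ultimately have "mpoly_eval Const ?y F - g * mpoly_eval Const ?y F1 \<in> p'"
      by (intro poly_ideal_closed(6)[OF p'(1)])
    then have "mpoly_eval Const ?y F0 \<in> p'" by (simp add: eF)
    also have "mpoly_eval Const ?y F0 = mpoly_eval Const y F0"
      using F0_ind by (intro mpoly_eval_cong) auto
    finally have "F0 = 0" using y(2) F0_ind by (simp add: alg_indep_mod_def)
    have "mpoly_eval Const ?y F = g * mpoly_eval Const ?y F1"
      unfolding eF \<open>F0 = 0\<close> by (simp only: e.hom_zero add_0)
    then have "g * mpoly_eval Const ?y F1 \<in> p" using Suc.prems(2) by (simp only:)
    then have "mpoly_eval Const ?y F1 \<in> p"
      using primeideal_mult_mem[OF p _ gV eV[OF F1_ind]] g(2) by blast
    moreover have "lookup m d < N" if m: "m \<in> keys F1" for m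
    proof -
      obtain m' where m': "m' \<in> keys F" "m = m' - ?x" "0 < lookup m' d"
        using F1_keys[OF m] by blast
      then show ?thesis using Suc.prems(3)[OF m'(1)] by (simp add: lookup_minus)
    qed
    ultimately have "F1 = 0" by (intro Suc.IH F1_ind)
    then show ?case using F \<open>F0 = 0\<close> by simp
  qed
  then show ?thesis
    unfolding alg_indep_mod_def
  proof (intro allI impI)
    fix F :: "(nat, 'k) mpoly"
    assume F: "indets F \<subseteq> {..<Suc d}" "mpoly_eval Const ?y F \<in> p"
    have "lookup m d < Suc (Max ((\<lambda>m. lookup m d) ` keys F))"
      if "m \<in> keys F" for m
      unfolding less_Suc_eq_le by (rule Max_ge) (use that in simp_all)
    with F show "F = 0" using \<open>\<And>N F. indets F \<subseteq> {..<Suc d} \<Longrightarrow> mpoly_eval Const ?y F \<in> p \<Longrightarrow>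
      (\<And>m. m \<in> keys F \<Longrightarrow> lookup m d < N) \<Longrightarrow> F = 0\<close> by blast
  qed
qed

lemma nontrivial_linear_relation:
  fixes c :: "'a \<Rightarrow> 'b \<Rightarrow> 'k::field"
  assumes "finite A" "finite M" "card M < card A"
  shows "\<exists>x. (\<exists>a\<in>A. x a \<noteq> 0) \<and> (\<forall>m\<in>M. (\<Sum>a\<in>A. x a * c a m) = 0)"
proof -
  let ?a = "card A"
  obtain f where f: "bij_betw f {..<?a} A" using ex_bij_betw_nat_finite[OF assms(1)] by (auto simp: lessThan_atLeast0)
  obtain g where g: "bij_betw g {..<card M} M" using ex_bij_betw_nat_finite[OF assms(2)] by (auto simp: lessThan_atLeast0)
  define T where "T = mat ?a ?a (\<lambda>(i, j). if i < card M then c (f j) (g i) else 0)"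
  have T: "T \<in> carrier_mat ?a ?a" by (simp add: T_def)
  have "det T = (\<Sum>j<?a. T $$ (?a - 1, j) * cofactor T (?a - 1) j)"
    using assms(3) by (intro laplace_expansion_row[OF T]) simp
  also have "\<dots> = 0" using assms(3) by (intro sum.neutral) (auto simp: T_def)
  finally obtain v where v: "v \<in> carrier_vec ?a" "v \<noteq> 0\<^sub>v ?a" "T *\<^sub>v v = 0\<^sub>v ?a"
    using det_0_iff_vec_prod_zero[OF T] by blast
  define x where "x a = v $ (inv_into {..<?a} f a)" for a
  have xf: "x (f j) = v $ j" if "j < ?a" for j
    using bij_betw_inv_into_left[OF f, of j] that by (simp add: x_def)
  have "\<exists>j<?a. v $ j \<noteq> 0"
  proof (rule ccontr)
    assume "\<not> ?thesis"
    then have "v = 0\<^sub>v ?a" using v(1) by (intro eq_vecI) auto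
    with v(2) show False by blast
  qed
  then obtain j where "j < ?a" "x (f j) \<noteq> 0" using xf by auto
  then have "\<exists>a\<in>A. x a \<noteq> 0" using bij_betwE[OF f] by blast
  moreover have "(\<Sum>a\<in>A. x a * c a m) = 0" if m: "m \<in> M" for m
  proof -
    obtain i where i: "i < card M" "m = g i" using m bij_betw_imp_surj_on[OF g] by auto
    have "(\<Sum>a\<in>A. x a * c a m) = (\<Sum>j<?a. x (f j) * c (f j) m)"
      by (rule sum.reindex_bij_betw[OF f, symmetric])
    also have "\<dots> = (\<Sum>j<?a. T $$ (i, j) * v $ j)"
      using i assms(3) xf by (intro sum.cong) (auto simp: T_def mult.commute)
    also have "\<dots> = (T *\<^sub>v v) $ i"
      using i assms(3) v(1) T by (simp add: scalar_prod_def lessThan_atLeast0)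
    finally show ?thesis using v(3) i assms(3) by simp
  qed
  ultimately show ?thesis by blast
qed

definition box :: "'x set \<Rightarrow> nat \<Rightarrow> ('x \<Rightarrow>\<^sub>0 nat) set" where
  "box V E = {m. keys m \<subseteq> V \<and> (\<forall>x\<in>V. lookup m x < E)}"

lemma box_finite_card:
  assumes "finite V"
  shows "finite (box V E)" "card (box V E) = E ^ card V"
proof -
  let ?f = "\<lambda>m. restrict (lookup m) V"
  have inj: "inj_on ?f (box V E)"
  proof (rule inj_onI, rule poly_mapping_eqI)
    fix m m' x assume m: "m \<in> box V E" "m' \<in> box V E" "?f m = ?f m'"
    show "lookup m x = lookup m' x"
    proof (cases "x \<in> V")
      case True
      then show ?thesis using fun_cong[OF m(3), of x] by simp
    next
      case False
      then have "x \<notin> keys m" "x \<notin> keys m'" using m by (auto simp: box_def)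
      then show ?thesis by (simp add: in_keys_iff)
    qed
  qed
  have img: "?f ` box V E = V \<rightarrow>\<^sub>E {..<E}"
  proof
    show "?f ` box V E \<subseteq> V \<rightarrow>\<^sub>E {..<E}" by (auto simp: box_def)
    show "V \<rightarrow>\<^sub>E {..<E} \<subseteq> ?f ` box V E"
    proof
      fix e assume e: "e \<in> V \<rightarrow>\<^sub>E {..<E}"
      define m where "m = Abs_poly_mapping (\<lambda>x. if x \<in> V then e x else 0)"
      have "finite {x. (if x \<in> V then e x else 0) \<noteq> 0}"
        using assms by (rule finite_subset[rotated]) auto
      then have m: "lookup m x = (if x \<in> V then e x else 0)" for x
        unfolding m_def by (simp add: Abs_poly_mapping_inverse)
      have "m \<in> box V E" using e by (auto simp: box_def m in_keys_iff split: if_splits)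
      moreover have "e = ?f m" using e by (auto simp: m fun_eq_iff restrict_def PiE_def extensional_def)
      ultimately show "e \<in> ?f ` box V E" by blast
    qed
  qed
  have "finite (?f ` box V E)" unfolding img using assms by (intro finite_PiE) auto
  then show "finite (box V E)" using inj by (rule finite_imageD)
  have "card (?f ` box V E) = E ^ card V"
    unfolding img using assms by (simp add: card_PiE)
  then show "card (box V E) = E ^ card V" using card_image[OF inj] by simp
qed

definition exponents_le :: "nat \<Rightarrow> ('x, 'k::comm_ring_1) mpoly \<Rightarrow> bool" where
  "exponents_le c f \<longleftrightarrow> (\<forall>m\<in>keys f. \<forall>x. lookup m x \<le> c)"

lemma exponents_le_mult:
  assumes "exponents_le a f" "exponents_le b g" shows "exponents_le (a + b) (f * g)"
  unfolding exponents_le_def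
proof (intro ballI allI)
  fix m x assume "m \<in> keys (f * g)"
  then have "m \<in> {a + b | a b. a \<in> keys f \<and> b \<in> keys g}"
    by (rule subsetD[OF Poly_Mapping.keys_mult])
  then obtain m1 m2 where "m = m1 + m2" "m1 \<in> keys f" "m2 \<in> keys g" by blast
  then show "lookup m x \<le> a + b"
    using assms by (auto simp: exponents_le_def lookup_add intro: add_mono)
qed

lemma exponents_le_1: "exponents_le 0 (1 :: ('x, 'k::comm_ring_1) mpoly)"
  by (auto simp: exponents_le_def single_one[symmetric] simp del: single_one split: if_splits)

lemma exponents_le_prod:
  "(\<And>i. i \<in> I \<Longrightarrow> exponents_le (a i) (f i)) \<Longrightarrow> exponents_le (\<Sum>i\<in>I. a i) (\<Prod>i\<in>I. f i)"
  by (induction I rule: infinite_finite_induct) (auto intro: exponents_le_mult exponents_le_1)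

lemma exponents_le_mono: "exponents_le a f \<Longrightarrow> a \<le> b \<Longrightarrow> exponents_le b f"
  by (auto simp: exponents_le_def intro: le_trans)

text \<open>
  A polynomial ring in \<open>N\<close> indeterminates contains at most \<open>N\<close> independent elements: there are more
  products of \<open>d > N\<close> given elements with exponents below \<open>E\<close>, namely \<open>E ^ d\<close>, than monomials in
  which these products can be written, whose number grows like \<open>E ^ N\<close>.
\<close>

lemma alg_indep_mod_le_card:
  fixes p :: "('x, 'k::field) mpoly set"
  assumes V: "finite V" and y: "\<And>i. i < d \<Longrightarrow> indets (y i) \<subseteq> V" and "0 \<in> p" and indep: "alg_indep_mod p y d"
  shows "d \<le> card V"
proof (rule ccontr)
  let ?N = "card V"
  assume "\<not> d \<le> ?N"
  then have "Suc ?N \<le> d" by simp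
  define c where "c = Max (insert 0 {lookup m x | m x i. i < d \<and> m \<in> keys (y i) \<and> x \<in> V})"
  have "{lookup m x | m x i. i < d \<and> m \<in> keys (y i) \<and> x \<in> V} =
      (\<Union>i\<in>{..<d}. \<Union>m\<in>keys (y i). lookup m ` V)" by auto
  then have fin: "finite {lookup m x | m x i. i < d \<and> m \<in> keys (y i) \<and> x \<in> V}"
    using V by simp
  have yc: "exponents_le c (y i)" if i: "i < d" for i
    unfolding exponents_le_def
  proof (intro ballI allI)
    fix m x assume m: "m \<in> keys (y i)"
    show "lookup m x \<le> c"
    proof (cases "x \<in> V")
      case True
      then show ?thesis unfolding c_def using fin i m by (intro Max_ge) auto
    next
      case False
      then have "x \<notin> keys m" using y[OF i] m by (auto simp: indets_def)
      then show ?thesis by (simp add: in_keys_iff)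
    qed
  qed
  define E where "E = Suc ((d * c + 1) ^ ?N)"
  let ?A = "box {..<d} E" and ?M = "box V ((d * c + 1) * E)"
  have keys_M: "keys (monom_eval y a) \<subseteq> ?M" if a: "a \<in> ?A" for a
  proof
    fix m assume m: "m \<in> keys (monom_eval y a)"
    have ak: "keys a \<subseteq> {..<d}" and aE: "\<And>i. i < d \<Longrightarrow> lookup a i < E"
      using a by (auto simp: box_def)
    have "exponents_le (\<Sum>i\<in>keys a. \<Sum>k<lookup a i. c) (\<Prod>i\<in>keys a. \<Prod>k<lookup a i. y i)"
      using ak yc by (intro exponents_le_prod) auto
    then have "exponents_le (\<Sum>i\<in>keys a. lookup a i * c) (monom_eval y a)"
      by (simp add: monom_eval_def)
    moreover have "(\<Sum>i\<in>keys a. lookup a i * c) \<le> d * c * E"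
    proof -
      have "(\<Sum>i\<in>keys a. lookup a i * c) \<le> (\<Sum>i\<in>keys a. E * c)"
        using aE ak by (intro sum_mono mult_right_mono) (auto intro: less_imp_le)
      also have "\<dots> = card (keys a) * (E * c)" by simp
      also have "\<dots> \<le> d * (E * c)"
        using card_mono[OF _ ak] by (intro mult_right_mono) auto
      finally show ?thesis by (simp add: ac_simps)
    qed
    ultimately have "exponents_le (d * c * E) (monom_eval y a)" by (rule exponents_le_mono)
    then have "lookup m x \<le> d * c * E" for x using m by (simp add: exponents_le_def)
    moreover have "d * c * E < (d * c + 1) * E" by (simp add: E_def)
    ultimately have "lookup m x < (d * c + 1) * E" for x using le_less_trans by blast
    moreover have "indets (monom_eval y a) \<subseteq> V"
      unfolding monom_eval_def using y ak
      by (intro order.trans[OF indets_prod] UN_least order.trans[OF indets_power]) auto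
    ultimately show "m \<in> ?M" using m by (auto simp: box_def indets_def)
  qed
  have "card ?M = (d * c + 1) ^ ?N * E ^ ?N" by (simp only: box_finite_card(2)[OF V] power_mult_distrib)
  also have "\<dots> < E * E ^ ?N" by (simp add: E_def)
  also have "\<dots> \<le> E ^ d" using power_increasing[OF \<open>Suc ?N \<le> d\<close>, of E] by (simp add: E_def)
  also have "\<dots> = card ?A" using box_finite_card(2)[of "{..<d}" E] by simp
  finally have "card ?M < card ?A" .
  then obtain x where x: "\<exists>a\<in>?A. x a \<noteq> 0"
    "\<forall>m\<in>?M. (\<Sum>a\<in>?A. x a * lookup (monom_eval y a) m) = 0"
    using nontrivial_linear_relation[OF box_finite_card(1) box_finite_card(1)[OF V], of "{..<d}" "(d * c + 1) * E" E
        "\<lambda>a m. lookup (monom_eval y a) m"] by auto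
  define F where "F = (\<Sum>a\<in>?A. single a (x a))"
  have finA: "finite ?A" by (rule box_finite_card(1)) simp
  have lookF: "lookup F a = (if a \<in> ?A then x a else 0)" for a
    using finA by (simp add: F_def lookup_sum lookup_single when_def)
  have "mpoly_eval Const y F = (\<Sum>a\<in>?A. Const (x a) * monom_eval y a)"
    unfolding F_def comm_ring_hom.mpoly_eval_sum[OF comm_ring_hom_Const]
      comm_ring_hom.mpoly_eval_single[OF comm_ring_hom_Const] ..
  also have "\<dots> = 0"
  proof (rule poly_mapping_eqI)
    fix m
    have lc: "lookup (Const b * f) m = b * lookup f m" for b and f :: "('x, 'k) mpoly"
      unfolding Const_def mult_map_scale_conv_mult[symmetric] by (simp add: Poly_Mapping.map.rep_eq when_def)
    have "(\<Sum>a\<in>?A. x a * lookup (monom_eval y a) m) = 0"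
    proof (cases "m \<in> ?M")
      case False
      then have "lookup (monom_eval y a) m = 0" if "a \<in> ?A" for a
        using keys_M[OF that] by (auto simp: in_keys_iff)
      then show ?thesis by simp
    qed (use x(2) in blast)
    then show "lookup (\<Sum>a\<in>?A. Const (x a) * monom_eval y a) m = lookup 0 m"
      by (simp add: lookup_sum lc)
  qed
  finally have "mpoly_eval Const y F \<in> p" using \<open>0 \<in> p\<close> by simp
  moreover have "indets F \<subseteq> {..<d}"
    unfolding F_def
    by (intro order.trans[OF indets_sum] UN_least order.trans[OF indets_single]) (auto simp: box_def)
  ultimately have "F = 0" using indep by (simp add: alg_indep_mod_def)
  then show False using x(1) lookF by (metis lookup_zero)
qed

lemma prime_chain_length:
  fixes q :: "nat \<Rightarrow> ('x, 'k::field) mpoly set"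
  assumes V: "finite V" and q: "\<And>i. i \<le> k \<Longrightarrow> primeideal (q i) (poly_ring V)"
    and dec: "\<And>i. i < k \<Longrightarrow> q (Suc i) \<subset> q i"
    and y: "\<And>i. i < d \<Longrightarrow> indets (y i) \<subseteq> V" "alg_indep_mod (q 0) y d"
  shows "d + k \<le> card V"
proof -
  have "\<exists>y. (\<forall>i<d + j. indets (y i) \<subseteq> V) \<and> alg_indep_mod (q j) y (d + j)" if "j \<le> k" for j
    using that
  proof (induction j)
    case 0
    then show ?case using y by auto
  next
    case (Suc j)
    then obtain y where y: "\<forall>i<d + j. indets (y i) \<subseteq> V" "alg_indep_mod (q j) y (d + j)" by auto
    obtain g where g: "g \<in> q j" "g \<notin> q (Suc j)" using dec[of j] Suc.prems by auto
    have I: "ideal (q j) (poly_ring V)" using q[of j] Suc.prems by (simp add: primeideal.axioms(1))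
    have "alg_indep_mod (q (Suc j)) (y(d + j := g)) (Suc (d + j))"
      using alg_indep_mod_extend[OF q[OF Suc.prems] I _ g] dec[of j] Suc.prems y by auto
    moreover have "\<forall>i<Suc (d + j). indets ((y(d + j := g)) i) \<subseteq> V"
      using y(1) poly_ideal_closed(4)[OF I g(1)] by (auto simp: less_Suc_eq)
    ultimately show ?case unfolding add_Suc_right by blast
  qed
  from this[of k] obtain y where "\<forall>i<d + k. indets (y i) \<subseteq> V" "alg_indep_mod (q k) y (d + k)" by auto
  then show ?thesis
    using poly_ideal_closed(1)[OF primeideal.axioms(1)[OF q[of k]]]
    by (intro alg_indep_mod_le_card[OF V]) auto
qed

lemma ex_root:
  assumes "0 < m" shows "\<exists>r :: 'k::alg_closed_field. r ^ m = c"
proof -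
  have "degree (Polynomial.monom 1 m + [:- c:]) = m"
    using assms by (subst degree_add_eq_left) (simp_all add: degree_monom_eq)
  then have "\<exists>r. poly (Polynomial.monom 1 m + [:- c:]) r = 0"
    using assms by (intro alg_closed_imp_poly_has_root) simp
  then show ?thesis by (auto simp: poly_monom)
qed

text \<open>Every invertible matrix is an adjugate, as the ground field contains \<open>(n - 1)\<close>-st roots.\<close>

lemma ex_adj_mat_eq:
  fixes A :: "'k::alg_closed_field mat"
  assumes n: "2 \<le> n" and A: "A \<in> carrier_mat n n" "det A \<noteq> 0" "\<And>i. i \<in> D \<Longrightarrow> A $$ (i, i) = 0" and D: "D \<subseteq> {..<n}"
  shows "\<exists>x\<in>zero_diag_inverse n D. adj_mat x = A"
proof -
  obtain r where r: "r ^ (n - 1) = det A" using ex_root[of "n - 1" "det A"] n by auto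
  have "r \<noteq> 0" using r A(2) n by (auto simp: power_0_left split: if_splits)
  define \<kappa> where "\<kappa> = r / det A"
  have "\<kappa> \<noteq> 0" using \<open>r \<noteq> 0\<close> A(2) by (simp add: \<kappa>_def)
  let ?x = "\<kappa> \<cdot>\<^sub>m adj_mat A"
  have x: "?x \<in> zero_diag_inverse n D" by (rule smult_adj_mat_mem(1)[OF A D \<open>\<kappa> \<noteq> 0\<close>])
  note X = zero_diag_inverseE[OF x]
  have "\<kappa> * det A = r" using A(2) by (simp add: \<kappa>_def)
  have "?x * A = r \<cdot>\<^sub>m 1\<^sub>m n"
    using adj_mat(1,3)[OF A(1)] A(1) \<open>\<kappa> * det A = r\<close>
    by (simp add: mult_smult_assoc_mat[of _ n n]) (intro eq_matI; simp)
  then have "det ?x * det A = r ^ n" using det_mult[OF X(1) A(1)] by simp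
  also have "r ^ n = r * r ^ (n - 1)" using n by (simp flip: power_Suc)
  finally have "det ?x = r" using r A(2) by simp
  have "adj_mat ?x $$ (i, j) * (\<kappa> * det A) = det ?x * A $$ (i, j)" if "i < n" "j < n" for i j
    by (rule smult_adj_mat_mem(2)[OF A D \<open>\<kappa> \<noteq> 0\<close> that])
  then have "adj_mat ?x $$ (i, j) = A $$ (i, j)" if "i < n" "j < n" for i j
    using that unfolding \<open>\<kappa> * det A = r\<close> \<open>det ?x = r\<close> using \<open>r \<noteq> 0\<close> by simp
  then have "adj_mat ?x = A" using X(3) A(1) by (intro eq_matI) auto
  then show ?thesis using x by blast
qed

text \<open>
  The off-diagonal entries of the adjugate take generic values on the invertible matrices whose
  inverse has zero diagonal, so the closure of this set has dimension at least \<open>n * n - n\<close>.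
\<close>

lemma alg_indep_off_diagonal:
  assumes n: "2 \<le> n"
  shows "\<exists>y :: nat \<Rightarrow> 'k::alg_closed_field matrix_poly. (\<forall>i<n * n - n. indets (y i) \<subseteq> {..<n} \<times> {..<n}) \<and>
    alg_indep_mod (zero_diag_inverse_ideal n {..<n}) y (n * n - n)"
proof -
  let ?V = "{..<n} \<times> {..<n}"
  let ?X = "generic_matrix n :: 'k matrix_poly mat"
  let ?d = "n * n - n"
  define Off where "Off = ?V - (\<lambda>i. (i, i)) ` {..<n}"
  have "card ((\<lambda>i. (i, i)) ` {..<n}) = n" by (simp add: card_image inj_on_def)
  then have "card Off = ?d" unfolding Off_def by (subst card_Diff_subset) (auto simp: card_cartesian_product)
  moreover have "finite Off" by (simp add: Off_def)
  ultimately obtain \<pi> where \<pi>: "bij_betw \<pi> {..<?d} Off"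
    using ex_bij_betw_nat_finite[of Off] by (auto simp: lessThan_atLeast0)
  have \<pi>_mem: "fst (\<pi> t) < n" "snd (\<pi> t) < n" "fst (\<pi> t) \<noteq> snd (\<pi> t)" if "t < ?d" for t
  proof -
    have "\<pi> t \<in> Off" using bij_betwE[OF \<pi>] that by simp
    then show "fst (\<pi> t) < n" "snd (\<pi> t) < n" "fst (\<pi> t) \<noteq> snd (\<pi> t)"
      by (cases "\<pi> t"; auto simp: Off_def)+
  qed
  define y where "y t = adj_mat ?X $$ (\<pi> t)" for t
  have yV: "indets (y t) \<subseteq> ?V" if "t < ?d" for t
    using indets_adj_generic_matrix[OF \<pi>_mem(1,2)[OF that], where 'k = 'k] by (simp add: y_def)
  have "F = 0" if F: "indets F \<subseteq> {..<?d}" "mpoly_eval Const y F \<in> zero_diag_inverse_ideal n {..<n}" for F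
    unfolding mpoly_eq_0_iff
  proof
    fix w :: "nat \<Rightarrow> 'k"
    show "eval_at w F = 0"
    proof (rule ccontr)
      assume nz: "eval_at w F \<noteq> 0"
      obtain C :: "'k mat" where C: "C \<in> carrier_mat n n" "det C \<noteq> 0" "\<forall>i<n. C $$ (i, i) = 0"
        using ex_invertible_zero_diag[OF n] by blast
      define u where "u s t = (1 - s) * w t + s * C $$ (\<pi> t)" for s t
      define A where "A s = mat n n (\<lambda>(i, j). if i = j then 0 else u s (inv_into {..<?d} \<pi> (i, j)))" for s
      have A: "A s \<in> carrier_mat n n" for s by (simp add: A_def)
      have inv: "inv_into {..<?d} \<pi> ij < ?d" "\<pi> (inv_into {..<?d} \<pi> ij) = ij" if "ij \<in> Off" for ij
        using bij_betwE[OF bij_betw_inv_into[OF \<pi>]] bij_betw_inv_into_right[OF \<pi>] that by auto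
      have A1: "A 1 = C"
      proof (rule eq_matI)
        fix i j assume "i < dim_row C" "j < dim_col C"
        then have ij: "i < n" "j < n" using C(1) by auto
        show "A 1 $$ (i, j) = C $$ (i, j)"
        proof (cases "i = j")
          case False
          then have "(i, j) \<in> Off" using ij by (auto simp: Off_def)
          then show ?thesis using ij False inv(2) by (simp add: A_def u_def)
        qed (use ij C(3) in \<open>simp add: A_def\<close>)
      qed (use C(1) in \<open>auto simp: A_def\<close>)
      have u_poly: "poly_fun (\<lambda>s. s) (\<lambda>s. u s t)" for t
        unfolding u_def by (intro poly_fun_add poly_fun_mult poly_fun_diff poly_fun_const poly_fun_param)
      have A_poly: "poly_fun (\<lambda>s. s) (\<lambda>s. A s $$ (i, j))" if "i < n" "j < n" for i j
        using that u_poly by (cases "i = j") (simp_all add: A_def)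
      define g where "g k = (if k = (0::nat) then (\<lambda>s. eval_at (u s) F) else (\<lambda>s. det (A s)))" for k
      have "u 0 = w" by (simp add: u_def fun_eq_iff)
      have "\<exists>s. \<forall>k\<in>{0, 1}. g k s \<noteq> 0"
      proof (rule generic_parameter)
        show "poly_fun (\<lambda>s. s) (g k)" for k
          unfolding g_def using A A_poly u_poly by (auto intro!: poly_fun_det[of _ n] poly_fun_mpoly_eval)
        show "g k (if k = 0 then 0 else 1) \<noteq> 0" for k
          unfolding g_def using nz A1 C(2) \<open>u 0 = w\<close> by simp
      qed simp
      then obtain s where s: "eval_at (u s) F \<noteq> 0" "det (A s) \<noteq> 0" by (auto simp: g_def)
      have "A s $$ (i, i) = 0" if "i \<in> {..<n}" for i using that by (simp add: A_def)
      from ex_adj_mat_eq[OF n A s(2) this] obtain x where x: "x \<in> zero_diag_inverse n {..<n}" "adj_mat x = A s"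
        by blast
      have "0 = eval_at (entries n x) (mpoly_eval Const y F)"
        using F(2) x(1) by (simp only: mem_zero_diag_inverse_ideal)
      also have "\<dots> = eval_at (\<lambda>t. eval_at (entries n x) (y t)) F"
        by (rule mpoly_eval_mpoly_eval[OF comm_ring_hom_id])
      also have "\<dots> = eval_at (u s) F"
      proof (rule mpoly_eval_cong)
        fix t assume "t \<in> indets F"
        then have t: "t < ?d" using F(1) by auto
        have "eval_at (entries n x) (y t) = A s $$ (\<pi> t)"
          using eval_adj_generic_matrix[OF comm_ring_hom_id zero_diag_inverseE(1)[OF x(1)] \<pi>_mem(1,2)[OF t]]
          by (simp add: y_def x(2))
        also have "\<dots> = u s t"
          using \<pi>_mem[OF t] bij_betw_inv_into_left[OF \<pi>, of t] t
          by (cases "\<pi> t") (simp add: A_def)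
        finally show "eval_at (entries n x) (y t) = u s t" .
      qed
      finally show False using s(1) by simp
    qed
  qed
  then show ?thesis using yV by (intro exI[of _ y]) (auto simp: alg_indep_mod_def)
qed

text \<open>
  Dropping the conditions on the diagonal one at a time gives a chain of \<open>n + 1\<close> primes.
\<close>

lemma zero_diag_inverse_ideal_strict_mono:
  assumes "2 \<le> n" "k < n"
  shows "zero_diag_inverse_ideal n {..<k} \<subset> (zero_diag_inverse_ideal n {..<Suc k} :: 'k::alg_closed_field matrix_poly set)"
proof
  have "zero_diag_inverse n {..<Suc k} \<subseteq> (zero_diag_inverse n {..<k} :: 'k mat set)"
    by (auto simp: zero_diag_inverse_def)
  then show "zero_diag_inverse_ideal n {..<k} \<subseteq> (zero_diag_inverse_ideal n {..<Suc k} :: 'k matrix_poly set)"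
    unfolding subset_iff mem_zero_diag_inverse_ideal by blast
  let ?f = "adj_mat (generic_matrix n :: 'k matrix_poly mat) $$ (k, k)"
  have "?f \<notin> zero_diag_inverse_ideal n {..<k}"
    using assms by (intro adj_entry_notin_zero_diag_inverse_ideal) auto
  moreover have "?f \<in> zero_diag_inverse_ideal n {..<Suc k}"
    unfolding mem_zero_diag_inverse_ideal
  proof (intro conjI ballI)
    show "indets ?f \<subseteq> {..<n} \<times> {..<n}" using assms by (intro indets_adj_generic_matrix)
    fix x :: "'k mat" assume "x \<in> zero_diag_inverse n {..<Suc k}"
    note x = zero_diag_inverseE[OF this]
    show "eval_at (entries n x) ?f = 0"
      unfolding eval_adj_generic_matrix[OF comm_ring_hom_id x(1) assms(2,2)] by (rule x(5)) simp
  qed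
  ultimately show "zero_diag_inverse_ideal n {..<k} \<noteq> (zero_diag_inverse_ideal n {..<Suc k} :: 'k matrix_poly set)"
    by blast
qed

section \<open>The rank at a prime\<close>

text \<open>
  The columns of a singular matrix are dependent: border a nonvanishing minor of largest size by a
  further column; its cofactors along a further row give the coefficients.
\<close>

lemma (in type_prime) ex_dependency_if_det_mem:
  assumes M: "M \<in> carrier_mat n n" "det M \<in> p"
  shows "\<exists>c. (\<forall>i<n. (\<Sum>j<n. c j * M $$ (i, j)) \<in> p) \<and> (\<exists>j<n. c j \<notin> p)"
proof -
  define minor where "minor t \<rho> \<gamma> = mat t t (\<lambda>(a, b). M $$ (\<rho> a, \<gamma> b))" for t and \<rho> \<gamma> :: "nat \<Rightarrow> nat"
  define P where "P t \<longleftrightarrow> (\<exists>\<rho> \<gamma>. (\<forall>a<t. \<rho> a < n \<and> \<gamma> a < n) \<and> det (minor t \<rho> \<gamma>) \<notin> p)" for t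
  have "P 0" unfolding P_def minor_def using one_notin by (simp add: det_dim_zero)
  have "\<not> P n"
  proof
    assume "P n"
    then obtain \<rho> \<gamma> where rg: "\<And>a. a < n \<Longrightarrow> \<rho> a < n" "\<And>a. a < n \<Longrightarrow> \<gamma> a < n" "det (minor n \<rho> \<gamma>) \<notin> p"
      unfolding P_def by blast
    define S where "S = mat n n (\<lambda>(a, i). if i = \<rho> a then 1 else (0::'a))"
    define T where "T = mat n n (\<lambda>(j, b). if j = \<gamma> b then 1 else (0::'a))"
    have ST: "S \<in> carrier_mat n n" "T \<in> carrier_mat n n" by (simp_all add: S_def T_def)
    have "(S * (M * T)) $$ (a, b) = M $$ (\<rho> a, \<gamma> b)" if ab: "a < n" "b < n" for a b
    proof -
      have MT: "(M * T) $$ (i, b) = M $$ (i, \<gamma> b)" if "i < n" for i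
      proof -
        have "(M * T) $$ (i, b) = (\<Sum>j<n. M $$ (i, j) * T $$ (j, b))"
          using M(1) ST(2) that ab by (simp add: scalar_prod_def lessThan_atLeast0)
        also have "\<dots> = (\<Sum>j<n. if j = \<gamma> b then M $$ (i, \<gamma> b) else 0)"
          using ab by (intro sum.cong) (auto simp: T_def)
        finally show ?thesis using rg(2)[OF ab(2)] by simp
      qed
      have "(S * (M * T)) $$ (a, b) = (\<Sum>i<n. S $$ (a, i) * (M * T) $$ (i, b))"
        using M(1) ST ab by (simp add: scalar_prod_def lessThan_atLeast0)
      also have "\<dots> = (\<Sum>i<n. if i = \<rho> a then M $$ (\<rho> a, \<gamma> b) else 0)"
        using ab MT by (intro sum.cong) (auto simp: S_def)
      finally show ?thesis using rg(1)[OF ab(1)] by simp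
    qed
    then have "minor n \<rho> \<gamma> = S * (M * T)"
      using M(1) ST by (intro eq_matI) (auto simp: minor_def)
    then have "det (minor n \<rho> \<gamma>) = det S * (det M * det T)"
      using det_mult[OF ST(1) mult_carrier_mat[OF M(1) ST(2)]] det_mult[OF M(1) ST(2)] by simp
    then show False using rg(3) M(2) by (simp add: mult_mem mult_mem')
  qed
  have "\<exists>t<n. P t \<and> \<not> P (Suc t)"
  proof (rule ccontr)
    assume "\<not> ?thesis"
    then have "P t" if "t \<le> n" for t using that \<open>P 0\<close> by (induction t) auto
    then show False using \<open>\<not> P n\<close> by blast
  qed
  then obtain t where t: "t < n" "P t" "\<not> P (Suc t)" by blast
  obtain \<rho> \<gamma> where rg: "\<And>a. a < t \<Longrightarrow> \<rho> a < n" "\<And>a. a < t \<Longrightarrow> \<gamma> a < n" "det (minor t \<rho> \<gamma>) \<notin> p"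
    using t(2) unfolding P_def by blast
  have "card (\<gamma> ` {..<t}) \<le> t" using card_image_le[of "{..<t}" \<gamma>] by simp
  then have "\<not> {..<n} \<subseteq> \<gamma> ` {..<t}" using card_mono[of "\<gamma> ` {..<t}" "{..<n}"] t(1) by auto
  then obtain j0 where j0: "j0 < n" "j0 \<notin> \<gamma> ` {..<t}" by auto
  define N where "N i = minor (Suc t) (\<rho>(t := i)) (\<gamma>(t := j0))" for i
  have N: "N i \<in> carrier_mat (Suc t) (Suc t)" for i by (simp add: N_def minor_def)
  define \<kappa> where "\<kappa> b = cofactor (N 0) t b" for b
  have \<kappa>: "cofactor (N i) t b = \<kappa> b" if "b < Suc t" for i b
  proof -
    have "mat_delete (N i) t b = mat_delete (N 0) t b"
      by (rule eq_matI) (auto simp: mat_delete_def N_def minor_def)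
    then show ?thesis by (simp add: \<kappa>_def cofactor_def)
  qed
  have "mat_delete (N 0) t t = minor t \<rho> \<gamma>"
    by (rule eq_matI) (auto simp: mat_delete_def N_def minor_def)
  then have \<kappa>_t: "\<kappa> t \<notin> p" using rg(3) by (simp add: \<kappa>_def cofactor_def)
  define c where "c j = (\<Sum>b<Suc t. if (\<gamma>(t := j0)) b = j then \<kappa> b else 0)" for j
  have "(\<Sum>j<n. c j * M $$ (i, j)) \<in> p" if i: "i < n" for i
  proof -
    have \<gamma>'n: "(\<gamma>(t := j0)) b < n" if "b < Suc t" for b using rg(2) j0(1) that by (auto simp: less_Suc_eq)
    have "(\<Sum>j<n. c j * M $$ (i, j)) = (\<Sum>b<Suc t. \<Sum>j<n. if j = (\<gamma>(t := j0)) b then \<kappa> b * M $$ (i, (\<gamma>(t := j0)) b) else 0)"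
      unfolding c_def sum_distrib_right by (subst sum.swap) (intro sum.cong refl, auto)
    also have "\<dots> = (\<Sum>b<Suc t. \<kappa> b * M $$ (i, (\<gamma>(t := j0)) b))"
      using \<gamma>'n by (intro sum.cong refl) simp
    also have "\<dots> = (\<Sum>b<Suc t. N i $$ (t, b) * cofactor (N i) t b)"
      using \<kappa> by (intro sum.cong refl) (simp add: N_def minor_def mult.commute)
    also have "\<dots> = det (N i)" by (rule laplace_expansion_row[OF N, symmetric]) simp
    also have "\<dots> \<in> p"
    proof (rule ccontr)
      assume "det (N i) \<notin> p"
      moreover have "\<forall>a<Suc t. (\<rho>(t := i)) a < n \<and> (\<gamma>(t := j0)) a < n"
        using rg(1) \<gamma>'n i by (auto simp: less_Suc_eq)
      ultimately have "P (Suc t)" unfolding P_def N_def by blast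
      then show False using t(3) by blast
    qed
    finally show ?thesis .
  qed
  moreover have "c j0 = \<kappa> t"
  proof -
    have "c j0 = \<kappa> t + (\<Sum>b<t. if \<gamma> b = j0 then \<kappa> b else 0)"
      by (simp add: c_def add.commute)
    also have "(\<Sum>b<t. if \<gamma> b = j0 then \<kappa> b else 0) = 0" using j0(2) by (intro sum.neutral) auto
    finally show ?thesis by simp
  qed
  ultimately show ?thesis using \<kappa>_t j0(1) by metis
qed

lemma finsum_poly_ring:
  fixes g :: "'i \<Rightarrow> ('x, 'k::comm_ring_1) mpoly"
  assumes "finite J" "\<And>j. j \<in> J \<Longrightarrow> indets (g j) \<subseteq> V"
  shows "(\<Oplus>\<^bsub>poly_ring V\<^esub>j\<in>J. g j) = sum g J"
proof -
  interpret cring "poly_ring V :: ('x, 'k) mpoly ring" by (rule cring_poly_ring)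
  show ?thesis
    using assms by (induction J rule: finite_induct) (simp_all add: poly_ring_simps Pi_iff)
qed

lemma cols_indep_at_iff:
  fixes p :: "'k::comm_ring_1 matrix_poly set"
  assumes p: "primeideal p (matrix_poly_ring n)"
  shows "cols_indep_at (matrix_poly_ring n) p (generic_matrix n) {..<n} \<longleftrightarrow> det (generic_matrix n) \<notin> p"
proof -
  let ?V = "{..<n} \<times> {..<n}"
  let ?X = "generic_matrix n :: 'k matrix_poly mat"
  define p' where "p' = {f. restrict_vars ?V f \<in> p}"
  interpret p': type_prime p'
    unfolding p'_def using p type_prime_restrict_vars unfolding matrix_poly_ring_def by blast
  interpret \<phi>: comm_ring_hom "restrict_vars ?V :: 'k matrix_poly \<Rightarrow> _" by (rule comm_ring_hom_restrict_vars)
  have p'_iff: "g \<in> p' \<longleftrightarrow> g \<in> p" if "indets g \<subseteq> ?V" for g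
    using restrict_vars_id[OF that] by (simp add: p'_def)
  have X_ind: "indets (?X $$ (i, j)) \<subseteq> ?V" if "i < n" "j < n" for i j
    using that by (simp add: generic_matrix_def)
  have prod_ind: "indets (c j * ?X $$ (i, j)) \<subseteq> ?V" if "indets (c j) \<subseteq> ?V" "i < n" "j < n" for c i j
    using indets_mult[of "c j" "?X $$ (i, j)"] X_ind[OF that(2,3)] that(1) by blast
  have sum_mem: "(\<Oplus>\<^bsub>matrix_poly_ring n\<^esub>j\<in>{..<n}. c j \<otimes>\<^bsub>matrix_poly_ring n\<^esub> ?X $$ (i, j)) \<in> p \<longleftrightarrow>
      (\<Sum>j<n. c j * ?X $$ (i, j)) \<in> p'"
    if c: "\<And>j. j < n \<Longrightarrow> indets (c j) \<subseteq> ?V" and i: "i < n" for c i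
  proof -
    have term_ind: "indets (c j * ?X $$ (i, j)) \<subseteq> ?V" if "j \<in> {..<n}" for j
      using prod_ind[of c j i] c[of j] i that by simp
    have eq: "(\<Oplus>\<^bsub>matrix_poly_ring n\<^esub>j\<in>{..<n}. c j \<otimes>\<^bsub>matrix_poly_ring n\<^esub> ?X $$ (i, j)) = (\<Sum>j<n. c j * ?X $$ (i, j))"
      unfolding matrix_poly_ring_def poly_ring_simps
      by (rule finsum_poly_ring[OF finite_lessThan term_ind])
    have "indets (\<Sum>j<n. c j * ?X $$ (i, j)) \<subseteq> ?V"
      by (intro order.trans[OF indets_sum] UN_least term_ind)
    then show ?thesis unfolding eq by (rule p'_iff[symmetric])
  qed
  have det_iff: "det ?X \<in> p' \<longleftrightarrow> det ?X \<in> p" by (rule p'_iff[OF indets_det_generic_matrix])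
  have dim: "dim_row ?X = n" by (simp add: generic_matrix_def)
  show ?thesis
  proof
    assume indep: "cols_indep_at (matrix_poly_ring n) p ?X {..<n}"
    show "det ?X \<notin> p"
    proof
      assume "det ?X \<in> p"
      then have "det ?X \<in> p'" using det_iff by simp
      then obtain c where c: "\<forall>i<n. (\<Sum>j<n. c j * ?X $$ (i, j)) \<in> p'" "\<exists>j<n. c j \<notin> p'"
        using p'.ex_dependency_if_det_mem[OF generic_matrix_carrier] by blast
      (* the coefficients may be taken in the subring, which the retraction maps identically *)
      define c' where "c' j = restrict_vars ?V (c j)" for j
      have c'_ind: "indets (c' j) \<subseteq> ?V" for j unfolding c'_def by (rule indets_restrict_vars)
      have "(\<Sum>j<n. c' j * ?X $$ (i, j)) \<in> p'" if i: "i < n" for i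
      proof -
        have "restrict_vars ?V (\<Sum>j<n. c j * ?X $$ (i, j)) = (\<Sum>j<n. c' j * ?X $$ (i, j))"
          unfolding \<phi>.hom_sum \<phi>.hom_mult c'_def
          using restrict_vars_id[OF X_ind[OF i]] by (intro sum.cong refl) simp
        moreover have "restrict_vars ?V (\<Sum>j<n. c j * ?X $$ (i, j)) \<in> p" using c(1) i by (simp add: p'_def)
        moreover have "indets (\<Sum>j<n. c' j * ?X $$ (i, j)) \<subseteq> ?V"
          by (intro order.trans[OF indets_sum] UN_least prod_ind[of c', OF c'_ind i]) simp
        ultimately show ?thesis using p'_iff by simp
      qed
      then have "\<forall>i<dim_row ?X. (\<Oplus>\<^bsub>matrix_poly_ring n\<^esub>j\<in>{..<n}. c' j \<otimes>\<^bsub>matrix_poly_ring n\<^esub> ?X $$ (i, j)) \<in> p"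
        using sum_mem[OF c'_ind] dim by simp
      moreover have "c' \<in> {..<n} \<rightarrow> carrier (matrix_poly_ring n)"
        using c'_ind by (simp add: matrix_poly_ring_def poly_ring_simps)
      ultimately have "\<forall>j\<in>{..<n}. c' j \<in> p" using indep unfolding cols_indep_at_def by blast
      then show False using c(2) by (auto simp: p'_def c'_def)
    qed
  next
    assume det: "det ?X \<notin> p"
    show "cols_indep_at (matrix_poly_ring n) p ?X {..<n}"
      unfolding cols_indep_at_def dim
    proof (intro ballI impI)
      fix c l
      assume c: "c \<in> {..<n} \<rightarrow> carrier (matrix_poly_ring n)"
        and rel: "\<forall>i<n. (\<Oplus>\<^bsub>matrix_poly_ring n\<^esub>j\<in>{..<n}. c j \<otimes>\<^bsub>matrix_poly_ring n\<^esub> ?X $$ (i, j)) \<in> p"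
        and l: "l \<in> {..<n}"
      have c_ind: "indets (c j) \<subseteq> ?V" if "j < n" for j
        using c that by (auto simp: matrix_poly_ring_def poly_ring_simps Pi_iff)
      have "(\<Sum>i<n. adj_mat ?X $$ (l, i) * (\<Sum>j<n. c j * ?X $$ (i, j))) \<in> p'"
      proof (rule p'.sum_mem, rule p'.mult_mem)
        fix i assume "i \<in> {..<n}"
        then show "(\<Sum>j<n. c j * ?X $$ (i, j)) \<in> p'" using rel sum_mem[of c i] c_ind by simp
      qed
      also have "(\<Sum>i<n. adj_mat ?X $$ (l, i) * (\<Sum>j<n. c j * ?X $$ (i, j))) =
          (\<Sum>j<n. (\<Sum>i<n. adj_mat ?X $$ (l, i) * ?X $$ (i, j)) * c j)"
        unfolding sum_distrib_left sum_distrib_right by (subst sum.swap) (simp only: ac_simps)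
      also have "\<dots> = (\<Sum>j<n. if j = l then det ?X * c l else 0)"
      proof (rule sum.cong[OF refl])
        fix j assume "j \<in> {..<n}"
        then have "(\<Sum>i<n. adj_mat ?X $$ (l, i) * ?X $$ (i, j)) = (if l = j then det ?X else 0)"
          using l by (intro adj_mat_mult[OF generic_matrix_carrier]) auto
        then show "(\<Sum>i<n. adj_mat ?X $$ (l, i) * ?X $$ (i, j)) * c j = (if j = l then det ?X * c l else 0)" by simp
      qed
      also have "\<dots> = det ?X * c l" using l by simp
      finally have "c l \<in> p'" using det det_iff by (simp add: p'.mult_mem_iff)
      then show "c l \<in> p" using p'_iff c_ind l by simp
    qed
  qed
qed

lemma rank_at_eq_iff:
  fixes p :: "'k::comm_ring_1 matrix_poly set"
  assumes p: "primeideal p (matrix_poly_ring n)"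
  shows "rank_at (matrix_poly_ring n) p (generic_matrix n) = n \<longleftrightarrow> det (generic_matrix n) \<notin> p"
proof -
  let ?S = "{card J | J. J \<subseteq> {..<n} \<and> cols_indep_at (matrix_poly_ring n) p (generic_matrix n) J}"
  have rank: "rank_at (matrix_poly_ring n) p (generic_matrix n) = Max ?S"
    by (simp add: rank_at_def generic_matrix_def)
  have le: "s \<le> n" if "s \<in> ?S" for s using that card_mono[of "{..<n}"] by fastforce
  have fin: "finite ?S" by (rule finite_subset[of _ "{..n}"]) (use le in auto)
  have "card ({} :: nat set) \<in> ?S" by (force simp: cols_indep_at_def)
  then have ne: "?S \<noteq> {}" by blast
  show ?thesis
  proof
    assume "rank_at (matrix_poly_ring n) p (generic_matrix n) = n"
    then have "n \<in> ?S" using Max_in[OF fin ne] rank by simp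
    then obtain J where J: "J \<subseteq> {..<n}" "card J = n" "cols_indep_at (matrix_poly_ring n) p (generic_matrix n) J"
      by blast
    have "J = {..<n}" using J(1,2) by (intro card_subset_eq) auto
    then show "det (generic_matrix n) \<notin> p" using J(3) cols_indep_at_iff[OF p] by simp
  next
    assume "det (generic_matrix n) \<notin> p"
    then have "cols_indep_at (matrix_poly_ring n) p (generic_matrix n) {..<n}" using cols_indep_at_iff[OF p] by simp
    then have "n \<in> ?S" by (intro CollectI exI[of _ "{..<n}"]) simp
    then show "rank_at (matrix_poly_ring n) p (generic_matrix n) = n"
      unfolding rank using fin le by (intro Max_eqI)
  qed
qed

section \<open>Irreducible closed sets and primes\<close>

lemma mem_vanishing_locus_iff: "p \<in> vanishing_locus R J \<longleftrightarrow> primeideal p R \<and> J \<subseteq> p"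
  by (simp add: vanishing_locus_def Spec_def)

lemma primeideal_subset_carrier: "primeideal p R \<Longrightarrow> p \<subseteq> carrier R"
  using additive_subgroup.a_subset[OF ideal.axioms(1)[OF primeideal.axioms(1)]] .

lemma vanishing_locus_subset_iff:
  "primeideal p R \<Longrightarrow> vanishing_locus R p \<subseteq> vanishing_locus R q \<longleftrightarrow> q \<subseteq> p"
  by (auto simp: mem_vanishing_locus_iff subset_iff)

lemma closedin_vanishing_locus: "J \<subseteq> carrier R \<Longrightarrow> closedin (zariski R) (vanishing_locus R J)"
  unfolding closedin_zariski by blast

lemma irreducible_in_vanishing_locus:
  assumes "primeideal p R"
  shows "irreducible_in (zariski R) (vanishing_locus R p)"
  unfolding irreducible_in_def topspace_zariski
proof (intro conjI allI impI)
  show "vanishing_locus R p \<subseteq> Spec R" by (auto simp: vanishing_locus_def)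
  have p: "p \<in> vanishing_locus R p" using assms by (simp add: mem_vanishing_locus_iff)
  then show "vanishing_locus R p \<noteq> {}" by blast
  fix A B
  assume "closedin (zariski R) A" "closedin (zariski R) B" and sub: "vanishing_locus R p \<subseteq> A \<union> B"
  then obtain J L where JL: "A = vanishing_locus R J" "B = vanishing_locus R L" unfolding closedin_zariski by blast
  have "p \<in> A \<or> p \<in> B" using p sub by blast
  then show "vanishing_locus R p \<subseteq> A \<or> vanishing_locus R p \<subseteq> B"
    unfolding JL subset_iff mem_vanishing_locus_iff by blast
qed

text \<open>The prime ideal is the intersection of the primes in the set.\<close>

lemma irreducible_closed_is_vanishing_locus:
  assumes R: "cring R" and C: "closedin (zariski R) C" "irreducible_in (zariski R) C"
  shows "\<exists>q. primeideal q R \<and> C = vanishing_locus R q"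
proof -
  interpret cring R by fact
  obtain J where J: "J \<subseteq> carrier R" "C = vanishing_locus R J" using C(1) unfolding closedin_zariski by blast
  have ne: "C \<noteq> {}" using C(2) by (simp add: irreducible_in_def)
  have prime: "primeideal p R" if "p \<in> C" for p using that unfolding J(2) by (simp add: mem_vanishing_locus_iff)
  define q where "q = \<Inter> C"
  have "q \<subseteq> carrier R" using ne primeideal_subset_carrier[OF prime] unfolding q_def by blast
  have "ideal q R"
    unfolding q_def by (rule i_Intersect[OF _ ne]) (use prime in \<open>auto intro: primeideal.axioms(1)\<close>)
  have "primeideal q R"
  proof (rule primeidealI[OF \<open>ideal q R\<close> R])
    obtain p where p: "p \<in> C" using ne by blast
    then have "carrier R \<noteq> p" using primeideal.I_notcarr[OF prime] by blast
    moreover have "q \<subseteq> p" using p by (auto simp: q_def)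
    ultimately show "carrier R \<noteq> q" using primeideal_subset_carrier[OF prime[OF p]] by blast
    fix a b assume ab: "a \<in> carrier R" "b \<in> carrier R" "a \<otimes>\<^bsub>R\<^esub> b \<in> q"
    have "C \<subseteq> vanishing_locus R {a} \<union> vanishing_locus R {b}"
    proof
      fix p assume p: "p \<in> C"
      then have "a \<otimes>\<^bsub>R\<^esub> b \<in> p" using ab(3) by (auto simp: q_def)
      then have "a \<in> p \<or> b \<in> p" using primeideal.I_prime[OF prime[OF p] ab(1,2)] by blast
      then show "p \<in> vanishing_locus R {a} \<union> vanishing_locus R {b}"
        using prime[OF p] by (auto simp: mem_vanishing_locus_iff)
    qed
    moreover have "closedin (zariski R) (vanishing_locus R {a})" "closedin (zariski R) (vanishing_locus R {b})"
      using ab by (auto intro: closedin_vanishing_locus)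
    ultimately have "C \<subseteq> vanishing_locus R {a} \<or> C \<subseteq> vanishing_locus R {b}"
      using C(2) unfolding irreducible_in_def by blast
    then show "a \<in> q \<or> b \<in> q" by (auto simp: q_def mem_vanishing_locus_iff)
  qed
  moreover have "C = vanishing_locus R q"
  proof
    show "C \<subseteq> vanishing_locus R q" using prime by (auto simp: mem_vanishing_locus_iff q_def)
    have "J \<subseteq> q" unfolding q_def J(2) by (auto simp: mem_vanishing_locus_iff)
    then show "vanishing_locus R q \<subseteq> C" unfolding J(2) subset_iff mem_vanishing_locus_iff by blast
  qed
  ultimately show ?thesis by blast
qed

text \<open>
  A chain of irreducible closed sets is a descending chain of primes, and each step downwards adds an
  independent element.
\<close>

lemma irreducible_codim_le:
  fixes q :: "('x, 'k::field) mpoly set"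
  assumes V: "finite V" and q: "primeideal q (poly_ring V)"
    and y: "\<And>i. i < d \<Longrightarrow> indets (y i) \<subseteq> V" "alg_indep_mod q y d" and "card V \<le> d + h"
  shows "irreducible_codim (zariski (poly_ring V)) (vanishing_locus (poly_ring V) q) \<le> enat h"
  unfolding irreducible_codim_def
proof (rule Sup_least)
  fix e
  assume "e \<in> {enat k | k. \<exists>c. c 0 = vanishing_locus (poly_ring V) q \<and>
    (\<forall>i\<le>k. closedin (zariski (poly_ring V)) (c i) \<and> irreducible_in (zariski (poly_ring V)) (c i)) \<and>
    (\<forall>i<k. c i \<subset> c (Suc i))}"
  then obtain k c where e: "e = enat k" and c0: "c 0 = vanishing_locus (poly_ring V) q"
    and c: "\<And>i. i \<le> k \<Longrightarrow> closedin (zariski (poly_ring V)) (c i)"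
      "\<And>i. i \<le> k \<Longrightarrow> irreducible_in (zariski (poly_ring V)) (c i)" "\<And>i. i < k \<Longrightarrow> c i \<subset> c (Suc i)"
    by blast
  have "\<exists>Q. i \<le> k \<longrightarrow> primeideal Q (poly_ring V) \<and> c i = vanishing_locus (poly_ring V) Q" for i
    using irreducible_closed_is_vanishing_locus[OF cring_poly_ring c(1,2)] by blast
  then obtain Q where Q: "\<And>i. i \<le> k \<Longrightarrow> primeideal (Q i) (poly_ring V)"
    "\<And>i. i \<le> k \<Longrightarrow> c i = vanishing_locus (poly_ring V) (Q i)" by metis
  have "Q 0 = q"
  proof
    have eq: "vanishing_locus (poly_ring V) (Q 0) = vanishing_locus (poly_ring V) q" using Q(2)[of 0] c0 by simp
    show "Q 0 \<subseteq> q" using vanishing_locus_subset_iff[OF q, of "Q 0"] eq by simp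
    show "q \<subseteq> Q 0" using vanishing_locus_subset_iff[OF Q(1)[of 0], of q] eq by simp
  qed
  have dec: "Q (Suc i) \<subset> Q i" if "i < k" for i
  proof -
    have ii: "i \<le> k" "Suc i \<le> k" using that by simp_all
    have "vanishing_locus (poly_ring V) (Q i) \<subset> vanishing_locus (poly_ring V) (Q (Suc i))"
      using c(3)[OF that] Q(2)[OF ii(1)] Q(2)[OF ii(2)] by simp
    then show ?thesis
      using vanishing_locus_subset_iff[OF Q(1)[OF ii(1)]] vanishing_locus_subset_iff[OF Q(1)[OF ii(2)]] by blast
  qed
  have "d + k \<le> card V"
    by (rule prime_chain_length[of V k Q d y, OF V Q(1) dec y(1)]) (simp_all add: \<open>Q 0 = q\<close> y(2))
  then show "e \<le> enat h" using assms(5) by (simp add: e)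
qed

section \<open>The components\<close>

theorem theorem4:
  fixes n :: nat
    and S :: "'k::alg_closed_field matrix_poly ring"
    and P I Q :: "'k matrix_poly set"
    and Y :: "'k matrix_poly set set"
  assumes "n \<ge> 4"
  defines "S \<equiv> matrix_poly_ring n"
    and "P \<equiv> principal_minor_ideal n (n - 1)"
    and "I \<equiv> determinantal_ideal n (n - 1)"
    and "Q \<equiv> saturated_principal_minor_ideal n (n - 1)"
    and "Y \<equiv> principal_rank_locus n n (n - 1)"
  shows "minimal_primes S P = {I, Q} \<and> I \<noteq> Q \<and>
         irreducible_components (zariski S) (vanishing_locus S P) =
           {vanishing_locus S I, zariski S closure_of Y} \<and>
         vanishing_locus S I \<noteq> zariski S closure_of Y \<and>
         locally_closedin (zariski S) Y \<and>
         codimension (zariski S) Y = enat n"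
proof -
  let ?V = "{..<n} \<times> {..<n}"
  let ?X = "generic_matrix n :: 'k matrix_poly mat"
  have n: "4 \<le> n" "2 \<le> n" "0 < n" using assms(1) by simp_all
  have S: "S = poly_ring ?V" by (simp add: S_def matrix_poly_ring_def)
  have Q_eq: "Q = zero_diag_inverse_ideal n {..<n}"
    unfolding Q_def by (rule saturated_principal_minor_ideal_eq[OF n(2)])
  have I_prime: "primeideal I S"
    using primeideal_determinantal_ideal[of n "n - 2", where 'k = 'k] n by (simp add: I_def S_def Suc_diff_Suc numeral_2_eq_2)
  have Q_prime: "primeideal Q S"
    unfolding Q_eq S_def by (rule primeideal_zero_diag_inverse_ideal[OF _ n(2)]) simp
  have gens: "adj_mat ?X $$ (i, i) \<in> I" "adj_mat ?X $$ (i, i) \<in> Q" if "i < n" for i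
  proof -
    show "adj_mat ?X $$ (i, i) \<in> I" unfolding I_def by (rule adj_mat_mem_determinantal_ideal[OF that that])
    show "adj_mat ?X $$ (i, i) \<in> Q"
      unfolding Q_eq mem_zero_diag_inverse_ideal
    proof (intro conjI ballI)
      show "indets (adj_mat ?X $$ (i, i)) \<subseteq> ?V" by (rule indets_adj_generic_matrix[OF that that])
      fix x :: "'k mat" assume "x \<in> zero_diag_inverse n {..<n}"
      note x = zero_diag_inverseE[OF this]
      show "eval_at (entries n x) (adj_mat ?X $$ (i, i)) = 0"
        unfolding eval_adj_generic_matrix[OF comm_ring_hom_id x(1) that that] by (rule x(5)) (simp add: that)
    qed
  qed
  have P_le: "P \<subseteq> I" "P \<subseteq> Q"
    unfolding P_def principal_minor_ideal_eq[OF n(3)] S[symmetric]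
    by (rule genideal_least[OF primeideal.axioms(1)[OF I_prime]], use gens(1) in blast)
      (rule genideal_least[OF primeideal.axioms(1)[OF Q_prime]], use gens(2) in blast)
  have over_P: "I \<subseteq> p \<or> Q \<subseteq> p" if "primeideal p S" "P \<subseteq> p" for p
    using prime_over_principal_minors[OF n(2)] that unfolding P_def I_def Q_def S_def by blast
  have incomp: "\<not> I \<subseteq> Q" "\<not> Q \<subseteq> I"
    using incomparable[OF n(1), where 'k = 'k] unfolding I_def Q_eq by blast+

  have minimal: "minimal_primes S P = {I, Q}"
  proof (intro equalityI subsetI)
    fix p assume "p \<in> minimal_primes S P"
    then have p: "primeideal p S" "P \<subseteq> p" "\<forall>q. primeideal q S \<longrightarrow> P \<subseteq> q \<longrightarrow> q \<subseteq> p \<longrightarrow> q = p"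
      by (auto simp: minimal_primes_def)
    then show "p \<in> {I, Q}" using over_P[OF p(1,2)] I_prime Q_prime P_le by blast
  next
    fix p assume "p \<in> {I, Q}"
    then show "p \<in> minimal_primes S P"
      using I_prime Q_prime P_le over_P incomp unfolding minimal_primes_def by blast
  qed

  have carrier: "P \<subseteq> carrier S" "I \<subseteq> carrier S" "Q \<subseteq> carrier S"
    using P_le primeideal_subset_carrier[OF I_prime] primeideal_subset_carrier[OF Q_prime] by auto
  have det_car: "det ?X \<in> carrier S" using indets_det_generic_matrix by (auto simp: S poly_ring_simps)
  have Y_iff: "p \<in> Y \<longleftrightarrow> primeideal p S \<and> P \<subseteq> p \<and> det ?X \<notin> p" for p
    using rank_at_eq_iff[of p n]
    by (auto simp: Y_def principal_rank_locus_def mem_vanishing_locus_iff S_def P_def)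
  have Y_Q: "Q \<subseteq> p" if "p \<in> Y" for p
  proof
    fix f assume "f \<in> Q"
    then obtain k where f: "f \<in> carrier S" "det ?X ^ k * f \<in> P"
      unfolding Q_def saturated_principal_minor_ideal_def saturation_def P_def S_def
      by (auto simp: matrix_poly_ring_def nat_pow_poly_ring poly_ring_simps)
    have p: "primeideal p S" "P \<subseteq> p" "det ?X \<notin> p" using that Y_iff by blast+
    have f_mem: "det ?X ^ k * f \<in> p" using f(2) p(2) by blast
    have "indets f \<subseteq> ?V" using f(1) by (simp add: S poly_ring_simps)
    from f_mem show "f \<in> p"
    proof (induction k)
      case (Suc k)
      have "indets (det ?X ^ k * f) \<subseteq> ?V"
        using indets_mult[of "det ?X ^ k" f] indets_power[of "det ?X" k] indets_det_generic_matrix \<open>indets f \<subseteq> ?V\<close>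
        by blast
      moreover have "det ?X * (det ?X ^ k * f) \<in> p" using Suc.prems by (simp add: mult.assoc)
      ultimately have "det ?X ^ k * f \<in> p"
        using primeideal_mult_mem[OF p(1)[unfolded S] _ indets_det_generic_matrix] p(3) by blast
      then show ?case by (rule Suc.IH)
    qed simp
  qed
  have "det ?X \<notin> Q"
  proof -
    obtain A :: "'k mat" where A: "A \<in> carrier_mat n n" "det A \<noteq> 0" "\<forall>i<n. A $$ (i, i) = 0"
      using ex_invertible_zero_diag[OF n(2)] by blast
    have x: "1 \<cdot>\<^sub>m adj_mat A \<in> zero_diag_inverse n {..<n}" using A by (intro smult_adj_mat_mem(1)) auto
    have "eval_at (entries n (1 \<cdot>\<^sub>m adj_mat A)) (det ?X) \<noteq> 0"
      unfolding eval_det_generic_matrix[OF comm_ring_hom_id zero_diag_inverseE(1)[OF x]]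
      by (rule zero_diag_inverseE(2)[OF x])
    then show ?thesis using x unfolding Q_eq mem_zero_diag_inverse_ideal by blast
  qed
  then have Q_Y: "Q \<in> Y" using Q_prime P_le(2) Y_iff by blast
  have closure: "zariski S closure_of Y = vanishing_locus S Q"
  proof
    have "Y \<subseteq> vanishing_locus S Q" using Y_Q Y_iff by (auto simp: mem_vanishing_locus_iff)
    then show "zariski S closure_of Y \<subseteq> vanishing_locus S Q"
      by (rule closure_of_minimal) (rule closedin_vanishing_locus[OF carrier(3)])
    obtain J where J: "J \<subseteq> carrier S" "zariski S closure_of Y = vanishing_locus S J"
      using closedin_closure_of[of "zariski S" Y] unfolding closedin_zariski by blast
    have "Y \<subseteq> topspace (zariski S)" using Y_iff by (auto simp: topspace_zariski Spec_def)
    then have "Y \<subseteq> vanishing_locus S J" using closure_of_subset[of Y "zariski S"] J(2) by blast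
    then have "Q \<in> vanishing_locus S J" using Q_Y by (rule subsetD)
    then have "J \<subseteq> Q" by (simp add: mem_vanishing_locus_iff)
    then show "vanishing_locus S Q \<subseteq> zariski S closure_of Y"
      unfolding J(2) subset_iff mem_vanishing_locus_iff by blast
  qed
  have locally_closed: "locally_closedin (zariski S) Y"
  proof -
    have "openin (zariski S) (Spec S - vanishing_locus S {det ?X})"
      unfolding openin_zariski using det_car by blast
    moreover have "Y = (Spec S - vanishing_locus S {det ?X}) \<inter> vanishing_locus S P"
      using Y_iff by (auto simp: mem_vanishing_locus_iff Spec_def)
    ultimately show ?thesis
      unfolding locally_closedin_def using closedin_vanishing_locus[OF carrier(1)] by blast
  qed

  have irr: "irreducible_in (zariski S) (vanishing_locus S I)" "irreducible_in (zariski S) (vanishing_locus S Q)"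
    using irreducible_in_vanishing_locus I_prime Q_prime by blast+
  have cover: "vanishing_locus S P = vanishing_locus S I \<union> vanishing_locus S Q"
    using over_P P_le unfolding set_eq_iff Un_iff mem_vanishing_locus_iff by (meson order.trans)
  have ncomp: "\<not> vanishing_locus S I \<subseteq> vanishing_locus S Q" "\<not> vanishing_locus S Q \<subseteq> vanishing_locus S I"
    using vanishing_locus_subset_iff[OF I_prime] vanishing_locus_subset_iff[OF Q_prime] incomp by blast+
  have sub: "Z \<subseteq> vanishing_locus S I \<or> Z \<subseteq> vanishing_locus S Q"
    if "Z \<subseteq> vanishing_locus S P" "irreducible_in (zariski S) Z" for Z
    using that closedin_vanishing_locus[OF carrier(2)] closedin_vanishing_locus[OF carrier(3)]
    unfolding irreducible_in_def cover by blast
  have components: "irreducible_components (zariski S) (vanishing_locus S P) = {vanishing_locus S I, vanishing_locus S Q}"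
  proof (intro equalityI subsetI)
    fix Z assume "Z \<in> irreducible_components (zariski S) (vanishing_locus S P)"
    then have Z: "Z \<subseteq> vanishing_locus S P" "irreducible_in (zariski S) Z"
      "\<And>Z'. Z' \<subseteq> vanishing_locus S P \<Longrightarrow> irreducible_in (zariski S) Z' \<Longrightarrow> Z \<subseteq> Z' \<Longrightarrow> Z' = Z"
      by (simp_all add: irreducible_components_def)
    show "Z \<in> {vanishing_locus S I, vanishing_locus S Q}"
      using sub[OF Z(1,2)] Z(3)[OF _ irr(1)] Z(3)[OF _ irr(2)] cover by blast
  next
    fix Z assume Z: "Z \<in> {vanishing_locus S I, vanishing_locus S Q}"
    have "Z' = Z" if Z': "Z' \<subseteq> vanishing_locus S P" "irreducible_in (zariski S) Z'" "Z \<subseteq> Z'" for Z'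
      using sub[OF Z'(1,2)] Z'(3) Z ncomp by blast
    then show "Z \<in> irreducible_components (zariski S) (vanishing_locus S P)"
      using Z irr cover unfolding irreducible_components_def by blast
  qed

  have codim_Q: "irreducible_codim (zariski S) (vanishing_locus S Q) \<le> enat n"
  proof -
    obtain y :: "nat \<Rightarrow> 'k matrix_poly" where y: "\<forall>i<n * n - n. indets (y i) \<subseteq> ?V"
      "alg_indep_mod Q y (n * n - n)"
      using alg_indep_off_diagonal[OF n(2)] unfolding Q_eq by blast
    have "card ?V \<le> (n * n - n) + n" by (simp add: card_cartesian_product)
    then show ?thesis
      unfolding S using Q_prime[unfolded S] y by (intro irreducible_codim_le[of _ _ "n * n - n" y]) auto
  qed
  have codim_ge: "enat n \<le> irreducible_codim (zariski S) Z"
    if Z: "closedin (zariski S) Z" "irreducible_in (zariski S) Z" "Z \<subseteq> vanishing_locus S Q" for Z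
  proof -
    define c where "c i = (if i = 0 then Z else vanishing_locus S (zero_diag_inverse_ideal n {..<n - i}))" for i
    have prime: "primeideal (zero_diag_inverse_ideal n {..<n - i} :: 'k matrix_poly set) S" for i
      unfolding S_def by (rule primeideal_zero_diag_inverse_ideal[OF _ n(2)]) auto
    have "closedin (zariski S) (c i) \<and> irreducible_in (zariski S) (c i)" for i
      using Z(1,2) closedin_vanishing_locus[OF primeideal_subset_carrier[OF prime[of i]]]
        irreducible_in_vanishing_locus[OF prime[of i]]
      by (simp add: c_def)
    moreover have "c i \<subset> c (Suc i)" if "i < n" for i
    proof -
      have "Suc (n - Suc i) = n - i" using that by simp
      then have "zero_diag_inverse_ideal n {..<n - Suc i} \<subset> (zero_diag_inverse_ideal n {..<n - i} :: 'k matrix_poly set)"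
        using zero_diag_inverse_ideal_strict_mono[OF n(2), of "n - Suc i", where 'k = 'k] that by simp
      then have "vanishing_locus S (zero_diag_inverse_ideal n {..<n - i}) \<subset> vanishing_locus S (zero_diag_inverse_ideal n {..<n - Suc i})"
        using vanishing_locus_subset_iff[OF prime[of i]] vanishing_locus_subset_iff[OF prime[of "Suc i"]] by blast
      moreover have "c i \<subseteq> vanishing_locus S (zero_diag_inverse_ideal n {..<n - i})"
        using Z(3) by (simp add: c_def Q_eq)
      ultimately show ?thesis unfolding c_def[of "Suc i"] by simp
    qed
    moreover have "c 0 = Z" by (simp add: c_def)
    ultimately show ?thesis
      unfolding irreducible_codim_def by (intro Sup_upper) blast
  qed
  have "codimension (zariski S) Y = enat n"
    unfolding codimension_def closure
  proof (rule antisym)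
    have "closedin (zariski S) (vanishing_locus S Q)" by (rule closedin_vanishing_locus[OF carrier(3)])
    then have "Inf {irreducible_codim (zariski S) Z | Z. closedin (zariski S) Z \<and> irreducible_in (zariski S) Z \<and>
        Z \<subseteq> vanishing_locus S Q} \<le> irreducible_codim (zariski S) (vanishing_locus S Q)"
      using irr(2) by (intro Inf_lower) blast
    also have "\<dots> \<le> enat n" by (rule codim_Q)
    finally show "Inf {irreducible_codim (zariski S) Z | Z. closedin (zariski S) Z \<and> irreducible_in (zariski S) Z \<and>
        Z \<subseteq> vanishing_locus S Q} \<le> enat n" .
    show "enat n \<le> Inf {irreducible_codim (zariski S) Z | Z. closedin (zariski S) Z \<and> irreducible_in (zariski S) Z \<and>
        Z \<subseteq> vanishing_locus S Q}"
      by (rule Inf_greatest) (use codim_ge in blast)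
  qed
  moreover have "I \<noteq> Q" using incomp by blast
  moreover have "vanishing_locus S I \<noteq> vanishing_locus S Q" using ncomp by blast
  ultimately show ?thesis using minimal components locally_closed closure by simp
qed

end
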